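(* Let $N\ge 1$ be an integer, let $\Omega\subset\mathbb{R}^N$ be an open bounded set with Lipschitz boundary, and let $A:\mathbb{R}^N\to\mathbb{R}^N$ be measurable and locally bounded with $A\in C^2(\overline{\Omega})$. Then, for every $u\in H^1_{0,A}(\Omega)$ (extended by $u=0$ on $\mathbb{R}^N\setminus\Omega$), $$\lim_{s\nearrow 1}(1-s)\int_{\mathbb{R}^{2N}}\frac{\big|u(x)-e^{\mathrm{i}(x-y)\cdot A\left(\frac{x+y}{2}\right)}u(y)\big|^2}{|x-y|^{N+2s}}\,dx\,dy=K_N\int_{\Omega}|\nabla u-\mathrm{i}A(x)u|^2\,dx,$$ where $$K_N=\frac12\int_{\mathbb{S}^{N-1}}|\omega\cdot\mathbf{e}|^2\,d\mathcal{H}^{N-1}(\omega),$$ $\mathbb{S}^{N-1}$ is the unit sphere of $\mathbb{R}^N$ and $\mathbf{e}$ is any unit vector in $\mathbb{R}^N$.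
   Context: $\mathrm{i}$ is the imaginary unit and $\mathcal{H}^{N-1}$ is the $(N-1)$-dimensional Hausdorff measure. The limit is over $s\in(0,1)$, $s\to1$. $A\in C^2(\overline\Omega)$ means that the restriction of $A$ to $\Omega$ is of class $C^2$ with all derivatives of order at most 2 extending continuously to $\overline\Omega$ (with the extension of $A$ itself agreeing with $A$ on $\overline{\Omega}$). $L^2(\Omega,\mathbb{C})$ is the space of complex-valued square-integrable functions on $\Omega$. Set $[u]_{H^1_A(\Omega)}:=\big(\int_\Omega|\nabla u-\mathrm{i}A(x)u|^2dx\big)^{1/2}$, with $\nabla u$ the weak gradient; $H^1_A(\Omega)$ is the space of $u\in L^2(\Omega,\mathbb{C})$ with $[u]_{H^1_A(\Omega)}<\infty$, endowed with the norm $\|u\|_{H^1_A(\Omega)}:=\big(\|u\|_{L^2(\Omega)}^2+[u]_{H^1_A(\Omega)}^2\big)^{1/2}$. $H^1_{0,A}(\Omega)$ is the closure of $C^\infty_c(\Omega)$ (complex-valued functions) in $H^1_A(\Omega)$; its elements are regarded as functions on $\mathbb{R}^N$ vanishing on $\mathbb{R}^N\setminus\Omega$. *)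

theory Defs
  imports "HOL-Analysis.Analysis"
begin

text \<open>Hausdorff measure of integer dimension \<open>k\<close>, with the usual normalisation by the volume
  of the \<open>k\<close>-dimensional unit ball. The empty set is treated separately, so that \<open>0 ^ 0 = 1\<close>
  gives the counting measure for \<open>k = 0\<close>; boundedness is required because \<^const>\<open>diameter\<close>
  is meaningless on unbounded sets.\<close>

definition hausdorff_content :: "nat \<Rightarrow> 'a::metric_space set \<Rightarrow> ennreal" where
  "hausdorff_content k C =
     (if C = {} then 0 else ennreal (unit_ball_vol (real k) * (diameter C / 2) ^ k))"

definition hausdorff_premeasure :: "nat \<Rightarrow> real \<Rightarrow> 'a::metric_space set \<Rightarrow> ennreal" where
  "hausdorff_premeasure k \<delta> E =
     (INF C \<in> {C :: nat \<Rightarrow> 'a set. E \<subseteq> (\<Union>i. C i) \<and> (\<forall>i. bounded (C i) \<and> diameter (C i) \<le> \<delta>)}.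
        \<Sum>i. hausdorff_content k (C i))"

definition hausdorff_outer_measure :: "nat \<Rightarrow> 'a::metric_space set \<Rightarrow> ennreal" where
  "hausdorff_outer_measure k E = (SUP \<delta>\<in>{0<..}. hausdorff_premeasure k \<delta> E)"

text \<open>This is a metric outer measure, hence countably additive on the Borel sets.\<close>

definition hausdorff_measure :: "nat \<Rightarrow> 'a::metric_space measure" where
  "hausdorff_measure k = measure_of UNIV (sets borel) (hausdorff_outer_measure k)"


text \<open>\<open>Ck_on k f S\<close>: \<open>f\<close> is of class \<open>C\<^sup>k\<close> on the open set \<open>S\<close>, all iterated
  directional derivatives of order at most \<open>k\<close> being required to exist and be continuous.\<close>

primrec Ck_on :: "nat \<Rightarrow> ('a::real_normed_vector \<Rightarrow> 'b::real_normed_vector) \<Rightarrow> 'a set \<Rightarrow> bool" where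
  "Ck_on 0 f S \<longleftrightarrow> continuous_on S f"
| "Ck_on (Suc k) f S \<longleftrightarrow> (\<forall>x\<in>S. f differentiable (at x)) \<and>
     (\<forall>v. Ck_on k (\<lambda>x. frechet_derivative f (at x) v) S)"

definition extends_to_closure :: "('a::topological_space \<Rightarrow> 'b::topological_space) \<Rightarrow> 'a set \<Rightarrow> bool" where
  "extends_to_closure f S \<longleftrightarrow> (\<exists>g. continuous_on (closure S) g \<and> (\<forall>x\<in>S. g x = f x))"

primrec derivs_extend :: "nat \<Rightarrow> ('a::real_normed_vector \<Rightarrow> 'b::real_normed_vector) \<Rightarrow> 'a set \<Rightarrow> bool" where
  "derivs_extend 0 f S \<longleftrightarrow> extends_to_closure f S"
| "derivs_extend (Suc k) f S \<longleftrightarrow> extends_to_closure f S \<and>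
     (\<forall>v. derivs_extend k (\<lambda>x. frechet_derivative f (at x) v) S)"

text \<open>\<open>f \<in> C\<^sup>k\<close> up to the boundary of the open set \<open>S\<close>. The first conjunct says that the
  continuous extension of \<open>f\<close> itself agrees with the given values of \<open>f\<close> on the closure.\<close>

definition Ck_on_closure :: "nat \<Rightarrow> ('a::real_normed_vector \<Rightarrow> 'b::real_normed_vector) \<Rightarrow> 'a set \<Rightarrow> bool" where
  "Ck_on_closure k f S \<longleftrightarrow> continuous_on (closure S) f \<and> Ck_on k f S \<and> derivs_extend k f S"

definition locally_bounded :: "('a::metric_space \<Rightarrow> 'b::metric_space) \<Rightarrow> bool" where
  "locally_bounded f \<longleftrightarrow> (\<forall>x. \<exists>r>0. bounded (f ` ball x r))"

text \<open>Near each boundary point, \<open>S\<close> is the region above a Lipschitz graph in some unit direction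
  \<open>e\<close>. The graph function lives on the hyperplane orthogonal to \<open>e\<close>, which plays the role of
  the space of one dimension less.\<close>

definition lipschitz_boundary :: "'a::euclidean_space set \<Rightarrow> bool" where
  "lipschitz_boundary S \<longleftrightarrow>
     (\<forall>p\<in>frontier S. \<exists>r>0. \<exists>e L. \<exists>\<gamma>::'a \<Rightarrow> real. norm e = 1 \<and>
        L-lipschitz_on {y. y \<bullet> e = 0} \<gamma> \<and>
        S \<inter> ball p r = {x \<in> ball p r. x \<bullet> e > \<gamma> (x - (x \<bullet> e) *\<^sub>R e)})"


definition test_functions :: "(real^'n) set \<Rightarrow> (real^'n \<Rightarrow> complex) set" where
  "test_functions \<Omega> = {\<phi>. (\<forall>k. Ck_on k \<phi> UNIV) \<and>
     compact (closure {x. \<phi> x \<noteq> 0}) \<and> closure {x. \<phi> x \<noteq> 0} \<subseteq> \<Omega>}"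

definition has_weak_gradient :: "(real^'n \<Rightarrow> complex) \<Rightarrow> (real^'n \<Rightarrow> complex^'n) \<Rightarrow> (real^'n) set \<Rightarrow> bool" where
  "has_weak_gradient u G \<Omega> \<longleftrightarrow>
     (\<forall>K. compact K \<and> K \<subseteq> \<Omega> \<longrightarrow> set_integrable lebesgue K u \<and> set_integrable lebesgue K G) \<and>
     (\<forall>\<phi>\<in>test_functions \<Omega>. \<forall>j.
        (LINT x:\<Omega>|lebesgue. u x * frechet_derivative \<phi> (at x) (axis j 1)) =
        - (LINT x:\<Omega>|lebesgue. G x $ j * \<phi> x))"

text \<open>Determined only up to null sets, and meaningful only if a weak gradient exists.\<close>

definition weak_gradient :: "(real^'n) set \<Rightarrow> (real^'n \<Rightarrow> complex) \<Rightarrow> (real^'n \<Rightarrow> complex^'n)" where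
  "weak_gradient \<Omega> u = (SOME G. has_weak_gradient u G \<Omega>)"

text \<open>The vector field \<open>\<nabla>u - \<i> A u\<close>.\<close>

definition magnetic_gradient ::
    "(real^'n \<Rightarrow> real^'n) \<Rightarrow> (real^'n) set \<Rightarrow> (real^'n \<Rightarrow> complex) \<Rightarrow> real^'n \<Rightarrow> complex^'n" where
  "magnetic_gradient A \<Omega> u x =
     (\<chi> j. weak_gradient \<Omega> u x $ j - \<i> * complex_of_real (A x $ j) * u x)"

definition magnetic_energy ::
    "(real^'n \<Rightarrow> real^'n) \<Rightarrow> (real^'n) set \<Rightarrow> (real^'n \<Rightarrow> complex) \<Rightarrow> ennreal" where
  "magnetic_energy A \<Omega> u =
     (\<integral>\<^sup>+x\<in>\<Omega>. ennreal ((norm (magnetic_gradient A \<Omega> u x))\<^sup>2) \<partial>lebesgue)"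

definition L2_space :: "(real^'n) set \<Rightarrow> (real^'n \<Rightarrow> complex) set" where
  "L2_space \<Omega> = {u. set_borel_measurable lebesgue \<Omega> u \<and>
     set_integrable lebesgue \<Omega> (\<lambda>x. (norm (u x))\<^sup>2)}"

definition H1A_space ::
    "(real^'n \<Rightarrow> real^'n) \<Rightarrow> (real^'n) set \<Rightarrow> (real^'n \<Rightarrow> complex) set" where
  "H1A_space A \<Omega> = {u \<in> L2_space \<Omega>. (\<exists>G. has_weak_gradient u G \<Omega>) \<and> magnetic_energy A \<Omega> u < \<infinity>}"

definition H1A_norm ::
    "(real^'n \<Rightarrow> real^'n) \<Rightarrow> (real^'n) set \<Rightarrow> (real^'n \<Rightarrow> complex) \<Rightarrow> real" where
  "H1A_norm A \<Omega> u =
     sqrt ((LINT x:\<Omega>|lebesgue. (norm (u x))\<^sup>2) + enn2real (magnetic_energy A \<Omega> u))"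

text \<open>The closure of the test functions in \<^const>\<open>H1A_space\<close>. Membership depends only on the
  values of a function inside \<open>\<Omega>\<close>.\<close>

definition H1A0_space ::
    "(real^'n \<Rightarrow> real^'n) \<Rightarrow> (real^'n) set \<Rightarrow> (real^'n \<Rightarrow> complex) set" where
  "H1A0_space A \<Omega> = {u \<in> H1A_space A \<Omega>.
     \<forall>\<epsilon>>0. \<exists>\<phi>\<in>test_functions \<Omega>. H1A_norm A \<Omega> (\<lambda>x. u x - \<phi> x) < \<epsilon>}"

end

theory Submission
  imports Defs "HOL-Computational_Algebra.Polynomial"
begin

text \<open>
  Substituting \<open>y = x + h\<close>, the double integral is the integral over \<open>h\<close> of
  \<open>|h| powr (- N - 2 s)\<close> times the squared \<open>L\<^sup>2\<close> norm of the magnetic difference of \<open>u\<close> at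
  step \<open>h\<close>. This norm is \<open>O(|h|)\<close>, uniformly over the energy space, and the difference is
  \<open>- h \<bullet> (\<nabla> - \<i> A) u + o(|h|)\<close> uniformly for test functions, hence in \<open>L\<^sup>2\<close> for every \<open>u\<close> by
  density. The weights \<open>(1 - s) |h| powr (- N - 2 s)\<close> concentrate at \<open>h = 0\<close> as \<open>s\<close> tends to 1, and
  rotation invariance turns the limit into half of the volume \<open>\<omega>\<close> of the unit ball times the energy.

  The constant requires that the \<open>(N - 1)\<close>-dimensional Hausdorff measure of the unit sphere is
  \<open>N \<omega>\<close>. Both bounds compare the sphere with thin shells around it: from above, efficient ball
  covers of a shell given by Vitali's theorem have slices that on average cover a sphere
  efficiently; from below, the sector of a shell over a small set \<open>C\<close> has, by the Brunn-Minkowski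
  inequality in the form of Prekopa and Leindler, at most the volume of its half-difference set,
  which is nearly contained in a flat cylinder whose base is a ball of diameter that of \<open>C\<close>.
\<close>

section \<open>The Prekopa-Leindler inequality\<close>

text \<open>A lower bound for Hausdorff measure must bound volume by diameter, which is the
  isodiametric inequality, and here it would be wanted on a curved hypersurface. Working with
  sectors of a full-dimensional shell avoids charts and measures on hyperplanes: passing to the
  half-difference set loses no volume, and forces the lateral spread of a sector over a set of
  diameter \<open>d\<close> into a ball of radius nearly \<open>d / 2\<close>.

  On the analytic side, the phase samples \<open>A\<close> at midpoints, which may leave \<Omega>,
  where \<open>A\<close> is only bounded. The pointwise expansion is therefore made for one fixed
  test function, a neighbourhood of whose support lies in \<Omega>. The passage to \<open>u\<close>
  uses a second test function, chosen anew for each \<open>h\<close> and closer to \<open>u\<close>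
  than a small multiple of \<open>norm h\<close>. The bound of order \<open>norm h\<close> is then
  needed for differences of test functions only, and a bound without any decay in \<open>h\<close>
  handles the rest.\<close>

lemma nn_integral_lborel_translate:
  fixes f :: "'a::euclidean_space \<Rightarrow> ennreal"
  assumes [measurable]: "f \<in> borel_measurable borel"
  shows "(\<integral>\<^sup>+x. f (c + x) \<partial>lborel) = (\<integral>\<^sup>+x. f x \<partial>lborel)"
proof -
  have "(\<integral>\<^sup>+x. f x \<partial>lborel) = (\<integral>\<^sup>+x. f x \<partial>distr lborel borel ((+) c))"
    by (simp add: lborel_distr_plus)
  also have "\<dots> = (\<integral>\<^sup>+x. f (c + x) \<partial>lborel)"
    by (subst nn_integral_distr) auto
  finally show ?thesis by simp
qed

lemma nn_integral_indicator_comp: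
  assumes "{x. f x \<in> K} \<in> sets M"
  shows "(\<integral>\<^sup>+x. indicator K (f x) \<partial>M) = emeasure M {x. f x \<in> K}"
proof -
  have "(\<lambda>x. indicator K (f x) :: ennreal) = indicator {x. f x \<in> K}"
    by (auto simp: fun_eq_iff indicator_def)
  then show ?thesis using assms by (simp only: nn_integral_indicator)
qed

lemma emeasure_lborel_translate:
  fixes K :: "'a::euclidean_space set"
  assumes [measurable]: "K \<in> sets borel"
  shows "emeasure lborel {x. x - c \<in> K} = emeasure lborel K"
proof -
  have "emeasure lborel {x. x - c \<in> K} = (\<integral>\<^sup>+x. indicator K (x - c) \<partial>lborel)"
    by (rule nn_integral_indicator_comp[where f="\<lambda>x. x - c" and K=K, symmetric]) measurable
  also have "\<dots> = (\<integral>\<^sup>+x. indicator K x \<partial>lborel)"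
    using nn_integral_lborel_translate[of "\<lambda>x. indicator K (x - c)" c] by simp
  finally show ?thesis by simp
qed

text \<open>The translate of \<open>K\<close> by the minimum of \<open>L\<close> and the translate
  of \<open>L\<close> by the maximum of \<open>K\<close> lie in the sumset and share at most one
  point. Any Borel \<open>H\<close> that contains the sumset is allowed, so measurability of sumsets
  is never at issue; the same device recurs for half-difference sets.\<close>

lemma emeasure_sumset_real_ge:
  fixes K L H :: "real set"
  assumes K: "compact K" "K \<noteq> {}" and L: "compact L" "L \<noteq> {}" and [measurable]: "H \<in> sets borel"
    and sub: "\<And>x y. x \<in> K \<Longrightarrow> y \<in> L \<Longrightarrow> x + y \<in> H"
  shows "emeasure lborel K + emeasure lborel L \<le> emeasure lborel H"
proof -
  obtain b where b: "b \<in> K" "\<And>x. x \<in> K \<Longrightarrow> x \<le> b"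
    using compact_attains_sup[OF K] by blast
  obtain a where a: "a \<in> L" "\<And>x. x \<in> L \<Longrightarrow> a \<le> x"
    using compact_attains_inf[OF L] by blast
  have [measurable]: "K \<in> sets borel" "L \<in> sets borel"
    using K L by (auto intro: borel_compact)
  have null: "{a + b} \<in> null_sets lborel" by (rule countable_imp_null_set_lborel) simp
  have "emeasure lborel ({x. x - b \<in> L} - {a + b}) = emeasure lborel {x. x - b \<in> L}"
    by (rule emeasure_Diff_null_set[OF null]) simp
  then have "emeasure lborel K + emeasure lborel L
      = emeasure lborel {x. x - a \<in> K} + emeasure lborel ({x. x - b \<in> L} - {a + b})"
    by (simp only: emeasure_lborel_translate[OF \<open>K \<in> sets borel\<close>] emeasure_lborel_translate[OF \<open>L \<in> sets borel\<close>])
  also have "\<dots> = emeasure lborel ({x. x - a \<in> K} \<union> ({x. x - b \<in> L} - {a + b}))"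
  proof (rule plus_emeasure)
    have "x = a + b" if "x - a \<in> K" "x - b \<in> L" for x
      using a(2)[OF that(2)] b(2)[OF that(1)] by simp
    then show "{x. x - a \<in> K} \<inter> ({x. x - b \<in> L} - {a + b}) = {}" by blast
    show "{x. x - a \<in> K} \<in> sets lborel" "{x. x - b \<in> L} - {a + b} \<in> sets lborel" by measurable
  qed
  also have "\<dots> \<le> emeasure lborel H"
    using sub[OF _ a(1)] sub[OF b(1)] by (intro emeasure_mono) (auto, force+)
  finally show ?thesis .
qed

lemma emeasure_lborel_inner_compact:
  fixes F :: "'a::euclidean_space set"
  assumes F: "F \<in> sets borel" "bounded F" and e: "e > 0"
  obtains K where "compact K" "K \<subseteq> F" "F \<noteq> {} \<Longrightarrow> K \<noteq> {}" "emeasure lborel F \<le> emeasure lborel K + ennreal e"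
proof -
  obtain T where T: "closed T" "T \<subseteq> F" "(F - T) \<in> lmeasurable" "emeasure lebesgue (F - T) < ennreal e"
    using sets_lebesgue_inner_closed[of F e] F e by auto
  have F_b: "F - T \<in> sets borel" using F T by (auto intro: borel_closed)
  have T_b: "T \<in> sets borel" using T by (auto intro: borel_closed)
  obtain x0 where x0: "F \<noteq> {} \<Longrightarrow> x0 \<in> F" by blast
  \<comment> \<open>The closed kernel \<open>T\<close> may be empty although \<open>F\<close> is
    not. One point of \<open>F\<close> is added, because the sumset bound fails for an empty
    summand.\<close>
  define K where "K = (if F = {} then T else insert x0 T)"
  have "emeasure lborel F = emeasure lborel T + emeasure lborel (F - T)"
    using F T F_b T_b by (subst plus_emeasure) (auto simp: Un_absorb1)
  also have "emeasure lborel (F - T) \<le> ennreal e"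
    using T(4) F_b by simp
  also have "emeasure lborel T \<le> emeasure lborel K"
    using T_b by (intro emeasure_mono) (auto simp: K_def)
  finally have "emeasure lborel F \<le> emeasure lborel K + ennreal e" by simp
  moreover have "compact K"
  proof -
    have "compact T" using F(2) T by (auto simp: compact_eq_bounded_closed intro: bounded_subset)
    then show ?thesis by (auto simp: K_def)
  qed
  moreover have "K \<subseteq> F" using T x0 by (auto simp: K_def)
  ultimately show ?thesis by (intro that) (auto simp: K_def)
qed

lemma emeasure_midpoints_real_bounded:
  fixes F G H :: "real set"
  assumes F: "F \<in> sets borel" "bounded F" "F \<noteq> {}" and G: "G \<in> sets borel" "bounded G" "G \<noteq> {}"
    and [measurable]: "H \<in> sets borel"
    and sub: "\<And>x y. x \<in> F \<Longrightarrow> y \<in> G \<Longrightarrow> (x + y) / 2 \<in> H"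
  shows "emeasure lborel F + emeasure lborel G \<le> 2 * emeasure lborel H"
proof (rule ennreal_le_epsilon)
  fix e :: real assume e: "e > 0"
  then have e2: "e/2 > 0" by simp
  obtain K where K: "compact K" "K \<subseteq> F" "K \<noteq> {}" "emeasure lborel F \<le> emeasure lborel K + ennreal (e/2)"
    using emeasure_lborel_inner_compact[OF F(1,2) e2] F(3) by blast
  obtain L where L: "compact L" "L \<subseteq> G" "L \<noteq> {}" "emeasure lborel G \<le> emeasure lborel L + ennreal (e/2)"
    using emeasure_lborel_inner_compact[OF G(1,2) e2] G(3) by blast
  have "emeasure lborel K + emeasure lborel L \<le> emeasure lborel {z. z / 2 \<in> H}"
    using K L sub by (intro emeasure_sumset_real_ge) auto
  also have "\<dots> = 2 * emeasure lborel H"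
  proof -
    have "emeasure lborel H = (\<integral>\<^sup>+x. indicator H x \<partial>lborel)" by simp
    also have "\<dots> = ennreal (1/2) * (\<integral>\<^sup>+x. indicator H (x / 2) \<partial>lborel)"
      using nn_integral_real_affine[of "indicator H" "1/2" 0] by simp
    also have "(\<integral>\<^sup>+x. indicator H (x / 2) \<partial>lborel) = emeasure lborel {z. z / 2 \<in> H}"
      by (rule nn_integral_indicator_comp[where f="\<lambda>z. z / 2" and K=H]) measurable
    finally have "2 * emeasure lborel H = (2 * ennreal (1/2)) * emeasure lborel {z. z / 2 \<in> H}"
      by (simp add: mult.assoc)
    also have "2 * ennreal (1/2) = 1"
      using ennreal_mult''[of "1/2" 2] by simp
    finally show ?thesis by simp
  qed
  finally have *: "emeasure lborel K + emeasure lborel L \<le> 2 * emeasure lborel H" .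
  have "emeasure lborel F + emeasure lborel G
      \<le> (emeasure lborel K + ennreal (e/2)) + (emeasure lborel L + ennreal (e/2))"
    using K L by (intro add_mono)
  also have "\<dots> = (emeasure lborel K + emeasure lborel L) + ennreal e"
    using e by (simp add: ac_simps flip: ennreal_plus)
  also have "\<dots> \<le> 2 * emeasure lborel H + ennreal e" using * by (intro add_mono) auto
  finally show "emeasure lborel F + emeasure lborel G \<le> 2 * emeasure lborel H + ennreal e" .
qed

lemma emeasure_midpoints_real:
  fixes F G H :: "real set"
  assumes F: "F \<in> sets borel" "F \<noteq> {}" and G: "G \<in> sets borel" "G \<noteq> {}"
    and H: "H \<in> sets borel"
    and sub: "\<And>x y. x \<in> F \<Longrightarrow> y \<in> G \<Longrightarrow> (x + y) / 2 \<in> H"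
  shows "emeasure lborel F + emeasure lborel G \<le> 2 * emeasure lborel H"
proof -
  obtain x0 y0 where x0: "x0 \<in> F" "y0 \<in> G" using F G by blast
  \<comment> \<open>The radius includes \<open>\<bar>x0\<bar>\<close> and
    \<open>\<bar>y0\<bar>\<close>, so that no truncated set is empty.\<close>
  define Q where "Q n = {-(real n + \<bar>x0\<bar> + \<bar>y0\<bar>)..(real n + \<bar>x0\<bar> + \<bar>y0\<bar>)}" for n
  have Q: "incseq (\<lambda>n. S \<inter> Q n)" for S
    by (auto simp: incseq_def Q_def)
  have UQ: "(\<Union>n. S \<inter> Q n) = S" for S
  proof -
    have "\<exists>n. x \<in> Q n" for x
    proof -
      obtain n where "\<bar>x\<bar> \<le> real n" using real_arch_simple by blast
      then show ?thesis by (intro exI[of _ n]) (auto simp: Q_def)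
    qed
    then show ?thesis by blast
  qed
  have lim: "(\<lambda>n. emeasure lborel (S \<inter> Q n)) \<longlonglongrightarrow> emeasure lborel S" if [measurable]: "S \<in> sets borel" for S
  proof -
    have "(\<lambda>n. emeasure lborel (S \<inter> Q n)) \<longlonglongrightarrow> emeasure lborel (\<Union>n. S \<inter> Q n)"
      using Q by (intro Lim_emeasure_incseq) (auto simp: Q_def)
    then show ?thesis by (simp only: UQ)
  qed
  have le: "emeasure lborel (F \<inter> Q n) + emeasure lborel (G \<inter> Q n) \<le> 2 * emeasure lborel H" for n
  proof (rule emeasure_midpoints_real_bounded)
    have "x0 \<in> Q n" "y0 \<in> Q n" by (auto simp: Q_def)
    then show "F \<inter> Q n \<noteq> {}" "G \<inter> Q n \<noteq> {}" using x0 by auto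
    show "F \<inter> Q n \<in> sets borel" "G \<inter> Q n \<in> sets borel" "H \<in> sets borel"
      using F G H by (auto simp: Q_def)
    show "bounded (F \<inter> Q n)" "bounded (G \<inter> Q n)" by (auto simp: Q_def bounded_Int)
    show "(x + y) / 2 \<in> H" if "x \<in> F \<inter> Q n" "y \<in> G \<inter> Q n" for x y
      using that by (auto intro: sub)
  qed
  show ?thesis
    by (rule LIMSEQ_le_const2[OF tendsto_add[OF lim[OF F(1)] lim[OF G(1)]]]) (use le in auto)
qed

text \<open>Layer-cake formula with the levels rescaled to the unit interval, which makes superlevel
  sets of functions with different suprema comparable at the same \<open>t\<close>. The cut at
  \<open>a\<close> lets it apply to a function that is not bounded by \<open>a\<close>.\<close>

lemma nn_integral_min_layers:
  fixes f :: "'a::euclidean_space \<Rightarrow> ennreal"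
  assumes [measurable]: "f \<in> borel_measurable borel" and a: "a > 0"
  shows "(\<integral>\<^sup>+x. min (f x) (ennreal a) \<partial>lborel) =
    ennreal a * (\<integral>\<^sup>+t. indicator {0<..<1} t * emeasure lborel {x. ennreal (t * a) < f x} \<partial>lborel)"
proof -
  have pt: "min v (ennreal a) = ennreal a * (\<integral>\<^sup>+t. indicator {t \<in> {0<..<1}. ennreal (t * a) < v} t \<partial>lborel)" for v
  proof (cases "v \<ge> ennreal a")
    case True
    have "{t \<in> {0<..<1}. ennreal (t * a) < v} = {0<..<1::real}"
    proof safe
      fix t :: real assume "t \<in> {0<..<1}"
      then have "ennreal (t * a) < ennreal a" using a by (intro ennreal_lessI) auto
      then show "ennreal (t * a) < v" using True by simp
    qed
    then show ?thesis using True a by (simp add: min_absorb2)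
  next
    case False
    then obtain r where r: "v = ennreal r" "0 \<le> r"
      by (cases v) auto
    have ra: "r < a" using False r a by (simp add: ennreal_le_iff)
    have "{t \<in> {0<..<1}. ennreal (t * a) < v} = {0<..<r / a}"
    proof (intro set_eqI)
      fix t :: real
      have "t < r / a \<Longrightarrow> t < 1" using ra a by (smt (verit) divide_less_eq_1)
      then show "t \<in> {t \<in> {0<..<1}. ennreal (t * a) < v} \<longleftrightarrow> t \<in> {0<..<r / a}"
        using a r by (auto simp: ennreal_less_iff pos_less_divide_eq)
    qed
    then have "ennreal a * (\<integral>\<^sup>+t. indicator {t \<in> {0<..<1}. ennreal (t * a) < v} t \<partial>lborel) = ennreal a * ennreal (r / a)"
      using a r by simp
    also have "\<dots> = v" using a r by (simp flip: ennreal_mult)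
    finally show ?thesis using False by (simp add: min_absorb1)
  qed
  define I where "I x t = indicator {0<..<1} t * (if ennreal (t * a) < f x then 1 else 0 :: ennreal)" for x and t :: real
  have I[measurable]: "(\<lambda>(x, t). I x t) \<in> borel_measurable (borel \<Otimes>\<^sub>M borel)"
    unfolding I_def by measurable
  have "(\<integral>\<^sup>+x. min (f x) (ennreal a) \<partial>lborel) = (\<integral>\<^sup>+x. ennreal a * (\<integral>\<^sup>+t. I x t \<partial>lborel) \<partial>lborel)"
  proof (rule nn_integral_cong)
    fix x
    have "(\<integral>\<^sup>+t. I x t \<partial>lborel) = (\<integral>\<^sup>+t. indicator {t \<in> {0<..<1}. ennreal (t * a) < f x} t \<partial>lborel)"
      by (rule nn_integral_cong) (simp add: I_def indicator_def)
    then show "min (f x) (ennreal a) = ennreal a * (\<integral>\<^sup>+t. I x t \<partial>lborel)" by (simp only: pt[of "f x"])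
  qed
  also have "\<dots> = ennreal a * (\<integral>\<^sup>+x. (\<integral>\<^sup>+t. I x t \<partial>lborel) \<partial>lborel)"
    by (rule nn_integral_cmult) measurable
  also have "(\<integral>\<^sup>+x. (\<integral>\<^sup>+t. I x t \<partial>lborel) \<partial>lborel) = (\<integral>\<^sup>+t. (\<integral>\<^sup>+x. I x t \<partial>lborel) \<partial>lborel)"
    by (rule lborel_pair.Fubini') measurable
  also have "\<dots> = (\<integral>\<^sup>+t. indicator {0<..<1} t * emeasure lborel {x. ennreal (t * a) < f x} \<partial>lborel)"
  proof (rule nn_integral_cong)
    fix t :: real
    have "(\<integral>\<^sup>+x. I x t \<partial>lborel) = (\<integral>\<^sup>+x. indicator {0<..<1} t * indicator {x. ennreal (t * a) < f x} x \<partial>lborel)"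
      by (rule nn_integral_cong) (simp add: I_def indicator_def)
    also have "\<dots> = indicator {0<..<1} t * emeasure lborel {x. ennreal (t * a) < f x}"
      by (subst nn_integral_cmult_indicator) auto
    finally show "(\<integral>\<^sup>+x. I x t \<partial>lborel) = indicator {0<..<1} t * emeasure lborel {x. ennreal (t * a) < f x}" .
  qed
  finally show ?thesis .
qed

text \<open>The inequality between arithmetic and geometric mean in a form free of roots, valid also
  at infinity.\<close>

lemma ennreal_four_mult_le_sum_square: "4 * (x * y) \<le> (x + y)\<^sup>2" for x y :: ennreal
proof (cases x; cases y)
  fix a b assume *: "x = ennreal a" "0 \<le> a" "y = ennreal b" "0 \<le> b"
  have "4 * (x * y) = ennreal (4 * (a * b))" using * by (simp add: ennreal_mult)
  also have "\<dots> \<le> ennreal ((a + b)\<^sup>2)"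
    using sum_squares_bound[of a b] by (intro ennreal_leI) (simp add: power2_sum)
  also have "\<dots> = (x + y)\<^sup>2" using * by (simp add: ennreal_power flip: ennreal_plus)
  finally show ?thesis .
qed (auto simp: power2_eq_square)

text \<open>The hypothesis is stated with squares, to avoid square roots of extended reals.\<close>

lemma prekopa_leindler_real_bounded:
  fixes f g h :: "real \<Rightarrow> ennreal"
  assumes meas[measurable]: "f \<in> borel_measurable borel" "g \<in> borel_measurable borel" "h \<in> borel_measurable borel"
    and bdd: "\<And>x. f x \<le> ennreal M" "\<And>x. g x \<le> ennreal M"
    and le: "\<And>x y. f x * g y \<le> (h ((x + y) / 2))\<^sup>2"
  shows "(\<integral>\<^sup>+x. f x \<partial>lborel) * (\<integral>\<^sup>+x. g x \<partial>lborel) \<le> (\<integral>\<^sup>+x. h x \<partial>lborel)\<^sup>2"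
proof -
  \<comment> \<open>Below a finite nonzero supremum every superlevel set is nonempty, as the
    estimate for midpoint sets demands.\<close>
  have sup: "\<exists>a>0. (\<forall>x. f x \<le> ennreal a) \<and> (\<forall>t\<in>{0<..<1}. \<exists>x. ennreal (t * a) < f x)"
    if f: "\<And>x. f x \<le> ennreal M" "f x0 \<noteq> 0" for f :: "real \<Rightarrow> ennreal" and x0
  proof -
    have le: "(SUP x. f x) \<le> ennreal M" by (intro SUP_least f)
    then obtain a where a: "(SUP x. f x) = ennreal a" "0 \<le> a"
      by (cases "SUP x. f x") (auto simp: top_unique)
    have up: "f x \<le> ennreal a" for x using a SUP_upper[of x UNIV f] by simp
    have a0: "a > 0" using up[of x0] f(2) a(2) by (cases "a = 0") auto
    have "\<exists>x. ennreal (t * a) < f x" if t: "t \<in> {0<..<1}" for t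
    proof -
      have "ennreal (t * a) < (SUP x. f x)"
        unfolding a using a0 t by (intro ennreal_lessI) auto
      then show ?thesis by (auto simp: less_SUP_iff)
    qed
    then show ?thesis using a0 up by blast
  qed
  show ?thesis
  proof (cases "(\<exists>x. f x \<noteq> 0) \<and> (\<exists>x. g x \<noteq> 0)")
    case False
    then have "f = (\<lambda>_. 0) \<or> g = (\<lambda>_. 0)" by auto
    then show ?thesis by auto
  next
    case True
    obtain a where a: "a > 0" "\<And>x. f x \<le> ennreal a" "\<And>t. t \<in> {0<..<1} \<Longrightarrow> \<exists>x. ennreal (t * a) < f x"
      using sup[of f, OF bdd(1)] True by blast
    obtain b where b: "b > 0" "\<And>x. g x \<le> ennreal b" "\<And>t. t \<in> {0<..<1} \<Longrightarrow> \<exists>x. ennreal (t * b) < g x"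
      using sup[of g, OF bdd(2)] True by blast
    \<comment> \<open>The geometric mean of the suprema: if \<open>f x > t * a\<close> and
      \<open>g y > t * b\<close>, then the square of \<open>h\<close> at the midpoint exceeds
      \<open>(t * c)^2\<close>. Hence one \<open>t\<close> serves all three level sets.\<close>
    define c where "c = sqrt (a * b)"
    have c: "c > 0" "c * c = a * b" using a b by (auto simp: c_def)
    define X where "X = (\<integral>\<^sup>+t. indicator {0<..<1} t * emeasure lborel {x. ennreal (t * a) < f x} \<partial>lborel)"
    define Y where "Y = (\<integral>\<^sup>+t. indicator {0<..<1} t * emeasure lborel {x. ennreal (t * b) < g x} \<partial>lborel)"
    define Z where "Z = (\<integral>\<^sup>+t. indicator {0<..<1} t * emeasure lborel {x. ennreal (t * c) < h x} \<partial>lborel)"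
    have X: "(\<integral>\<^sup>+x. f x \<partial>lborel) = ennreal a * X"
      using nn_integral_min_layers[OF meas(1) a(1)] a(2) by (simp add: X_def min_absorb1)
    have Y: "(\<integral>\<^sup>+x. g x \<partial>lborel) = ennreal b * Y"
      using nn_integral_min_layers[OF meas(2) b(1)] b(2) by (simp add: Y_def min_absorb1)
    have "ennreal c * Z = (\<integral>\<^sup>+x. min (h x) (ennreal c) \<partial>lborel)"
      using nn_integral_min_layers[OF meas(3) c(1)] by (simp add: Z_def)
    also have "\<dots> \<le> (\<integral>\<^sup>+x. h x \<partial>lborel)" by (intro nn_integral_mono) auto
    finally have Z: "ennreal c * Z \<le> (\<integral>\<^sup>+x. h x \<partial>lborel)" .
    have level: "emeasure lborel {x. ennreal (t * a) < f x} + emeasure lborel {x. ennreal (t * b) < g x}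
        \<le> 2 * emeasure lborel {x. ennreal (t * c) < h x}" if t: "t \<in> {0<..<1}" for t
    proof (rule emeasure_midpoints_real)
      fix x y assume xy: "x \<in> {x. ennreal (t * a) < f x}" "y \<in> {x. ennreal (t * b) < g x}"
      obtain p where p: "f x = ennreal p" "p \<ge> 0" using a(2)[of x] by (cases "f x") (auto simp: top_unique)
      obtain q where q: "g y = ennreal q" "q \<ge> 0" using b(2)[of y] by (cases "g y") (auto simp: top_unique)
      have "t * a < p" "t * b < q" using xy p q t a b by (auto simp: ennreal_less_iff)
      moreover have "0 < t * a" "0 < t * b" using t a b by auto
      ultimately have "(t * a) * (t * b) < p * q" by (intro mult_strict_mono) linarith+
      then have "(t * c)\<^sup>2 < p * q" using c by (simp add: power2_eq_square mult.assoc mult.left_commute)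
      then have "(ennreal (t * c))\<^sup>2 < f x * g y"
        using p q c t by (simp add: ennreal_power ennreal_less_iff flip: ennreal_mult)
      then have "(ennreal (t * c))\<^sup>2 < (h ((x + y) / 2))\<^sup>2" using le[of x y] by simp
      then have "ennreal (t * c) < h ((x + y) / 2)"
        by (meson leD leI power_mono zero_le)
      then show "(x + y) / 2 \<in> {x. ennreal (t * c) < h x}" by simp
    qed (use a(3)[OF t] b(3)[OF t] in auto)
    have "X + Y = (\<integral>\<^sup>+t. indicator {0<..<1} t * emeasure lborel {x. ennreal (t * a) < f x}
        + indicator {0<..<1} t * emeasure lborel {x. ennreal (t * b) < g x} \<partial>lborel)"
      unfolding X_def Y_def by (intro nn_integral_add[symmetric]) measurable
    also have "\<dots> \<le> (\<integral>\<^sup>+t. 2 * (indicator {0<..<1} t * emeasure lborel {x. ennreal (t * c) < h x}) \<partial>lborel)"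
      using level by (intro nn_integral_mono) (auto simp: indicator_def)
    also have "\<dots> = 2 * Z"
      unfolding Z_def by (intro nn_integral_cmult) measurable
    finally have XYZ: "X + Y \<le> 2 * Z" .
    \<comment> \<open>The one-dimensional set inequality has produced a bound on the sum
      \<open>X + Y\<close>; the inequality of the means converts it into a bound on the
      product.\<close>
    have "4 * ((\<integral>\<^sup>+x. f x \<partial>lborel) * (\<integral>\<^sup>+x. g x \<partial>lborel)) = ennreal (a * b) * (4 * (X * Y))"
      using a b by (simp add: X Y ennreal_mult ac_simps)
    also have "\<dots> \<le> ennreal (c * c) * (X + Y)\<^sup>2"
      unfolding c by (intro mult_left_mono ennreal_four_mult_le_sum_square) auto
    also have "\<dots> \<le> ennreal (c * c) * (2 * Z)\<^sup>2"
      using XYZ by (intro mult_left_mono power_mono) auto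
    also have "\<dots> = 4 * (ennreal c * Z)\<^sup>2"
      using c(1) by (simp add: power_mult_distrib ennreal_mult power2_eq_square[of "ennreal c"] ac_simps)
    also have "\<dots> \<le> 4 * (\<integral>\<^sup>+x. h x \<partial>lborel)\<^sup>2"
      using Z by (intro mult_left_mono power_mono) auto
    finally show ?thesis by (subst (asm) ennreal_mult_le_mult_iff) auto
  qed
qed

lemma prekopa_leindler_real:
  fixes f g h :: "real \<Rightarrow> ennreal"
  assumes meas[measurable]: "f \<in> borel_measurable borel" "g \<in> borel_measurable borel" "h \<in> borel_measurable borel"
    and le: "\<And>x y. f x * g y \<le> (h ((x + y) / 2))\<^sup>2"
  shows "(\<integral>\<^sup>+x. f x \<partial>lborel) * (\<integral>\<^sup>+x. g x \<partial>lborel) \<le> (\<integral>\<^sup>+x. h x \<partial>lborel)\<^sup>2"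
proof -
  have lim: "(\<lambda>n. \<integral>\<^sup>+x. min (f x) (of_nat n) \<partial>lborel) \<longlonglongrightarrow> (\<integral>\<^sup>+x. f x \<partial>lborel)"
    if [measurable]: "f \<in> borel_measurable borel" for f :: "real \<Rightarrow> ennreal"
  proof -
    have sup: "(SUP n. min (f x) (of_nat n)) = f x" for x
    proof (cases "f x")
      case (real r)
      then obtain n where "f x \<le> of_nat n" using real_arch_simple[of r] by (auto simp: ennreal_of_nat_eq_real_of_nat)
      then have "f x \<le> (SUP n. min (f x) (of_nat n))" by (intro SUP_upper2[of n]) auto
      then show ?thesis by (intro antisym SUP_least) auto
    next
      case top
      then show ?thesis using ennreal_SUP_of_nat_eq_top by (simp add: min_absorb2)
    qed
    have mono: "incseq (\<lambda>n x. min (f x) (of_nat n))"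
      by (intro incseq_SucI le_funI min.mono order.refl of_nat_mono) simp
    have "(\<integral>\<^sup>+x. f x \<partial>lborel) = (SUP n. \<integral>\<^sup>+x. min (f x) (of_nat n) \<partial>lborel)"
      by (subst nn_integral_monotone_convergence_SUP[symmetric, OF mono]) (simp_all add: sup)
    moreover have "incseq (\<lambda>n. \<integral>\<^sup>+x. min (f x) (of_nat n) \<partial>lborel)"
      by (intro incseq_SucI nn_integral_mono min.mono order.refl of_nat_mono) simp
    ultimately show ?thesis using LIMSEQ_SUP by metis
  qed
  have "(\<integral>\<^sup>+x. min (f x) (of_nat n) \<partial>lborel) * (\<integral>\<^sup>+x. min (g x) (of_nat n) \<partial>lborel) \<le> (\<integral>\<^sup>+x. h x \<partial>lborel)\<^sup>2" for n
  proof (rule prekopa_leindler_real_bounded[where M="real n"])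
    fix x y
    have "min (f x) (of_nat n) * min (g y) (of_nat n) \<le> f x * g y" by (intro mult_mono) auto
    then show "min (f x) (of_nat n) * min (g y) (of_nat n) \<le> (h ((x + y) / 2))\<^sup>2" using le[of x y] by simp
  qed (auto simp: ennreal_of_nat_eq_real_of_nat)
  \<comment> \<open>Vanishing factors are excluded because multiplication of extended reals is not
    continuous at zero times infinity; in that case the claim is trivial.\<close>
  moreover have "(\<lambda>n. (\<integral>\<^sup>+x. min (f x) (of_nat n) \<partial>lborel) * (\<integral>\<^sup>+x. min (g x) (of_nat n) \<partial>lborel))
      \<longlonglongrightarrow> (\<integral>\<^sup>+x. f x \<partial>lborel) * (\<integral>\<^sup>+x. g x \<partial>lborel)"
    if "(\<integral>\<^sup>+x. f x \<partial>lborel) \<noteq> 0" "(\<integral>\<^sup>+x. g x \<partial>lborel) \<noteq> 0"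
    using that by (intro tendsto_mult_ennreal lim meas) auto
  ultimately show ?thesis
    by (cases "(\<integral>\<^sup>+x. f x \<partial>lborel) = 0 \<or> (\<integral>\<^sup>+x. g x \<partial>lborel) = 0") (auto intro!: LIMSEQ_le_const2)
qed

text \<open>Induction over the coordinates: when the new coordinate is frozen at \<open>s\<close>,
  \<open>t\<close> and their midpoint, the induction hypothesis says exactly that the three
  marginals satisfy the assumption of the one-dimensional inequality.\<close>

lemma prekopa_leindler_PiM:
  assumes "finite I"
  assumes "f \<in> borel_measurable (PiM I (\<lambda>_. lborel))" "g \<in> borel_measurable (PiM I (\<lambda>_. lborel))"
    "h \<in> borel_measurable (PiM I (\<lambda>_. lborel))"
    and "\<And>x y. x \<in> space (PiM I (\<lambda>_. lborel)) \<Longrightarrow> y \<in> space (PiM I (\<lambda>_. lborel)) \<Longrightarrow>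
      f x * g y \<le> (h (\<lambda>i\<in>I. (x i + y i) / 2))\<^sup>2"
  shows "(\<integral>\<^sup>+x. f x \<partial>PiM I (\<lambda>_. lborel)) * (\<integral>\<^sup>+x. g x \<partial>PiM I (\<lambda>_. lborel))
    \<le> (\<integral>\<^sup>+x. h x \<partial>PiM I (\<lambda>_. lborel :: real measure))\<^sup>2"
  using assms
proof (induction I arbitrary: f g h)
  case empty
  then show ?case by (simp add: PiM_empty nn_integral_count_space_finite restrict_def)
next
  case (insert i I)
  interpret product_sigma_finite "\<lambda>_. lborel :: real measure" by standard
  let ?M = "PiM I (\<lambda>_. lborel :: real measure)"
  have upd: "(\<lambda>x. x(i := t)) \<in> measurable ?M (PiM (insert i I) (\<lambda>_. lborel))" for t :: real
    using insert.hyps by (intro measurable_fun_upd[where J=I]) auto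
  have upd2: "(\<lambda>p. (snd p)(i := fst p)) \<in> measurable (lborel \<Otimes>\<^sub>M ?M) (PiM (insert i I) (\<lambda>_. lborel))"
    using measurable_compose[OF measurable_Pair[OF measurable_snd measurable_fst] measurable_add_dim[of i I "\<lambda>_. lborel"]]
    by simp
  have marg: "(\<lambda>y. \<integral>\<^sup>+x. F (x(i := y)) \<partial>?M) \<in> borel_measurable borel"
    if "F \<in> borel_measurable (PiM (insert i I) (\<lambda>_. lborel))" for F :: "_ \<Rightarrow> ennreal"
  proof -
    interpret M: sigma_finite_measure ?M by (rule sigma_finite) fact
    have "(\<lambda>p. F ((snd p)(i := fst p))) \<in> borel_measurable (lborel \<Otimes>\<^sub>M ?M)"
      using measurable_compose[OF upd2 that] .
    then have "(\<lambda>y. \<integral>\<^sup>+x. F (x(i := y)) \<partial>?M) \<in> borel_measurable lborel"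
      by (intro M.borel_measurable_nn_integral) (simp add: split_beta')
    then show ?thesis by simp
  qed
  have "(\<integral>\<^sup>+y. (\<integral>\<^sup>+x. f (x(i := y)) \<partial>?M) \<partial>lborel) * (\<integral>\<^sup>+y. (\<integral>\<^sup>+x. g (x(i := y)) \<partial>?M) \<partial>lborel)
    \<le> (\<integral>\<^sup>+y. (\<integral>\<^sup>+x. h (x(i := y)) \<partial>?M) \<partial>lborel)\<^sup>2"
  proof (rule prekopa_leindler_real)
    fix s t :: real
    show "(\<integral>\<^sup>+x. f (x(i := s)) \<partial>?M) * (\<integral>\<^sup>+x. g (x(i := t)) \<partial>?M) \<le> (\<integral>\<^sup>+x. h (x(i := (s + t) / 2)) \<partial>?M)\<^sup>2"
    proof (rule insert.IH)
      fix x y assume xy: "x \<in> space ?M" "y \<in> space ?M"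
      have "(\<lambda>j\<in>insert i I. ((x(i := s)) j + (y(i := t)) j) / 2) = (\<lambda>j\<in>I. (x j + y j) / 2)(i := (s + t) / 2)"
        using insert.hyps by (auto simp: fun_eq_iff)
      moreover have "f (x(i := s)) * g (y(i := t)) \<le> (h (\<lambda>j\<in>insert i I. ((x(i := s)) j + (y(i := t)) j) / 2))\<^sup>2"
        using measurable_space[OF upd] xy by (intro insert.prems(4))
      ultimately show "f (x(i := s)) * g (y(i := t)) \<le> (h ((\<lambda>j\<in>I. (x j + y j) / 2)(i := (s + t) / 2)))\<^sup>2"
        by (simp only:)
    qed (intro measurable_compose[OF upd] insert.prems)+
  qed (intro marg insert.prems)+
  then show ?case using insert.hyps insert.prems by (simp add: product_nn_integral_insert_rev)
qed

lemma prekopa_leindler: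
  fixes f g h :: "'a::euclidean_space \<Rightarrow> ennreal"
  assumes [measurable]: "f \<in> borel_measurable borel" "g \<in> borel_measurable borel" "h \<in> borel_measurable borel"
    and le: "\<And>x y. f x * g y \<le> (h ((x + y) /\<^sub>R 2))\<^sup>2"
  shows "(\<integral>\<^sup>+x. f x \<partial>lborel) * (\<integral>\<^sup>+x. g x \<partial>lborel) \<le> (\<integral>\<^sup>+x. h x \<partial>lborel)\<^sup>2"
proof -
  let ?P = "PiM (Basis :: 'a set) (\<lambda>_. lborel :: real measure)"
  let ?s = "\<lambda>f. \<Sum>b\<in>Basis. f b *\<^sub>R b :: 'a"
  have eq: "(\<integral>\<^sup>+x. f x \<partial>lborel) = (\<integral>\<^sup>+x. f (?s x) \<partial>?P)"
    if "f \<in> borel_measurable borel" for f :: "'a \<Rightarrow> ennreal"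
    using that by (subst lborel_eq) (simp add: nn_integral_distr)
  have "(\<integral>\<^sup>+x. f (?s x) \<partial>?P) * (\<integral>\<^sup>+x. g (?s x) \<partial>?P) \<le> (\<integral>\<^sup>+x. h (?s x) \<partial>?P)\<^sup>2"
  proof (rule prekopa_leindler_PiM)
    fix x y
    have "?s (\<lambda>i\<in>Basis. (x i + y i) / 2) = (?s x + ?s y) /\<^sub>R 2"
      by (simp add: scaleR_sum_right sum.distrib[symmetric] scaleR_add_left[symmetric] add_divide_distrib)
    then show "f (?s x) * g (?s y) \<le> (h (?s (\<lambda>i\<in>Basis. (x i + y i) / 2)))\<^sup>2"
      using le by simp
    have s: "?s \<in> measurable ?P borel" by measurable
    show "(\<lambda>x. f (?s x)) \<in> borel_measurable ?P" "(\<lambda>x. g (?s x)) \<in> borel_measurable ?P"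
      "(\<lambda>x. h (?s x)) \<in> borel_measurable ?P"
      by (rule measurable_compose[OF s], fact)+
  qed simp
  then show ?thesis by (simp add: eq)
qed

lemma nn_integral_lborel_uminus:
  fixes f :: "'a::euclidean_space \<Rightarrow> ennreal"
  assumes [measurable]: "f \<in> borel_measurable borel"
  shows "(\<integral>\<^sup>+x. f (- x) \<partial>lborel) = (\<integral>\<^sup>+x. f x \<partial>lborel)"
proof -
  have "(lborel :: 'a measure) = distr lborel borel uminus"
    using lborel_affine[of "-1" "0::'a"] by (simp add: density_1)
  then have "(\<integral>\<^sup>+x. f x \<partial>lborel) = (\<integral>\<^sup>+x. f x \<partial>distr lborel borel uminus)" by simp
  also have "\<dots> = (\<integral>\<^sup>+x. f (- x) \<partial>lborel)"
    by (subst nn_integral_distr) auto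
  finally show ?thesis by simp
qed

lemma ennreal_power2_le_imp_le:
  fixes x y :: ennreal
  assumes "x\<^sup>2 \<le> y\<^sup>2" shows "x \<le> y"
proof (rule ccontr)
  assume "\<not> x \<le> y"
  then have "y < x" by simp
  then obtain r where r: "y = ennreal r" "0 \<le> r" by (cases y) auto
  have "y * y < x * x"
  proof (cases x)
    case (real t)
    then have "r * r < t * t" using r \<open>y < x\<close> by (intro mult_strict_mono) (auto simp: ennreal_less_iff)
    then show ?thesis using r real by (simp add: ennreal_less_iff flip: ennreal_mult)
  next
    case top
    then show ?thesis using r by (simp add: ennreal_mult_less_top flip: ennreal_mult)
  qed
  then show False using assms by (simp add: power2_eq_square)
qed

text \<open>The Brunn-Minkowski inequality for \<open>D\<close> and its reflection, read off from
  indicator functions. It stands in for the isodiametric inequality: a half-difference lies within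
  half the diameter of the origin, whereas \<open>D\<close> itself need not fit into a ball of that
  radius.\<close>

lemma emeasure_le_half_difference_set:
  fixes D E :: "'a::euclidean_space set"
  assumes [measurable]: "D \<in> sets borel" "E \<in> sets borel"
    and sub: "\<And>x y. x \<in> D \<Longrightarrow> y \<in> D \<Longrightarrow> (x - y) /\<^sub>R 2 \<in> E"
  shows "emeasure lborel D \<le> emeasure lborel E"
proof -
  have "(\<integral>\<^sup>+x. indicator D x \<partial>lborel) * (\<integral>\<^sup>+x. indicator D (- x) \<partial>lborel)
      \<le> (\<integral>\<^sup>+x. indicator E x \<partial>lborel)\<^sup>2"
  proof (rule prekopa_leindler)
    fix x y show "indicator D x * indicator D (- y) \<le> (indicator E ((x + y) /\<^sub>R 2) :: ennreal)\<^sup>2"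
      using sub[of x "- y"] by (cases "x \<in> D"; cases "- y \<in> D") simp_all
  qed measurable
  also have "(\<integral>\<^sup>+x. indicator D (- x) \<partial>lborel) = (\<integral>\<^sup>+x. indicator D x \<partial>lborel)"
    by (rule nn_integral_lborel_uminus) measurable
  finally have "(emeasure lborel D)\<^sup>2 \<le> (emeasure lborel E)\<^sup>2" by (simp add: power2_eq_square)
  then show ?thesis by (rule ennreal_power2_le_imp_le)
qed

section \<open>Hausdorff measure\<close>

lemma hausdorff_content_mono:
  assumes "C \<subseteq> D" "bounded D"
  shows "hausdorff_content k C \<le> hausdorff_content k D"
  using assms diameter_subset[OF assms] diameter_ge_0[OF bounded_subset[OF assms(2,1)]]
  by (auto simp: hausdorff_content_def intro!: ennreal_leI mult_left_mono power_mono)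

lemma hausdorff_premeasure_le:
  assumes "E \<subseteq> (\<Union>i. C i)" "\<And>i. bounded (C i)" "\<And>i. diameter (C i) \<le> \<delta>"
  shows "hausdorff_premeasure k \<delta> E \<le> (\<Sum>i. hausdorff_content k (C i))"
  unfolding hausdorff_premeasure_def using assms by (intro INF_lower) auto

lemma hausdorff_premeasure_greatest:
  assumes "\<And>C. E \<subseteq> (\<Union>i. C i) \<Longrightarrow> (\<And>i. bounded (C i)) \<Longrightarrow> (\<And>i. diameter (C i) \<le> \<delta>) \<Longrightarrow>
    c \<le> (\<Sum>i. hausdorff_content k (C i))"
  shows "c \<le> hausdorff_premeasure k \<delta> E"
  unfolding hausdorff_premeasure_def by (rule INF_greatest) (use assms in auto)

lemma hausdorff_premeasure_close:
  assumes "hausdorff_premeasure k \<delta> E < c"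
  obtains C where "E \<subseteq> (\<Union>i. C i)" "\<And>i. bounded (C i)" "\<And>i. diameter (C i) \<le> \<delta>"
    "(\<Sum>i. hausdorff_content k (C i)) < c"
  using assms unfolding hausdorff_premeasure_def INF_less_iff by auto

lemma hausdorff_premeasure_mono:
  "E \<subseteq> F \<Longrightarrow> hausdorff_premeasure k \<delta> E \<le> hausdorff_premeasure k \<delta> F"
  by (rule hausdorff_premeasure_greatest) (auto intro!: hausdorff_premeasure_le)

lemma hausdorff_premeasure_antimono:
  "\<delta> \<le> \<delta>' \<Longrightarrow> hausdorff_premeasure k \<delta>' E \<le> hausdorff_premeasure k \<delta> E"
  by (rule hausdorff_premeasure_greatest) (auto intro!: hausdorff_premeasure_le intro: order_trans)

lemma hausdorff_premeasure_empty: "0 \<le> \<delta> \<Longrightarrow> hausdorff_premeasure k \<delta> {} = 0"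
  using hausdorff_premeasure_le[of "{}" "\<lambda>_. {}" \<delta> k] by (simp add: hausdorff_content_def)

lemma hausdorff_premeasure_UN_le:
  "hausdorff_premeasure k \<delta> (\<Union>n. A n) \<le> (\<Sum>n::nat. hausdorff_premeasure k \<delta> (A n))"
proof (rule ennreal_le_epsilon)
  fix e :: real assume e: "0 < e" and fin: "(\<Sum>n. hausdorff_premeasure k \<delta> (A n)) < top"
  have "hausdorff_premeasure k \<delta> (A n) < hausdorff_premeasure k \<delta> (A n) + e * (1/2)^Suc n" for n
    using e fin by (auto simp add: less_top dest!: ennreal_suminf_lessD)
  then have "\<exists>C. A n \<subseteq> (\<Union>i. C i) \<and> (\<forall>i. bounded (C i)) \<and> (\<forall>i. diameter (C i) \<le> \<delta>) \<and>
      (\<Sum>i. hausdorff_content k (C i)) < hausdorff_premeasure k \<delta> (A n) + e * (1/2)^Suc n" for n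
  proof -
    assume lt: "hausdorff_premeasure k \<delta> (A n) < hausdorff_premeasure k \<delta> (A n) + e * (1/2)^Suc n" for n
    show ?thesis using hausdorff_premeasure_close[OF lt[of n]] by metis
  qed
  then obtain B where B: "\<And>n. A n \<subseteq> (\<Union>i. B n i)" "\<And>n i. bounded (B n i)" "\<And>n i. diameter (B n i) \<le> \<delta>"
      "\<And>n. (\<Sum>i. hausdorff_content k (B n i)) < hausdorff_premeasure k \<delta> (A n) + e * (1/2)^Suc n"
    by metis
  define C where "C n = case_prod B (prod_decode n)" for n
  have "(\<Union>n. A n) \<subseteq> (\<Union>n. C n)"
  proof safe
    fix x n assume "x \<in> A n"
    then obtain i where "x \<in> B n i" using B(1) by blast
    then have "x \<in> C (prod_encode (n, i))" by (simp add: C_def)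
    then show "x \<in> (\<Union>n. C n)" by blast
  qed
  then have "hausdorff_premeasure k \<delta> (\<Union>n. A n) \<le> (\<Sum>n. hausdorff_content k (C n))"
    by (rule hausdorff_premeasure_le) (auto simp: C_def split_beta' B)
  also have "\<dots> = (\<Sum>n. \<Sum>i. hausdorff_content k (B n i))"
    using suminf_ennreal_2dimen[of "\<lambda>n. \<Sum>i. hausdorff_content k (B n i)" "\<lambda>p. hausdorff_content k (case_prod B p)"]
    by (simp add: C_def)
  also have "\<dots> \<le> (\<Sum>n. hausdorff_premeasure k \<delta> (A n) + e * (1/2) ^ Suc n)"
    by (intro suminf_le allI less_imp_le B) auto
  also have "\<dots> = (\<Sum>n. hausdorff_premeasure k \<delta> (A n)) + (\<Sum>n. ennreal e * ennreal ((1/2) ^ Suc n))"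
    using e by (subst suminf_add[symmetric])
               (auto simp del: ennreal_suminf_cmult simp add: ennreal_mult[symmetric])
  also have "\<dots> = (\<Sum>n. hausdorff_premeasure k \<delta> (A n)) + e"
    unfolding ennreal_suminf_cmult
    by (subst suminf_ennreal_eq[OF zero_le_power power_half_series]) auto
  finally show "hausdorff_premeasure k \<delta> (\<Union>n. A n) \<le> (\<Sum>n. hausdorff_premeasure k \<delta> (A n)) + e" .
qed

lemma hausdorff_premeasure_le_outer:
  "0 < \<delta> \<Longrightarrow> hausdorff_premeasure k \<delta> E \<le> hausdorff_outer_measure k E"
  unfolding hausdorff_outer_measure_def by (intro SUP_upper) auto

lemma hausdorff_outer_measure_least:
  "(\<And>\<delta>. 0 < \<delta> \<Longrightarrow> hausdorff_premeasure k \<delta> E \<le> c) \<Longrightarrow> hausdorff_outer_measure k E \<le> c"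
  unfolding hausdorff_outer_measure_def by (intro SUP_least) auto

text \<open>Along these scales the premeasure increases, so the supremum commutes with sums. The
  free factor \<open>d\<close> keeps all scales below a given separation distance.\<close>

lemma hausdorff_outer_measure_SUP:
  assumes "d > 0"
  shows "hausdorff_outer_measure k E = (SUP n. hausdorff_premeasure k (d / real (Suc n)) E)"
proof (rule antisym)
  show "hausdorff_outer_measure k E \<le> (SUP n. hausdorff_premeasure k (d / real (Suc n)) E)"
  proof (rule hausdorff_outer_measure_least)
    fix \<delta> :: real assume \<delta>: "0 < \<delta>"
    obtain n where "d / \<delta> < real n" using reals_Archimedean2 by blast
    then have "d / real (Suc n) \<le> \<delta>" using \<delta> assms by (simp add: field_simps)
    then show "hausdorff_premeasure k \<delta> E \<le> (SUP n. hausdorff_premeasure k (d / real (Suc n)) E)"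
      by (intro SUP_upper2[of n]) (auto intro: hausdorff_premeasure_antimono)
  qed
  show "(SUP n. hausdorff_premeasure k (d / real (Suc n)) E) \<le> hausdorff_outer_measure k E"
    using assms by (intro SUP_least hausdorff_premeasure_le_outer) auto
qed

lemma hausdorff_outer_measure_UN_le:
  "hausdorff_outer_measure k (\<Union>i. A i) \<le> (\<Sum>i::nat. hausdorff_outer_measure k (A i))"
proof (rule hausdorff_outer_measure_least)
  fix \<delta> :: real assume "0 < \<delta>"
  then have "(\<Sum>i. hausdorff_premeasure k \<delta> (A i)) \<le> (\<Sum>i. hausdorff_outer_measure k (A i))"
    by (intro suminf_le allI hausdorff_premeasure_le_outer) auto
  then show "hausdorff_premeasure k \<delta> (\<Union>i. A i) \<le> (\<Sum>i. hausdorff_outer_measure k (A i))"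
    using hausdorff_premeasure_UN_le order_trans by blast
qed

lemma hausdorff_outer_measure_space:
  "outer_measure_space (Pow UNIV) (hausdorff_outer_measure k)"
  unfolding outer_measure_space_def
proof (intro conjI)
  show "positive (Pow UNIV) (hausdorff_outer_measure k)"
    by (auto simp: positive_def hausdorff_outer_measure_def hausdorff_premeasure_empty)
  show "increasing (Pow UNIV) (hausdorff_outer_measure k)"
    by (auto simp: increasing_def intro!: hausdorff_outer_measure_least
        intro: order_trans[OF hausdorff_premeasure_mono hausdorff_premeasure_le_outer])
  show "countably_subadditive (Pow UNIV) (hausdorff_outer_measure k)"
    by (auto simp: countably_subadditive_def hausdorff_outer_measure_UN_le)
qed

lemma hausdorff_outer_measure_mono:
  "E \<subseteq> F \<Longrightarrow> hausdorff_outer_measure k E \<le> hausdorff_outer_measure k F"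
  using hausdorff_outer_measure_space[of k] by (auto simp: outer_measure_space_def increasing_def)

lemma hausdorff_outer_measure_Un_le:
  "hausdorff_outer_measure k (E \<union> F) \<le> hausdorff_outer_measure k E + hausdorff_outer_measure k F"
proof -
  have "hausdorff_outer_measure k {} = 0"
    using hausdorff_outer_measure_space[of k] by (auto simp: outer_measure_space_def positive_def)
  then have "(\<Sum>i. hausdorff_outer_measure k (binaryset E F i)) = hausdorff_outer_measure k E + hausdorff_outer_measure k F"
    by (rule suminf_binaryset_eq)
  then show ?thesis
    using hausdorff_outer_measure_UN_le[of k "binaryset E F"] by (simp add: UN_binaryset_eq)
qed

text \<open>A set of diameter below \<open>d\<close> cannot meet both \<open>P\<close> and
  \<open>Q\<close>, so a fine cover of the union splits into two covers with no set counted
  twice.\<close>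

lemma hausdorff_outer_measure_separated:
  assumes d: "d > 0" and sep: "\<And>x y. x \<in> P \<Longrightarrow> y \<in> Q \<Longrightarrow> d \<le> dist x y"
  shows "hausdorff_outer_measure k P + hausdorff_outer_measure k Q \<le> hausdorff_outer_measure k (P \<union> Q)"
proof -
  have pre: "hausdorff_premeasure k \<delta> P + hausdorff_premeasure k \<delta> Q \<le> hausdorff_outer_measure k (P \<union> Q)"
    if \<delta>: "0 < \<delta>" "\<delta> < d" for \<delta>
  proof -
    have "hausdorff_premeasure k \<delta> P + hausdorff_premeasure k \<delta> Q \<le> hausdorff_premeasure k \<delta> (P \<union> Q)"
    proof (rule hausdorff_premeasure_greatest)
      fix C :: "nat \<Rightarrow> 'a set" assume C: "P \<union> Q \<subseteq> (\<Union>i. C i)" "\<And>i. bounded (C i)" "\<And>i. diameter (C i) \<le> \<delta>"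
      \<comment> \<open>Sets are emptied rather than dropped, to keep the enumeration by naturals;
        the empty set has content 0 even for \<open>k = 0\<close>.\<close>
      define CP where "CP i = (if C i \<inter> P = {} then {} else C i)" for i :: nat
      define CQ where "CQ i = (if C i \<inter> Q = {} then {} else C i)" for i :: nat
      have le: "hausdorff_content k (CP i) + hausdorff_content k (CQ i) \<le> hausdorff_content k (C i)" for i
      proof (cases "C i \<inter> P = {} \<or> C i \<inter> Q = {}")
        case True
        then show ?thesis by (auto simp: CP_def CQ_def hausdorff_content_def)
      next
        case False
        then obtain x y where "x \<in> C i" "x \<in> P" "y \<in> C i" "y \<in> Q" by blast
        then have "d \<le> diameter (C i)"
          using sep diameter_bounded_bound[OF C(2)] by (meson order_trans)
        then show ?thesis using C(3)[of i] \<delta> by simp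
      qed
      have "hausdorff_premeasure k \<delta> P \<le> (\<Sum>i. hausdorff_content k (CP i))"
        using C \<delta> by (intro hausdorff_premeasure_le) (auto simp: CP_def subset_eq disjoint_iff, blast)
      moreover have "hausdorff_premeasure k \<delta> Q \<le> (\<Sum>i. hausdorff_content k (CQ i))"
        using C \<delta> by (intro hausdorff_premeasure_le) (auto simp: CQ_def subset_eq disjoint_iff, blast)
      ultimately have "hausdorff_premeasure k \<delta> P + hausdorff_premeasure k \<delta> Q
          \<le> (\<Sum>i. hausdorff_content k (CP i)) + (\<Sum>i. hausdorff_content k (CQ i))" by (rule add_mono)
      also have "\<dots> = (\<Sum>i. hausdorff_content k (CP i) + hausdorff_content k (CQ i))"
        by (intro suminf_add) auto
      also have "\<dots> \<le> (\<Sum>i. hausdorff_content k (C i))"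
        by (intro suminf_le le) auto
      finally show "hausdorff_premeasure k \<delta> P + hausdorff_premeasure k \<delta> Q \<le> (\<Sum>i. hausdorff_content k (C i))" .
    qed
    also have "\<dots> \<le> hausdorff_outer_measure k (P \<union> Q)"
      using \<delta> by (intro hausdorff_premeasure_le_outer)
    finally show ?thesis .
  qed
  have inc: "incseq (\<lambda>n. hausdorff_premeasure k (d / 2 / real (Suc n)) E)" for E :: "'a set"
    using d by (intro incseq_SucI hausdorff_premeasure_antimono divide_left_mono) auto
  have "hausdorff_outer_measure k P + hausdorff_outer_measure k Q
      = (SUP n. hausdorff_premeasure k (d / 2 / real (Suc n)) P + hausdorff_premeasure k (d / 2 / real (Suc n)) Q)"
    using d by (simp only: hausdorff_outer_measure_SUP[of "d / 2"] half_gt_zero ennreal_SUP_add[OF inc inc])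
  also have "\<dots> \<le> hausdorff_outer_measure k (P \<union> Q)"
  proof (intro SUP_least pre)
    fix n
    show "0 < d / 2 / real (Suc n)" using d by simp
    have "d / 2 / real (Suc n) \<le> d / 2" using d by (simp add: divide_le_eq mult_left_mono)
    then show "d / 2 / real (Suc n) < d" using d by linarith
  qed
  finally show ?thesis .
qed

text \<open>Caratheodory's criterion. The part of \<open>X\<close> close to \<open>F\<close> but
  outside it is cut into rings by distance. Adjacent rings may touch, but rings of equal parity are
  separated, so the measures of the rings have a finite sum and the rings nearest to
  \<open>F\<close> contribute little. What remains, \<open>Y n\<close>, is separated from
  \<open>F\<close>.\<close>

lemma hausdorff_outer_measure_closed_split:
  fixes F X :: "'a::metric_space set"
  assumes F: "closed F"
  shows "hausdorff_outer_measure k (X \<inter> F) + hausdorff_outer_measure k (X - F) \<le> hausdorff_outer_measure k X"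
proof (cases "F = {} \<or> hausdorff_outer_measure k X = top")
  case True
  have "hausdorff_outer_measure k ({}::'a set) = 0"
    using hausdorff_outer_measure_space[of k] by (auto simp: outer_measure_space_def positive_def)
  then show ?thesis using True by auto
next
  case False
  let ?H = "hausdorff_outer_measure k :: 'a set \<Rightarrow> ennreal"
  define a where "a n = 1 / real (Suc n)" for n
  have a_less: "a n < a m" if "m < n" for m n
    using that by (auto simp: a_def intro!: divide_strict_left_mono)
  have a_pos: "a n > 0" for n by (simp add: a_def)
  define R where "R n = {x \<in> X. a (Suc n) \<le> infdist x F \<and> infdist x F < a n}" for n
  define Y where "Y n = {x \<in> X. a n \<le> infdist x F}" for n
  have lip: "infdist y F \<le> infdist x F + dist x y" for x y
    using infdist_triangle[of y F x] by (simp add: dist_commute)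
  have H0: "?H {} = 0"
    using hausdorff_outer_measure_space[of k] by (auto simp: outer_measure_space_def positive_def)
  have alt: "(\<Sum>j<m. ?H (R (2 * j + p))) \<le> ?H (\<Union>j<m. R (2 * j + p))" for m p
  proof (induction m)
    case (Suc m)
    have "(\<Sum>j<Suc m. ?H (R (2 * j + p))) \<le> ?H (\<Union>j<m. R (2 * j + p)) + ?H (R (2 * m + p))"
      using Suc by (simp add: add_mono)
    also have "\<dots> \<le> ?H ((\<Union>j<m. R (2 * j + p)) \<union> R (2 * m + p))"
    \<comment> \<open>Earlier rings of the same parity have distance at least
      \<open>a (2 * m + p - 1)\<close> from \<open>F\<close>, the new ring less than
      \<open>a (2 * m + p)\<close>. For \<open>m = 0\<close> the subtraction of naturals could
      truncate, but then the union is empty.\<close>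
    proof (cases "m = 0")
      case True then show ?thesis by (simp add: H0)
    next
      case False
      show ?thesis
      proof (rule hausdorff_outer_measure_separated[of "a (2 * m + p - 1) - a (2 * m + p)"])
        show "0 < a (2 * m + p - 1) - a (2 * m + p)" using a_less[of "2*m+p-1" "2*m+p"] False by simp
        fix x y assume "x \<in> (\<Union>j<m. R (2 * j + p))" and y: "y \<in> R (2 * m + p)"
        then obtain j where j: "j < m" "x \<in> R (2 * j + p)" by blast
        have "a (2 * m + p - 1) \<le> a (Suc (2 * j + p))"
          using a_less[of "Suc (2 * j + p)" "2*m+p-1"] j
          by (cases "Suc (2 * j + p) = 2*m+p-1") (auto simp: less_le)
        then show "a (2 * m + p - 1) - a (2 * m + p) \<le> dist x y"
          using j y lip[of x y] by (auto simp: R_def dist_commute)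
      qed
    qed
    also have "(\<Union>j<m. R (2 * j + p)) \<union> R (2 * m + p) = (\<Union>j<Suc m. R (2 * j + p))"
      by (auto simp: lessThan_Suc)
    finally show ?case .
  qed (simp add: H0)
  have alt2: "(\<Sum>j<m. ?H (R (2 * j + p))) \<le> ?H X" for m p
    by (rule order_trans[OF alt hausdorff_outer_measure_mono]) (auto simp: R_def)
  have "(\<Sum>j<m. ?H (R j)) \<le> 2 * ?H X" for m
  proof -
    have "(\<Sum>j<m. ?H (R j)) \<le> (\<Sum>j<2 * m. ?H (R j))"
      by (intro sum_mono2) auto
    also have "\<dots> = (\<Sum>j<m. ?H (R (2 * j + 0))) + (\<Sum>j<m. ?H (R (2 * j + 1)))"
      by (induction m) (simp_all add: ac_simps)
    also have "\<dots> \<le> ?H X + ?H X" by (intro add_mono alt2)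
    finally show ?thesis by (simp add: mult_2)
  qed
  then have "(\<Sum>j. ?H (R j)) \<le> 2 * ?H X" by (intro suminf_le_const) auto
  then have sum_fin: "(\<Sum>j. ?H (R j)) \<noteq> top"
    using False by (auto simp: top_unique ennreal_mult_eq_top_iff)
  define r where "r j = enn2real (?H (R j))" for j
  have r: "?H (R j) = ennreal (r j)" "r j \<ge> 0" for j
  proof -
    have "?H (R j) \<le> ?H X" by (rule hausdorff_outer_measure_mono) (auto simp: R_def)
    then have "?H (R j) < top" using False by (simp add: less_top[symmetric] top_unique) (metis top_unique)
    then show "?H (R j) = ennreal (r j)" by (simp add: r_def)
    show "r j \<ge> 0" by (simp add: r_def)
  qed
  have summ: "summable r" using sum_fin r by (intro summable_suminf_not_top) auto
  show ?thesis
  proof (rule ennreal_le_epsilon)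
    fix e :: real assume e: "0 < e"
    obtain n where n: "norm (\<Sum>i. r (i + n)) < e" using suminf_exist_split[OF e summ] by blast
    have sub: "X - F \<subseteq> Y n \<union> (\<Union>i. R (i + n))"
    proof
      fix x assume x: "x \<in> X - F"
      then have pos: "infdist x F > 0"
        using F False in_closed_iff_infdist_zero[of F x] infdist_nonneg[of x F] by (simp add: less_le)
      show "x \<in> Y n \<union> (\<Union>i. R (i + n))"
      proof (cases "a n \<le> infdist x F")
        case True then show ?thesis using x by (auto simp: Y_def)
      next
        case lt: False
        obtain m where "1 / infdist x F < real m" using reals_Archimedean2 by blast
        then have "a m \<le> infdist x F" using pos by (simp add: a_def field_simps)
        \<comment> \<open>The least index with \<open>a m\<close> at most the distance identifies
          the ring of \<open>x\<close>. It exceeds \<open>n\<close> because \<open>x\<close> is too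
          close to \<open>F\<close> to lie in \<open>Y n\<close>.\<close>
        define m where "m = (LEAST m. a m \<le> infdist x F)"
        have m: "a m \<le> infdist x F" unfolding m_def by (rule LeastI) fact
        have "m > n"
        proof (rule ccontr)
          assume "\<not> m > n"
          then have "a n \<le> a m" using a_less[of m n] by (cases "m = n") auto
          then show False using m lt by simp
        qed
        then obtain i where i: "m = Suc (i + n)" by (metis add.commute less_imp_Suc_add)
        have "\<not> a (i + n) \<le> infdist x F" using not_less_Least[of "i + n" "\<lambda>m. a m \<le> infdist x F"] i
          unfolding m_def[symmetric] by simp
        then have "x \<in> R (i + n)" using m i x by (auto simp: R_def)
        then show ?thesis by blast
      qed
    qed
    have sep: "?H (X \<inter> F) + ?H (Y n) \<le> ?H ((X \<inter> F) \<union> Y n)"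
    proof (rule hausdorff_outer_measure_separated[OF a_pos[of n]])
      fix x y assume "x \<in> X \<inter> F" "y \<in> Y n"
      then show "a n \<le> dist x y" using lip[of y x] infdist_zero[of x F] by (auto simp: Y_def)
    qed
    have tail: "(\<Sum>i. ?H (R (i + n))) \<le> ennreal e"
    proof -
      have "(\<Sum>i. ?H (R (i + n))) = ennreal (\<Sum>i. r (i + n))"
        unfolding r using r(2) summ by (intro suminf_ennreal2) (auto simp: summable_iff_shift)
      also have "\<dots> \<le> ennreal e" using n by (intro ennreal_leI) auto
      finally show ?thesis .
    qed
    have "?H (X \<inter> F) + ?H (X - F) \<le> ?H (X \<inter> F) + (?H (Y n) + ?H (\<Union>i. R (i + n)))"
      by (intro add_left_mono order_trans[OF hausdorff_outer_measure_mono[OF sub] hausdorff_outer_measure_Un_le])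
    also have "\<dots> \<le> ?H (X \<inter> F) + (?H (Y n) + ennreal e)"
      by (intro add_left_mono order_trans[OF hausdorff_outer_measure_UN_le] tail)
    also have "\<dots> \<le> ?H ((X \<inter> F) \<union> Y n) + ennreal e"
      using sep by (simp add: add.assoc[symmetric] add_right_mono)
    also have "\<dots> \<le> ?H X + ennreal e"
      by (intro add_right_mono hausdorff_outer_measure_mono) (auto simp: Y_def)
    finally show "?H (X \<inter> F) + ?H (X - F) \<le> ?H X + ennreal e" .
  qed
qed

lemma measure_space_hausdorff:
  "measure_space UNIV (sets borel) (hausdorff_outer_measure k :: 'a::metric_space set \<Rightarrow> ennreal)"
proof -
  interpret P: sigma_algebra UNIV "Pow (UNIV :: 'a set)" by (rule sigma_algebra_Pow)
  let ?L = "lambda_system UNIV (Pow UNIV) (hausdorff_outer_measure k :: 'a set \<Rightarrow> ennreal)"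
  have L: "measure_space UNIV ?L (hausdorff_outer_measure k)"
    by (rule P.caratheodory_lemma[OF hausdorff_outer_measure_space])
  then interpret L: sigma_algebra UNIV ?L by (simp add: measure_space_def)
  have "F \<in> ?L" if "closed F" for F
    unfolding P.lambda_system_eq
  proof (intro CollectI conjI ballI antisym)
    fix X
    show "hausdorff_outer_measure k (X \<inter> F) + hausdorff_outer_measure k (X - F) \<le> hausdorff_outer_measure k X"
      using that by (rule hausdorff_outer_measure_closed_split)
    show "hausdorff_outer_measure k X \<le> hausdorff_outer_measure k (X \<inter> F) + hausdorff_outer_measure k (X - F)"
      using hausdorff_outer_measure_Un_le[of k "X \<inter> F" "X - F"] by (simp add: Int_Diff_Un)
  qed simp
  then have "sigma_sets UNIV {F :: 'a set. closed F} \<subseteq> ?L"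
    by (intro L.sigma_sets_subset) auto
  then have "sets borel \<subseteq> ?L" by (simp add: borel_eq_closed)
  then show ?thesis
    using measure_down[OF L] sets.sigma_algebra_axioms[of "borel :: 'a measure"] by simp
qed

section \<open>Hausdorff measure on Borel sets and its isometry invariance\<close>

lemma sets_hausdorff_measure[simp, measurable_cong]: "sets (hausdorff_measure k) = sets borel"
  unfolding hausdorff_measure_def using sets.sigma_sets_eq[of borel] by simp

lemma space_hausdorff_measure[simp]: "space (hausdorff_measure k) = UNIV"
  unfolding hausdorff_measure_def by simp

lemma emeasure_hausdorff_measure:
  fixes E :: "'a::metric_space set"
  assumes "E \<in> sets borel"
  shows "emeasure (hausdorff_measure k) E = hausdorff_outer_measure k E"
proof (rule emeasure_measure_of[OF hausdorff_measure_def])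
  show "positive (sets (hausdorff_measure k)) (hausdorff_outer_measure k :: 'a set \<Rightarrow> ennreal)"
    "countably_additive (sets (hausdorff_measure k)) (hausdorff_outer_measure k :: 'a set \<Rightarrow> ennreal)"
    using measure_space_hausdorff[of k] by (auto simp: measure_space_def)
qed (use assms in auto)

text \<open>Covers are pushed forward without increasing diameters. Besides isometries, this serves
  the scaling of larger concentric spheres onto the unit sphere.\<close>

lemma hausdorff_premeasure_contraction_image:
  fixes f :: "'a::metric_space \<Rightarrow> 'b::metric_space"
  assumes lip: "\<And>x y. dist (f x) (f y) \<le> dist x y"
  shows "hausdorff_premeasure k \<delta> (f ` E) \<le> hausdorff_premeasure k \<delta> E"
proof (rule hausdorff_premeasure_greatest)
  fix C :: "nat \<Rightarrow> 'a set" assume C: "E \<subseteq> (\<Union>i. C i)" "\<And>i. bounded (C i)" "\<And>i. diameter (C i) \<le> \<delta>"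
  have bdd: "bounded (f ` S)" if "bounded S" for S
  proof -
    from that obtain x d where "\<And>y. y \<in> S \<Longrightarrow> dist x y \<le> d" by (auto simp: bounded_def)
    then show ?thesis unfolding bounded_def using lip by (intro exI[of _ "f x"] exI[of _ d]) (auto intro: order_trans)
  qed
  have diam: "diameter (f ` S) \<le> diameter S" if "bounded S" for S
  proof (cases "S = {}")
    case False
    have "dist (f x) (f y) \<le> diameter S" if "x \<in> S" "y \<in> S" for x y
      using lip[of x y] diameter_bounded_bound[OF \<open>bounded S\<close> that] by simp
    then have "(SUP p\<in>f ` S \<times> f ` S. case_prod dist p) \<le> diameter S"
      using False by (intro cSUP_least) auto
    then show ?thesis using False by (simp add: diameter_def)
  qed simp
  have "hausdorff_premeasure k \<delta> (f ` E) \<le> (\<Sum>i. hausdorff_content k (f ` C i))"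
  proof (rule hausdorff_premeasure_le)
    show "f ` E \<subseteq> (\<Union>i. f ` C i)" using C(1) by blast
    show "bounded (f ` C i)" "diameter (f ` C i) \<le> \<delta>" for i
      using bdd[OF C(2)] order_trans[OF diam[OF C(2)] C(3)] by auto
  qed
  also have "\<dots> \<le> (\<Sum>i. hausdorff_content k (C i))"
  proof (intro suminf_le allI)
    fix i
    show "hausdorff_content k (f ` C i) \<le> hausdorff_content k (C i)"
      using diam[OF C(2)] diameter_ge_0[OF bdd[OF C(2)]]
      by (auto simp: hausdorff_content_def intro!: ennreal_leI mult_left_mono power_mono)
  qed auto
  finally show "hausdorff_premeasure k \<delta> (f ` E) \<le> (\<Sum>i. hausdorff_content k (C i))" .
qed

lemma hausdorff_outer_measure_isometry_image:
  fixes f :: "'a::metric_space \<Rightarrow> 'b::metric_space"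
  assumes iso: "\<And>x y. dist (f x) (f y) = dist x y" and "surj f"
  shows "hausdorff_outer_measure k (f ` E) = hausdorff_outer_measure k E"
proof -
  have "inj f" by (rule injI) (metis iso dist_eq_0_iff)
  then have inv: "inv f ` f ` E = E" by (auto simp: image_image)
  have iso': "dist (inv f x) (inv f y) = dist x y" for x y
    using iso[of "inv f x" "inv f y"] \<open>surj f\<close> by (simp add: surj_f_inv_f)
  have "hausdorff_premeasure k \<delta> (f ` E) = hausdorff_premeasure k \<delta> E" for \<delta>
  proof (rule antisym)
    show "hausdorff_premeasure k \<delta> (f ` E) \<le> hausdorff_premeasure k \<delta> E"
      by (rule hausdorff_premeasure_contraction_image) (simp add: iso)
    show "hausdorff_premeasure k \<delta> E \<le> hausdorff_premeasure k \<delta> (f ` E)"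
      using hausdorff_premeasure_contraction_image[of "inv f" k \<delta> "f ` E"] by (simp add: inv iso')
  qed
  then show ?thesis by (simp add: hausdorff_outer_measure_def)
qed

lemma distr_hausdorff_measure_isometry:
  fixes f :: "'a::metric_space \<Rightarrow> 'a"
  assumes iso: "\<And>x y. dist (f x) (f y) = dist x y" and "surj f"
  shows "distr (hausdorff_measure k) borel f = hausdorff_measure k"
proof (rule measure_eqI)
  have [measurable]: "f \<in> borel_measurable borel"
    by (intro borel_measurable_continuous_onI) (auto simp: continuous_on_iff iso)
  fix E assume "E \<in> sets (distr (hausdorff_measure k) borel f)"
  then have E[measurable]: "E \<in> sets borel" by simp
  have "f -` E \<in> sets borel" using measurable_sets[of f borel borel E] by simp
  moreover have "f ` (f -` E) = E" using \<open>surj f\<close> by (simp add: surj_image_vimage_eq)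
  moreover have "emeasure (distr (hausdorff_measure k) borel f) E = emeasure (hausdorff_measure k) (f -` E)"
    by (subst emeasure_distr) auto
  ultimately show "emeasure (distr (hausdorff_measure k) borel f) E = emeasure (hausdorff_measure k) E"
    using hausdorff_outer_measure_isometry_image[OF assms, of k "f -` E"]
    by (simp add: emeasure_hausdorff_measure E)
qed simp

section \<open>Rotation invariance\<close>

lemma orthogonal_transformation_borel_measurable:
  fixes f :: "'a::euclidean_space \<Rightarrow> 'a"
  assumes "orthogonal_transformation f"
  shows "f \<in> borel_measurable borel"
  using orthogonal_transformation_linear[OF assms]
  by (intro borel_measurable_continuous_onI linear_continuous_on) (simp add: linear_conv_bounded_linear)

lemma dist_orthogonal_transformation:
  assumes "orthogonal_transformation f"
  shows "dist (f x) (f y) = dist x y"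
  using assms by (metis dist_norm linear_diff orthogonal_transformation_def orthogonal_transformation_norm)

lemma orthogonal_transformation_maps:
  fixes a b :: "'a::euclidean_space"
  assumes "norm a = norm b"
  obtains f where "orthogonal_transformation f" "f a = b"
proof (cases "a = b")
  case True
  then show ?thesis using that[of "\<lambda>x. x"] by simp
next
  case False
  define v where "v = a - b"
  \<comment> \<open>The reflection in the hyperplane orthogonal to \<open>a - b\<close>.\<close>
  define f where "f x = x - (2 * (x \<bullet> v) / (v \<bullet> v)) *\<^sub>R v" for x
  have v: "v \<bullet> v \<noteq> 0" using False by (simp add: v_def)
  have "a \<bullet> a = b \<bullet> b" using assms by (simp add: norm_eq)
  then have "2 * (a \<bullet> v) = v \<bullet> v" by (simp add: v_def inner_diff inner_commute)
  then have "f a = b" using v by (simp add: f_def) (simp add: v_def)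
  moreover have "orthogonal_transformation f"
    unfolding orthogonal_transformation_def
  proof (intro conjI allI)
    show "linear f"
      by (intro linearI) (auto simp: f_def inner_add_left add_divide_distrib algebra_simps)
    fix x y
    have "f x \<bullet> f y = x \<bullet> y - 2 * (2 * (x \<bullet> v) * (y \<bullet> v) / (v \<bullet> v))
        + (2 * (x \<bullet> v) / (v \<bullet> v)) * (2 * (y \<bullet> v) / (v \<bullet> v)) * (v \<bullet> v)"
      unfolding f_def by (simp add: inner_diff inner_commute)
    then show "f x \<bullet> f y = x \<bullet> y" using v by simp
  qed
  ultimately show ?thesis by (rule that[rotated])
qed

text \<open>Vitali's theorem exhausts an open set by disjoint balls up to a null set, and an
  orthogonal map takes balls to balls of the same radius. No determinant is involved.\<close>

lemma emeasure_lborel_open_le_orthogonal_image: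
  fixes f :: "'a::euclidean_space \<Rightarrow> 'a"
  assumes f: "orthogonal_transformation f" and U: "open U"
  shows "emeasure lborel U \<le> emeasure lborel (f ` U)"
proof -
  define K where "K = {(x, r). 0 < r \<and> ball x r \<subseteq> U}"
  have bij: "bij f" by (rule orthogonal_transformation_bij[OF f])
  have "\<exists>i. i \<in> K \<and> x \<in> ball (fst i) (snd i) \<and> snd i < d" if x: "x \<in> U" "0 < d" for x d
  proof -
    obtain e where e: "e > 0" "ball x e \<subseteq> U" using U x(1) by (meson openE)
    have "ball x (min e (d / 2)) \<subseteq> ball x e" by auto
    then have "(x, min e (d / 2)) \<in> K" using e x by (auto simp: K_def)
    then show ?thesis using e x by (intro exI[of _ "(x, min e (d / 2))"]) auto
  qed
  then obtain C where C: "countable C" "C \<subseteq> K"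
      "pairwise (\<lambda>i j. disjnt (ball (fst i) (snd i)) (ball (fst j) (snd j))) C"
      "negligible (U - (\<Union>i\<in>C. ball (fst i) (snd i)))"
    by (rule Vitali_covering_theorem_balls)
  let ?B = "\<lambda>i. ball (fst i) (snd i)"
  have img: "f ` ?B i = ball (f (fst i)) (snd i)" for i
    by (rule image_orthogonal_transformation_ball[OF f])
  have disj: "disjoint_family_on ?B C"
    using C(3) by (auto simp: disjoint_family_on_def pairwise_def disjnt_def)
  have disj': "disjoint_family_on (\<lambda>i. f ` ?B i) C"
    using disj bij unfolding disjoint_family_on_def by (auto simp: bij_def image_Int[symmetric])
  have UB: "(\<Union>i\<in>C. ?B i) \<in> sets borel" by (intro borel_open open_UN ballI open_ball)
  have null: "U - (\<Union>i\<in>C. ?B i) \<in> null_sets lborel"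
  proof -
    have "U - (\<Union>i\<in>C. ?B i) \<in> sets borel" by (intro sets.Diff borel_open U open_UN ballI open_ball)
    then show ?thesis using C(4) by (simp add: negligible_iff_null_sets null_sets_completion_iff)
  qed
  have "emeasure lborel U \<le> emeasure lborel ((\<Union>i\<in>C. ?B i) \<union> (U - (\<Union>i\<in>C. ?B i)))"
    using U UB null by (intro emeasure_mono sets.Un) auto
  also have "\<dots> = emeasure lborel (\<Union>i\<in>C. ?B i)"
    using null UB by (intro emeasure_Un_null_set) auto
  also have "\<dots> = (\<integral>\<^sup>+i. emeasure lborel (?B i) \<partial>count_space C)"
    using C(1) disj by (intro emeasure_UN_countable) auto
  also have "\<dots> = (\<integral>\<^sup>+i. emeasure lborel (f ` ?B i) \<partial>count_space C)"
    using C(2) by (intro nn_integral_cong) (auto simp: img emeasure_ball K_def)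
  also have "\<dots> = emeasure lborel (\<Union>i\<in>C. f ` ?B i)"
    using C(1) disj' by (intro emeasure_UN_countable[symmetric]) (auto simp: img)
  also have "\<dots> \<le> emeasure lborel (f ` U)"
  proof (rule emeasure_mono)
    have "?B i \<subseteq> U" if "i \<in> C" for i
    proof -
      have "i \<in> K" using C(2) that by blast
      then show ?thesis by (cases i) (simp add: K_def)
    qed
    then show "(\<Union>i\<in>C. f ` ?B i) \<subseteq> f ` U" by blast
    have "open (f ` U)"
      by (rule open_surjective_linear_image[OF U orthogonal_transformation_linear[OF f] orthogonal_transformation_surj[OF f]])
    then show "f ` U \<in> sets lborel" by simp
  qed
  finally show ?thesis .
qed

lemma distr_lborel_orthogonal:
  fixes f :: "'a::euclidean_space \<Rightarrow> 'a"
  assumes f: "orthogonal_transformation f"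
  shows "distr lborel borel f = lborel"
proof (rule lborel_eqI[symmetric])
  note [measurable] = orthogonal_transformation_borel_measurable[OF f]
  have bij: "bij f" and inv: "orthogonal_transformation (inv f)"
    using f by (auto intro: orthogonal_transformation_bij orthogonal_transformation_inv)
  fix l u :: 'a assume "\<And>b. b \<in> Basis \<Longrightarrow> l \<bullet> b \<le> u \<bullet> b"
  then have "emeasure lborel (box l u) = (\<Prod>b\<in>Basis. (u - l) \<bullet> b)"
    by (simp add: emeasure_lborel_box)
  \<comment> \<open>Equality comes from applying the inequality for open sets both to
    \<open>f\<close> and to its inverse.\<close>
  moreover have "emeasure lborel (box l u) = emeasure lborel (inv f ` box l u)"
  proof (rule antisym)
    show "emeasure lborel (box l u) \<le> emeasure lborel (inv f ` box l u)"
      by (intro emeasure_lborel_open_le_orthogonal_image inv) auto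
    have "open (inv f ` box l u)"
      by (rule open_surjective_linear_image[OF open_box orthogonal_transformation_linear[OF inv] orthogonal_transformation_surj[OF inv]])
    then have "emeasure lborel (inv f ` box l u) \<le> emeasure lborel (f ` (inv f ` box l u))"
      by (intro emeasure_lborel_open_le_orthogonal_image f)
    also have "f ` (inv f ` box l u) = box l u"
      using bij by (simp add: image_f_inv_f bij_is_surj)
    finally show "emeasure lborel (inv f ` box l u) \<le> emeasure lborel (box l u)" .
  qed
  moreover have "inv f ` box l u = f -` box l u" using bij by (simp add: bij_vimage_eq_inv_image)
  moreover have "emeasure (distr lborel borel f) (box l u) = emeasure lborel (f -` box l u)"
    by (subst emeasure_distr) auto
  ultimately show "emeasure (distr lborel borel f) (box l u) = (\<Prod>b\<in>Basis. (u - l) \<bullet> b)"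
    by simp
qed simp

lemma nn_integral_lborel_orthogonal:
  fixes f :: "'a::euclidean_space \<Rightarrow> 'a"
  assumes f: "orthogonal_transformation f" and [measurable]: "g \<in> borel_measurable borel"
  shows "(\<integral>\<^sup>+x. g (f x) \<partial>lborel) = (\<integral>\<^sup>+x. g x \<partial>lborel)"
proof -
  note [measurable] = orthogonal_transformation_borel_measurable[OF f]
  have "(\<integral>\<^sup>+x. g x \<partial>lborel) = (\<integral>\<^sup>+x. g x \<partial>distr lborel borel f)"
    by (simp add: distr_lborel_orthogonal[OF f])
  also have "\<dots> = (\<integral>\<^sup>+x. g (f x) \<partial>lborel)" by (subst nn_integral_distr) auto
  finally show ?thesis by simp
qed

text \<open>The integral is the same for all unit vectors, and over an orthonormal basis the squares
  add up to the squared norm. The general \<open>M\<close> and \<open>g\<close> let one argument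
  serve both Hausdorff measure on the sphere and radial weights against Lebesgue measure.\<close>

lemma nn_integral_inner_square_rotation_invariant:
  fixes M :: "'a::euclidean_space measure" and g :: "real \<Rightarrow> ennreal" and e :: 'a
  assumes M: "sets M = sets borel"
    and inv: "\<And>f. orthogonal_transformation f \<Longrightarrow> distr M borel f = M"
    and [measurable]: "g \<in> borel_measurable borel" and e: "norm e = 1"
  shows "of_nat DIM('a) * (\<integral>\<^sup>+x. ennreal ((x \<bullet> e)\<^sup>2) * g (norm x) \<partial>M) = (\<integral>\<^sup>+x. ennreal ((norm x)\<^sup>2) * g (norm x) \<partial>M)"
proof -
  note [measurable_cong] = M
  let ?I = "\<lambda>e. \<integral>\<^sup>+x. ennreal ((x \<bullet> e)\<^sup>2) * g (norm x) \<partial>M"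
  have eq: "?I b = ?I e" if b: "b \<in> Basis" for b
  proof -
    obtain f where f: "orthogonal_transformation f" "f b = e"
      using orthogonal_transformation_maps[of b e] b e by auto
    have [measurable]: "f \<in> borel_measurable M"
      using orthogonal_transformation_borel_measurable[OF f(1)] by measurable
    have "?I e = (\<integral>\<^sup>+x. ennreal ((x \<bullet> e)\<^sup>2) * g (norm x) \<partial>distr M borel f)"
      by (simp add: inv[OF f(1)])
    also have "\<dots> = (\<integral>\<^sup>+x. ennreal ((f x \<bullet> e)\<^sup>2) * g (norm (f x)) \<partial>M)"
      by (subst nn_integral_distr) auto
    also have "\<dots> = ?I b"
      using f(1) by (simp add: orthogonal_transformation_def orthogonal_transformation_norm[OF f(1)] flip: f(2))
    finally show ?thesis by simp
  qed
  have "of_nat DIM('a) * ?I e = (\<Sum>b\<in>Basis. ?I b)" using eq by simp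
  also have "\<dots> = (\<integral>\<^sup>+x. (\<Sum>b\<in>Basis. ennreal ((x \<bullet> b)\<^sup>2) * g (norm x)) \<partial>M)"
    by (subst nn_integral_sum) auto
  also have "\<dots> = (\<integral>\<^sup>+x. ennreal ((norm x)\<^sup>2) * g (norm x) \<partial>M)"
  proof (intro nn_integral_cong)
    fix x :: 'a
    have "(\<Sum>b\<in>Basis. ennreal ((x \<bullet> b)\<^sup>2) * g (norm x)) = ennreal (\<Sum>b\<in>Basis. (x \<bullet> b)\<^sup>2) * g (norm x)"
      by (simp add: sum_distrib_right[symmetric])
    also have "(\<Sum>b\<in>Basis. (x \<bullet> b)\<^sup>2) = (norm x)\<^sup>2"
      unfolding power2_norm_eq_inner by (subst euclidean_inner) (simp add: power2_eq_square)
    finally show "(\<Sum>b\<in>Basis. ennreal ((x \<bullet> b)\<^sup>2) * g (norm x)) = ennreal ((norm x)\<^sup>2) * g (norm x)" .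
  qed
  finally show ?thesis .
qed

section \<open>Volume of a cylinder\<close>

lemma emeasure_cylinder_Basis_le:
  fixes p :: "'a::euclidean_space"
  assumes p: "p \<in> Basis" and a: "0 \<le> a" and r: "r > 0"
  shows "emeasure lborel {x. \<bar>x \<bullet> p\<bar> \<le> a \<and> norm (x - (x \<bullet> p) *\<^sub>R p) \<le> r}
    \<le> ennreal (2 * a * (unit_ball_vol (real (DIM('a) - 1)) * r ^ (DIM('a) - 1)))"
proof -
  interpret product_sigma_finite "\<lambda>_. lborel :: real measure" by standard
  let ?E = "{x::'a. \<bar>x \<bullet> p\<bar> \<le> a \<and> norm (x - (x \<bullet> p) *\<^sub>R p) \<le> r}"
  let ?A = "Basis - {p}"
  let ?P = "\<lambda>I. PiM I (\<lambda>_. lborel :: real measure)"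
  let ?s = "\<lambda>f. \<Sum>b\<in>Basis. f b *\<^sub>R b :: 'a"
  have E[measurable]: "?E \<in> sets borel" by measurable
  have [measurable]: "?s \<in> measurable (?P Basis) borel" by measurable
  have ins: "insert p ?A = Basis" using p by auto
  \<comment> \<open>The base of the cylinder, as a ball in the coordinates other than
    \<open>p\<close>. Its volume is available in exactly this product form, so no Euclidean type of
    one dimension less is required.\<close>
  let ?D = "{f. sqrt (\<Sum>i\<in>?A. (f i)\<^sup>2) \<le> r} \<inter> space (?P ?A)"
  have eq: "?s (x(p := y)) \<in> ?E \<longleftrightarrow> \<bar>y\<bar> \<le> a \<and> x \<in> ?D" if x: "x \<in> space (?P ?A)" for x y
  proof -
    have inner: "?s f \<bullet> p = f p" for f using p by (rule inner_sum_left_Basis)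
    have "(\<Sum>b\<in>Basis. (x(p := y)) b *\<^sub>R b) = y *\<^sub>R p + (\<Sum>b\<in>?A. x b *\<^sub>R b)"
      using p by (subst sum.remove[of Basis p]) (auto intro!: sum.cong)
    then have diff: "?s (x(p := y)) - y *\<^sub>R p = (\<Sum>b\<in>?A. x b *\<^sub>R b)"
      by (simp only: add_diff_cancel_left')
    have ip: "?s (x(p := y)) \<bullet> p = y"
      using inner[of "x(p := y)"] by (simp only: fun_upd_same)
    have "norm (\<Sum>b\<in>?A. x b *\<^sub>R b) = sqrt (\<Sum>b\<in>?A. (x b)\<^sup>2)"
    proof -
      have "(norm (\<Sum>b\<in>?A. x b *\<^sub>R b))\<^sup>2 = (\<Sum>b\<in>?A. (norm (x b *\<^sub>R b))\<^sup>2)"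
        by (rule norm_sum_Pythagorean) (auto simp: pairwise_def orthogonal_def inner_Basis)
      also have "\<dots> = (\<Sum>b\<in>?A. (x b)\<^sup>2)" by (intro sum.cong) auto
      finally show ?thesis by (metis norm_ge_zero real_sqrt_unique)
    qed
    then have "norm (?s (x(p := y)) - y *\<^sub>R p) = sqrt (\<Sum>b\<in>?A. (x b)\<^sup>2)" by (simp only: diff)
    then show ?thesis unfolding mem_Collect_eq ip using x by simp
  qed
  have "emeasure lborel ?E = (\<integral>\<^sup>+x. indicator ?E x \<partial>lborel)" by simp
  also have "\<dots> = (\<integral>\<^sup>+x. indicator ?E (?s x) \<partial>?P Basis)"
    by (subst lborel_eq, subst nn_integral_distr) simp_all
  also have "\<dots> = (\<integral>\<^sup>+x. indicator ?E (?s x) \<partial>?P (insert p ?A))"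
    by (simp only: ins)
  also have "\<dots> = (\<integral>\<^sup>+y. \<integral>\<^sup>+x. indicator ?E (?s (x(p := y))) \<partial>?P ?A \<partial>lborel)"
    by (intro product_nn_integral_insert_rev) (auto simp: ins)
  also have "\<dots> = (\<integral>\<^sup>+y. \<integral>\<^sup>+x. indicator {-a..a} y * indicator ?D x \<partial>?P ?A \<partial>lborel)"
    by (intro nn_integral_cong) (use eq in \<open>auto simp: indicator_def\<close>)
  also have "\<dots> = (\<integral>\<^sup>+y. indicator {-a..a} y * emeasure (?P ?A) ?D \<partial>lborel)"
    by (intro nn_integral_cong nn_integral_cmult_indicator) measurable
  also have "emeasure (?P ?A) ?D = ennreal (unit_ball_vol (real (card ?A)) * r ^ card ?A)"
    using r by (intro emeasure_cball_aux) auto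
  also have "card ?A = DIM('a) - 1" using p by simp
  also have "(\<integral>\<^sup>+y. indicator {-a..a} y * ennreal (unit_ball_vol (real (DIM('a) - 1)) * r ^ (DIM('a) - 1)) \<partial>lborel)
     = ennreal (2 * a) * ennreal (unit_ball_vol (real (DIM('a) - 1)) * r ^ (DIM('a) - 1))"
    using a by (simp add: nn_integral_multc)
  also have "\<dots> = ennreal (2 * a * (unit_ball_vol (real (DIM('a) - 1)) * r ^ (DIM('a) - 1)))"
    using a r by (subst ennreal_mult) auto
  finally show ?thesis by simp
qed

lemma emeasure_cylinder_le:
  fixes p :: "'a::euclidean_space"
  assumes p: "norm p = 1" and a: "0 \<le> a" and r: "r \<ge> 0"
  shows "emeasure lborel {x. \<bar>x \<bullet> p\<bar> \<le> a \<and> norm (x - (x \<bullet> p) *\<^sub>R p) \<le> r}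
    \<le> ennreal (2 * a * (unit_ball_vol (real (DIM('a) - 1)) * r ^ (DIM('a) - 1)))"
proof -
  let ?E = "\<lambda>p r. {x::'a. \<bar>x \<bullet> p\<bar> \<le> a \<and> norm (x - (x \<bullet> p) *\<^sub>R p) \<le> r}"
  let ?c = "\<lambda>r. 2 * a * (unit_ball_vol (real (DIM('a) - 1)) * r ^ (DIM('a) - 1))"
  obtain b :: 'a where b: "b \<in> Basis" using nonempty_Basis by blast
  obtain f :: "'a \<Rightarrow> 'a" where f: "orthogonal_transformation f" "f b = p"
    using orthogonal_transformation_maps[of b p] b p by auto
  have rot: "emeasure lborel (?E p r) = emeasure lborel (?E b r)" for r
  proof -
    have "f x \<in> ?E p r \<longleftrightarrow> x \<in> ?E b r" for x
    proof -
      have "f x \<bullet> p = x \<bullet> b" using f by (auto simp: orthogonal_transformation_def)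
      moreover have "f x - (x \<bullet> b) *\<^sub>R p = f (x - (x \<bullet> b) *\<^sub>R b)"
        using orthogonal_transformation_linear[OF f(1)] f(2) by (simp add: linear_diff linear_scale)
      ultimately show ?thesis by (simp add: orthogonal_transformation_norm[OF f(1)])
    qed
    then have "(\<integral>\<^sup>+x. indicator (?E p r) (f x) \<partial>lborel) = (\<integral>\<^sup>+x. indicator (?E b r) x \<partial>lborel)"
      by (intro nn_integral_cong) (simp add: indicator_def)
    moreover have "(\<integral>\<^sup>+x. indicator (?E p r) (f x) \<partial>lborel) = (\<integral>\<^sup>+x. indicator (?E p r) x \<partial>lborel)"
      by (rule nn_integral_lborel_orthogonal[OF f(1)]) measurable
    ultimately show ?thesis by simp
  qed
  \<comment> \<open>The coordinate version requires a positive radius. A limit of decreasing radii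
    includes \<open>r = 0\<close>, which occurs for sets of diameter 0.\<close>
  have "emeasure lborel (?E p r) \<le> ennreal (?c (r + inverse (real (Suc n))))" for n
  proof -
    have "emeasure lborel (?E p r) \<le> emeasure lborel (?E p (r + inverse (real (Suc n))))"
    proof (intro emeasure_mono subsetI)
      fix x assume "x \<in> ?E p r"
      moreover have "r \<le> r + inverse (real (Suc n))" by simp
      ultimately show "x \<in> ?E p (r + inverse (real (Suc n)))" by (auto intro: order_trans simp del: of_nat_Suc)
    qed measurable
    also have "\<dots> \<le> ennreal (?c (r + inverse (real (Suc n))))"
      unfolding rot using b a r by (intro emeasure_cylinder_Basis_le) (auto intro: add_nonneg_pos)
    finally show ?thesis .
  qed
  moreover have "(\<lambda>n. ennreal (?c (r + inverse (real (Suc n))))) \<longlonglongrightarrow> ennreal (?c (r + 0))"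
    by (intro tendsto_ennrealI tendsto_mult tendsto_const tendsto_power tendsto_add LIMSEQ_inverse_real_of_nat)
  ultimately show ?thesis by (intro LIMSEQ_le_const[of _ "ennreal (?c r)"]) auto
qed

section \<open>Measure of the sphere\<close>

lemma hausdorff_premeasure_le_countable:
  assumes I: "countable I" and E: "E \<subseteq> (\<Union>i\<in>I. C i)" and C: "\<And>i. i \<in> I \<Longrightarrow> bounded (C i)" "\<And>i. i \<in> I \<Longrightarrow> diameter (C i) \<le> \<delta>"
    and \<delta>: "0 \<le> \<delta>"
  shows "hausdorff_premeasure k \<delta> E \<le> (\<integral>\<^sup>+i. hausdorff_content k (C i) \<partial>count_space I)"
proof -
  define J where "J = to_nat_on I ` I"
  define D where "D n = (if n \<in> J then C (from_nat_into I n) else {})" for n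
  have bij: "bij_betw (to_nat_on I) I J"
    using inj_on_to_nat_on[OF I] by (simp add: J_def bij_betw_def)
  have D: "D (to_nat_on I i) = C i" if "i \<in> I" for i
    using that I by (auto simp: D_def J_def)
  have D2: "D n = {} \<or> (\<exists>i\<in>I. D n = C i)" for n
  proof (cases "n \<in> J")
    case True
    then obtain i where "i \<in> I" "n = to_nat_on I i" by (auto simp: J_def)
    then show ?thesis using D by auto
  qed (simp add: D_def)
  have "hausdorff_premeasure k \<delta> E \<le> (\<Sum>n. hausdorff_content k (D n))"
  proof (rule hausdorff_premeasure_le)
    show "E \<subseteq> (\<Union>n. D n)" using E D by blast
    show "bounded (D n)" for n using D2[of n] C(1) by auto
    show "diameter (D n) \<le> \<delta>" for n using D2[of n] C(2) \<delta> by auto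
  qed
  also have "\<dots> = (\<integral>\<^sup>+n. hausdorff_content k (D n) \<partial>count_space UNIV)"
    by (simp add: nn_integral_count_space_nat)
  also have "\<dots> = (\<integral>\<^sup>+n. hausdorff_content k (D n) * indicator J n \<partial>count_space UNIV)"
    by (intro nn_integral_cong) (auto simp: D_def hausdorff_content_def indicator_def)
  also have "\<dots> = (\<integral>\<^sup>+n. hausdorff_content k (D n) \<partial>count_space J)"
    by (simp add: nn_integral_count_space_indicator)
  also have "\<dots> = (\<integral>\<^sup>+i. hausdorff_content k (D (to_nat_on I i)) \<partial>count_space I)"
    by (rule nn_integral_bij_count_space[OF bij, symmetric])
  also have "\<dots> = (\<integral>\<^sup>+i. hausdorff_content k (C i) \<partial>count_space I)"
    by (intro nn_integral_cong) (simp add: D)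
  finally show ?thesis .
qed

section \<open>Economical covers by balls\<close>

lemma nn_integral_count_space_Un_le:
  "(\<integral>\<^sup>+x. f x \<partial>count_space (A \<union> B)) \<le> (\<integral>\<^sup>+x. f x \<partial>count_space A) + (\<integral>\<^sup>+x. f x \<partial>count_space B)"
proof -
  have "(\<integral>\<^sup>+x. f x \<partial>count_space (A \<union> B)) = (\<integral>\<^sup>+x. f x * indicator (A \<union> B) x \<partial>count_space UNIV)"
    by (rule nn_integral_count_space_indicator) simp
  also have "\<dots> \<le> (\<integral>\<^sup>+x. f x * indicator A x + f x * indicator B x \<partial>count_space UNIV)"
    by (intro nn_integral_mono) (auto simp: indicator_def)
  also have "\<dots> = (\<integral>\<^sup>+x. f x * indicator A x \<partial>count_space UNIV) + (\<integral>\<^sup>+x. f x * indicator B x \<partial>count_space UNIV)"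
    by (rule nn_integral_add) auto
  also have "\<dots> = (\<integral>\<^sup>+x. f x \<partial>count_space A) + (\<integral>\<^sup>+x. f x \<partial>count_space B)"
    by (simp add: nn_integral_count_space_indicator)
  finally show ?thesis .
qed

text \<open>The balls from Vitali's theorem miss a null set, which is covered by the enlarged balls of
  the covering lemma applied inside an open set of small measure.\<close>

lemma efficient_ball_covering:
  fixes U :: "'a::euclidean_space set"
  assumes U: "open U" and \<delta>: "\<delta> > 0" and \<epsilon>: "\<epsilon> > 0"
  obtains C :: "('a \<times> real) set" where "countable C" "U \<subseteq> (\<Union>(x, r)\<in>C. cball x r)"
    "\<And>x r. (x, r) \<in> C \<Longrightarrow> x \<in> U \<and> 0 < r \<and> r \<le> \<delta>"
    "(\<integral>\<^sup>+(x, r). emeasure lborel (cball x r) \<partial>count_space C) \<le> emeasure lborel U + ennreal \<epsilon>"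
proof -
  let ?B = "\<lambda>i :: 'a \<times> real. cball (fst i) (snd i)"
  have fine: "\<exists>i. i \<in> {(x, r). x \<in> W \<and> 0 < r \<and> r \<le> \<delta> \<and> cball x r \<subseteq> V} \<and> x \<in> ?B i \<and> snd i < d"
    if x: "x \<in> W" "W \<subseteq> V" "open V" "0 < d" for x d W V
  proof -
    obtain e where e: "e > 0" "cball x e \<subseteq> V" using x by (meson open_contains_cball subsetD)
    have "cball x (min e (min (d / 2) \<delta>)) \<subseteq> cball x e" by auto
    then have "(x, min e (min (d / 2) \<delta>)) \<in> {(x, r). x \<in> W \<and> 0 < r \<and> r \<le> \<delta> \<and> cball x r \<subseteq> V}"
      using e x \<delta> by auto
    then show ?thesis using e x \<delta> by (intro exI[of _ "(x, min e (min (d / 2) \<delta>))"]) auto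
  qed
  let ?K = "{(x, r). x \<in> U \<and> 0 < r \<and> r \<le> \<delta> \<and> cball x r \<subseteq> U}"
  obtain C1 where C1: "countable C1" "C1 \<subseteq> ?K" "pairwise (\<lambda>i j. disjnt (?B i) (?B j)) C1"
      "negligible (U - (\<Union>i\<in>C1. ?B i))"
  proof (rule Vitali_covering_theorem_cballs[of ?K snd U fst])
    show "0 < snd i" if "i \<in> ?K" for i using that by auto
    show "\<exists>i. i \<in> ?K \<and> x \<in> ?B i \<and> snd i < d" if "x \<in> U" "0 < d" for x d
      using fine[OF that(1) order.refl U that(2)] .
  qed
  define Z where "Z = U - (\<Union>i\<in>C1. ?B i)"
  have Z_b: "Z \<in> sets borel" unfolding Z_def
    by (intro sets.Diff borel_open U sets.countable_UN''[OF C1(1)] borel_closed closed_cball)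
  then have Z_null: "emeasure lborel Z = 0"
    using C1(4) by (simp add: Z_def[symmetric] negligible_iff_null_sets null_sets_completion_iff null_sets_def)
  \<comment> \<open>Enlarging radii by the factor 5 multiplies volumes by
    \<open>5 ^ DIM('a)\<close>, which is compensated in advance.\<close>
  define \<epsilon>' where "\<epsilon>' = \<epsilon> / 5 ^ DIM('a)"
  have \<epsilon>': "\<epsilon>' > 0" using \<epsilon> by (simp add: \<epsilon>'_def)
  have "Z \<in> sets lebesgue" using Z_b by simp
  then obtain T where T: "open T" "Z \<subseteq> T" "emeasure lebesgue (T - Z) < ennreal \<epsilon>'"
    using sets_lebesgue_outer_open[OF _ \<epsilon>'] by metis
  have "T - Z \<in> sets borel" using T Z_b by auto
  then have "emeasure lborel ((T - Z) \<union> Z) \<le> emeasure lborel (T - Z) + emeasure lborel Z"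
    using Z_b by (intro emeasure_subadditive) auto
  moreover have "(T - Z) \<union> Z = T" using T by auto
  ultimately have "emeasure lborel T \<le> emeasure lborel (T - Z) + emeasure lborel Z" by simp
  then have T_le: "emeasure lborel T \<le> ennreal \<epsilon>'"
    using T(3) \<open>T - Z \<in> sets borel\<close> Z_null by (simp add: emeasure_completion less_imp_le)
  \<comment> \<open>Radii at most \<open>\<delta> / 5\<close> respect the bound \<delta> after
    enlargement, and centres in \<open>Z\<close> are still points of \<open>U\<close>.\<close>
  define K2 where "K2 = {(x, r). x \<in> Z \<and> 0 < r \<and> r \<le> \<delta> / 5 \<and> cball x r \<subseteq> T}"
  have K2: "fst i \<in> Z" "0 < snd i" "snd i \<le> \<delta> / 5" "?B i \<subseteq> T" if "i \<in> K2" for i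
    using that by (auto simp: K2_def split_beta')
  have cover: "Z \<subseteq> (\<Union>i\<in>K2. ?B i)"
  proof
    fix x assume x: "x \<in> Z"
    then obtain e where e: "e > 0" "cball x e \<subseteq> T" using T by (meson open_contains_cball subsetD)
    have "cball x (min e (\<delta> / 5)) \<subseteq> cball x e" by auto
    then have "(x, min e (\<delta> / 5)) \<in> K2" using x e \<delta> by (auto simp: K2_def)
    moreover have "x \<in> ?B (x, min e (\<delta> / 5))" using e \<delta> by simp
    ultimately show "x \<in> (\<Union>i\<in>K2. ?B i)" by blast
  qed
  obtain C2 where C2: "countable C2" "C2 \<subseteq> K2" "pairwise (\<lambda>i j. disjnt (?B i) (?B j)) C2"
      "Z \<subseteq> (\<Union>i\<in>C2. cball (fst i) (5 * snd i))"
  proof (rule Vitali_covering_lemma_cballs[OF cover, of "\<delta> / 5"])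
    show "0 < snd i \<and> snd i \<le> \<delta> / 5" if "i \<in> K2" for i using K2(2,3) that by auto
  qed
  have sum_le: "(\<integral>\<^sup>+i. emeasure lborel (?B i) \<partial>count_space C) \<le> emeasure lborel V"
    if "countable C" "pairwise (\<lambda>i j. disjnt (?B i) (?B j)) C" "\<And>i. i \<in> C \<Longrightarrow> ?B i \<subseteq> V" "open V" for C V
  proof -
    have "(\<integral>\<^sup>+i. emeasure lborel (?B i) \<partial>count_space C) = emeasure lborel (\<Union>i\<in>C. ?B i)"
      using that by (intro emeasure_UN_countable[symmetric])
        (auto simp: disjoint_family_on_def pairwise_def disjnt_def)
    also have "\<dots> \<le> emeasure lborel V" using that by (intro emeasure_mono) auto
    finally show ?thesis .
  qed
  define C3 where "C3 = (\<lambda>(x, r). (x, 5 * r)) ` C2"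
  have inj: "inj_on (\<lambda>(x, r). (x, 5 * r)) C2" by (auto simp: inj_on_def)
  have "(\<integral>\<^sup>+i. emeasure lborel (?B i) \<partial>count_space C3)
      = (\<integral>\<^sup>+i. emeasure lborel (?B ((\<lambda>(x, r). (x, 5 * r)) i)) \<partial>count_space C2)"
    using inj by (intro nn_integral_bij_count_space[symmetric]) (simp add: C3_def bij_betw_def)
  also have "\<dots> = (\<integral>\<^sup>+i. ennreal (5 ^ DIM('a)) * emeasure lborel (?B i) \<partial>count_space C2)"
  proof (intro nn_integral_cong)
    fix i assume "i \<in> space (count_space C2)"
    then have "i \<in> K2" using C2(2) by auto
    then have "0 < snd i" by (rule K2(2))
    then obtain x r where i: "i = (x, r)" "0 < r" by (cases i) auto
    then show "emeasure lborel (?B ((\<lambda>(x, r). (x, 5 * r)) i)) = ennreal (5 ^ DIM('a)) * emeasure lborel (?B i)"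
      by (simp add: emeasure_cball power_mult_distrib ennreal_mult[symmetric] ac_simps)
  qed
  also have "\<dots> = ennreal (5 ^ DIM('a)) * (\<integral>\<^sup>+i. emeasure lborel (?B i) \<partial>count_space C2)"
    by (rule nn_integral_cmult) auto
  also have "\<dots> \<le> ennreal (5 ^ DIM('a)) * ennreal \<epsilon>'"
  proof (rule mult_left_mono)
    have "(\<integral>\<^sup>+i. emeasure lborel (?B i) \<partial>count_space C2) \<le> emeasure lborel T"
      using C2(2) K2(4) by (intro sum_le C2 T) blast
    then show "(\<integral>\<^sup>+i. emeasure lborel (?B i) \<partial>count_space C2) \<le> ennreal \<epsilon>'" using T_le by simp
  qed simp
  also have "\<dots> = ennreal \<epsilon>" using \<epsilon> by (simp add: \<epsilon>'_def ennreal_mult[symmetric])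
  finally have C3_le: "(\<integral>\<^sup>+i. emeasure lborel (?B i) \<partial>count_space C3) \<le> ennreal \<epsilon>" .
  show ?thesis
  proof (rule that[of "C1 \<union> C3"])
    show "countable (C1 \<union> C3)" using C1 C2 by (simp add: C3_def)
    have "U \<subseteq> (\<Union>i\<in>C1. ?B i) \<union> Z" by (auto simp: Z_def)
    also have "\<dots> \<subseteq> (\<Union>i\<in>C1. ?B i) \<union> (\<Union>i\<in>C3. ?B i)" using C2(4) by (intro Un_mono) (auto simp: C3_def split_beta')
    finally show "U \<subseteq> (\<Union>(x, r)\<in>C1 \<union> C3. cball x r)" by (auto simp: split_beta')
    show "x \<in> U \<and> 0 < r \<and> r \<le> \<delta>" if "(x, r) \<in> C1 \<union> C3" for x r
    proof (cases "(x, r) \<in> C1")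
      case True
      then have "(x, r) \<in> ?K" using C1(2) by blast
      then show ?thesis by simp
    next
      case False
      then have "(x, r / 5) \<in> C2" using that by (auto simp: C3_def)
      then have "(x, r / 5) \<in> K2" using C2(2) by blast
      then show ?thesis using K2[of "(x, r / 5)"] by (simp add: Z_def)
    qed
    have "(\<integral>\<^sup>+i. emeasure lborel (?B i) \<partial>count_space (C1 \<union> C3)) \<le> emeasure lborel U + ennreal \<epsilon>"
    proof (rule order_trans[OF nn_integral_count_space_Un_le])
      have C1U: "?B i \<subseteq> U" if "i \<in> C1" for i
      proof -
        have "i \<in> ?K" using C1(2) that by blast
        then show ?thesis by (cases i) simp
      qed
      have "(\<integral>\<^sup>+i. emeasure lborel (?B i) \<partial>count_space C1) \<le> emeasure lborel U"
        by (intro sum_le C1 U C1U)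
      then show "(\<integral>\<^sup>+i. emeasure lborel (?B i) \<partial>count_space C1) + (\<integral>\<^sup>+i. emeasure lborel (?B i) \<partial>count_space C3)
        \<le> emeasure lborel U + ennreal \<epsilon>" using C3_le by (rule add_mono)
    qed
    then show "(\<integral>\<^sup>+(x, r). emeasure lborel (cball x r) \<partial>count_space (C1 \<union> C3)) \<le> emeasure lborel U + ennreal \<epsilon>"
      by (simp add: split_beta')
  qed
qed

section \<open>Upper bound for the sphere by slicing covers of a shell\<close>

lemma sphere_Int_cball_subset:
  fixes x :: "'a::real_inner"
  assumes x: "norm x > 0" and t: "t > 0"
  shows "sphere 0 t \<inter> cball x r \<subseteq> (if \<bar>t - norm x\<bar> \<le> r then cball ((t / norm x) *\<^sub>R x) (sqrt (t / norm x) * sqrt (r\<^sup>2 - (t - norm x)\<^sup>2)) else {})"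
proof
  fix y assume y: "y \<in> sphere 0 t \<inter> cball x r"
  let ?\<rho> = "norm x"
  have ny: "norm y = t" "norm (y - x) \<le> r" using y by (auto simp: dist_norm norm_minus_commute)
  have ge: "\<bar>t - ?\<rho>\<bar> \<le> r" using norm_triangle_ineq3[of y x] ny by simp
  have "(norm (y - x))\<^sup>2 \<le> r\<^sup>2" using ny by (intro power_mono) auto
  then have 1: "t\<^sup>2 + ?\<rho>\<^sup>2 - 2 * (x \<bullet> y) \<le> r\<^sup>2"
    using ny by (simp add: power2_norm_eq_inner inner_diff inner_commute algebra_simps flip: ny(1))
  \<comment> \<open>The covering ball is centred at the radial projection of \<open>x\<close> to the
    sphere. The squared distance of \<open>y\<close> to it equals \<open>t / norm x\<close> times
    \<open>(norm (y - x))^2 - (t - norm x)^2\<close>, so in a thin shell the radius differs from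
    that of a flat slice at height \<open>t - norm x\<close> only by a factor near 1.\<close>
  have "(dist ((t / ?\<rho>) *\<^sub>R x) y)\<^sup>2 = (t / ?\<rho>)\<^sup>2 * ?\<rho>\<^sup>2 + t\<^sup>2 - 2 * (t / ?\<rho>) * (x \<bullet> y)"
    unfolding dist_norm ny(1)[symmetric] power2_norm_eq_inner
    by (simp add: inner_diff inner_commute power2_eq_square algebra_simps)
  also have "\<dots> = 2 * t\<^sup>2 - 2 * (t / ?\<rho>) * (x \<bullet> y)"
    using x by (simp add: power_divide)
  also have "\<dots> = (t / ?\<rho>) * (2 * t * ?\<rho> - 2 * (x \<bullet> y))"
    using x by (simp add: field_simps power2_eq_square)
  also have "\<dots> \<le> (t / ?\<rho>) * (r\<^sup>2 - (t - ?\<rho>)\<^sup>2)"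
    using 1 x t by (intro mult_left_mono) (auto simp: power2_diff)
  finally have "dist ((t / ?\<rho>) *\<^sub>R x) y \<le> sqrt (t / ?\<rho>) * sqrt (r\<^sup>2 - (t - ?\<rho>)\<^sup>2)"
    by (simp add: real_le_rsqrt real_sqrt_mult[symmetric])
  then show "y \<in> (if \<bar>t - ?\<rho>\<bar> \<le> r then cball ((t / ?\<rho>) *\<^sub>R x) (sqrt (t / ?\<rho>) * sqrt (r\<^sup>2 - (t - ?\<rho>)\<^sup>2)) else {})"
    using ge by simp
qed

text \<open>The volume of a ball of dimension \<open>Suc k\<close> from its flat
  \<open>k\<close>-dimensional slices; a Beta integral gives the recursion for
  \<open>unit_ball_vol\<close>. It adds the slice bounds up to exactly the volume of each covering
  ball, so nothing is lost in this step.\<close>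

lemma nn_integral_ball_slices:
  assumes r: "r > 0"
  shows "(\<integral>\<^sup>+t. ennreal (unit_ball_vol (real k) * (indicator {c - r..c + r} t * sqrt (r\<^sup>2 - (t - c)\<^sup>2) ^ k)) \<partial>lborel)
    = ennreal (unit_ball_vol (real (Suc k)) * r ^ Suc k)"
proof -
  let ?f = "\<lambda>t. ennreal (unit_ball_vol (real k) * (indicator {c - r..c + r} t * sqrt (r\<^sup>2 - (t - c)\<^sup>2) ^ k))"
  have [measurable]: "?f \<in> borel_measurable borel" by measurable
  have pt: "?f (c + r * x) = ennreal (unit_ball_vol (real k) * r ^ k) * ennreal (indicator {-1..1} x * sqrt (1 - x\<^sup>2) ^ k)" for x
  proof -
    have "r\<^sup>2 - (c + r * x - c)\<^sup>2 = r\<^sup>2 * (1 - x\<^sup>2)" by (simp add: power_mult_distrib algebra_simps)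
    then have "sqrt (r\<^sup>2 - (c + r * x - c)\<^sup>2) = r * sqrt (1 - x\<^sup>2)" using r by (simp only: real_sqrt_mult) simp
    moreover have "indicator {c - r..c + r} (c + r * x) = (indicator {-1..1} x :: real)"
      using mult_le_cancel_left_pos[OF r, of "-1" x] mult_le_cancel_left_pos[OF r, of x 1]
      by (simp add: indicator_def)
    ultimately show ?thesis
      using r by (subst ennreal_mult[symmetric]) (auto simp: power_mult_distrib indicator_def abs_square_le_1 abs_le_iff)
  qed
  have "(\<integral>\<^sup>+t. ?f t \<partial>lborel) = ennreal r * (\<integral>\<^sup>+x. ?f (c + r * x) \<partial>lborel)"
    using r by (subst nn_integral_real_affine[of _ r c]) auto
  also have "(\<integral>\<^sup>+x. ?f (c + r * x) \<partial>lborel) = ennreal (unit_ball_vol (real k) * r ^ k) * ennreal (Beta (1/2) (real k / 2 + 1))"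
    unfolding pt by (simp add: nn_integral_cmult emeasure_cball_aux_integral)
  also have "ennreal r * \<dots> = ennreal (unit_ball_vol (real k) * Beta (1/2) (real k / 2 + 1) * r ^ Suc k)"
    using r by (simp add: ennreal_mult'[symmetric] mult_ac)
  also have "unit_ball_vol (real k) * Beta (1/2) (real k / 2 + 1) = unit_ball_vol (real (Suc k))"
    by (auto simp: unit_ball_vol_def Beta_def Gamma_eq_zero_iff field_simps
          Gamma_one_half_real powr_half_sqrt [symmetric] powr_add [symmetric])
  finally show ?thesis .
qed

lemma emeasure_shell:
  assumes "0 \<le> \<eta>"
  shows "emeasure lborel (ball (0::'a::euclidean_space) (1 + \<eta>) - cball 0 1) = ennreal (unit_ball_vol (real DIM('a)) * ((1 + \<eta>) ^ DIM('a) - 1))"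
proof (cases "\<eta> = 0")
  case True
  then show ?thesis by (simp add: Diff_eq_empty_iff[THEN iffD2, OF ball_subset_cball])
next
  case False
  then have "emeasure lborel (ball (0::'a) (1 + \<eta>) - cball 0 1) = emeasure lborel (ball (0::'a) (1 + \<eta>)) - emeasure lborel (cball (0::'a) 1)"
    using assms by (intro emeasure_Diff) (auto simp: emeasure_cball)
  also have "\<dots> = ennreal (unit_ball_vol (real DIM('a)) * (1 + \<eta>) ^ DIM('a) - unit_ball_vol (real DIM('a)))"
    using assms by (simp add: emeasure_ball emeasure_cball ennreal_minus)
  finally show ?thesis by (simp add: algebra_simps)
qed

lemma hausdorff_content_cball:
  fixes p :: "'a::euclidean_space"
  assumes "R \<ge> 0"
  shows "hausdorff_content k (cball p R) = ennreal (unit_ball_vol (real k) * R ^ k)"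
  using assms by (simp add: hausdorff_content_def)

text \<open>Integrating over \<open>t\<close> the efficiency of the cover of the sphere of radius \<open>t\<close> by the slices
  of a cover of the shell by balls.\<close>

lemma hausdorff_premeasure_sphere_shell:
  fixes \<delta> \<eta> \<epsilon> :: real
  defines "k \<equiv> DIM('a::euclidean_space) - 1"
  assumes \<delta>: "\<delta> > 0" and \<eta>: "\<eta> > 0" and \<epsilon>: "\<epsilon> > 0"
  shows "ennreal \<eta> * hausdorff_premeasure k \<delta> (sphere (0::'a) 1)
    \<le> ennreal (sqrt (1 + \<eta>) ^ k) * (emeasure lborel (ball (0::'a) (1 + \<eta>) - cball 0 1) + ennreal \<epsilon>)"
proof -
  let ?P = "hausdorff_premeasure k \<delta> (sphere (0::'a) 1)"
  let ?c = "sqrt (1 + \<eta>) ^ k"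
  define U where "U = ball (0::'a) (1 + \<eta>) - cball 0 1"
  have "open U" by (auto simp: U_def)
  obtain C :: "('a \<times> real) set" where C: "countable C" "U \<subseteq> (\<Union>(x, r)\<in>C. cball x r)"
    "\<And>x r. (x, r) \<in> C \<Longrightarrow> x \<in> U \<and> 0 < r \<and> r \<le> \<delta> / 2"
    "(\<integral>\<^sup>+(x, r). emeasure lborel (cball x r) \<partial>count_space C) \<le> emeasure lborel U + ennreal \<epsilon>"
    using efficient_ball_covering[OF \<open>open U\<close>, of "\<delta> / 2" \<epsilon>] \<delta> \<epsilon> by auto
  define g where "g i t = ennreal (unit_ball_vol (real k) * (indicator {norm (fst i) - snd i..norm (fst i) + snd i} t
      * sqrt ((snd i)\<^sup>2 - (t - norm (fst i))\<^sup>2) ^ k))" for i :: "'a \<times> real" and t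
  have [measurable]: "g i \<in> borel_measurable borel" for i unfolding g_def by measurable
  \<comment> \<open>Since \<open>norm x > 1\<close> and \<open>t < 1 + \<eta>\<close>, the
    distortion \<open>sqrt (t / norm x)\<close> is at most \<open>sqrt (1 + \<eta>)\<close>.\<close>
  have slice: "hausdorff_content k (sphere 0 t \<inter> cball (fst i) (snd i)) \<le> ennreal ?c * g i t"
    if t: "t \<in> {1<..<1 + \<eta>}" and i: "i \<in> C" for i t
  proof -
    obtain x r where xr: "i = (x, r)" "x \<in> U" "0 < r" "r \<le> \<delta> / 2" using C(3) i by (cases i) auto
    let ?\<rho> = "norm x"
    let ?R = "sqrt (t / ?\<rho>) * sqrt (r\<^sup>2 - (t - ?\<rho>)\<^sup>2)"
    have \<rho>: "1 < ?\<rho>" using xr by (auto simp: U_def)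
    have sub: "sphere 0 t \<inter> cball x r \<subseteq> (if \<bar>t - ?\<rho>\<bar> \<le> r then cball ((t / ?\<rho>) *\<^sub>R x) ?R else {})"
      using \<rho> t by (intro sphere_Int_cball_subset) auto
    show ?thesis
    proof (cases "\<bar>t - ?\<rho>\<bar> \<le> r")
      case False
      then show ?thesis using sub xr by (simp add: hausdorff_content_def)
    next
      case True
      have "(t - ?\<rho>)\<^sup>2 \<le> r\<^sup>2" using True by (metis abs_ge_zero power2_abs power_mono)
      then have R: "?R \<ge> 0" using t \<rho> by auto
      have "t / ?\<rho> \<le> t / 1" using t \<rho> by (intro divide_left_mono) auto
      then have le: "sqrt (t / ?\<rho>) ^ k \<le> ?c" using t \<rho> by (intro power_mono) auto
      have "hausdorff_content k (sphere 0 t \<inter> cball x r) \<le> hausdorff_content k (cball ((t / ?\<rho>) *\<^sub>R x) ?R)"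
        using sub True by (intro hausdorff_content_mono) auto
      also have "\<dots> = ennreal (unit_ball_vol (real k) * (sqrt (t / ?\<rho>) ^ k * sqrt (r\<^sup>2 - (t - ?\<rho>)\<^sup>2) ^ k))"
        using R by (simp only: hausdorff_content_cball power_mult_distrib)
      also have "\<dots> \<le> ennreal (?c * (unit_ball_vol (real k) * sqrt (r\<^sup>2 - (t - ?\<rho>)\<^sup>2) ^ k))"
        using le \<open>(t - ?\<rho>)\<^sup>2 \<le> r\<^sup>2\<close>
        by (intro ennreal_leI) (simp add: mult.assoc[symmetric] mult.commute[of "unit_ball_vol _"] mult_right_mono)
      also have "\<dots> = ennreal ?c * g i t"
      proof -
        have "t \<in> {?\<rho> - r..?\<rho> + r}" using True by auto
        then show ?thesis using \<eta> \<open>(t - ?\<rho>)\<^sup>2 \<le> r\<^sup>2\<close> by (simp add: g_def xr ennreal_mult[symmetric])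
      qed
      finally show ?thesis by (simp add: xr)
    qed
  qed
  have P_le: "?P \<le> (\<integral>\<^sup>+i. ennreal ?c * g i t \<partial>count_space C)" if t: "t \<in> {1<..<1 + \<eta>}" for t
  proof -
    \<comment> \<open>Scaling down from radius \<open>t > 1\<close> is a contraction, so every
      sphere inside the shell bounds the same quantity \<open>?P\<close>.\<close>
    have "sphere 0 1 \<subseteq> (\<lambda>x::'a. x /\<^sub>R t) ` sphere 0 t"
    proof
      fix x :: 'a assume "x \<in> sphere 0 1"
      then show "x \<in> (\<lambda>x. x /\<^sub>R t) ` sphere 0 t"
        using t by (intro image_eqI[of _ _ "t *\<^sub>R x"]) auto
    qed
    then have "?P \<le> hausdorff_premeasure k \<delta> ((\<lambda>x. x /\<^sub>R t) ` sphere (0::'a) t)"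
      by (rule hausdorff_premeasure_mono)
    also have "\<dots> \<le> hausdorff_premeasure k \<delta> (sphere (0::'a) t)"
    proof (rule hausdorff_premeasure_contraction_image)
      fix x y :: 'a
      have "dist (x /\<^sub>R t) (y /\<^sub>R t) = dist x y / t"
        using t by (simp add: dist_norm divide_inverse_commute flip: scaleR_diff_right)
      also have "\<dots> \<le> dist x y / 1" using t by (intro divide_left_mono) auto
      finally show "dist (x /\<^sub>R t) (y /\<^sub>R t) \<le> dist x y" by simp
    qed
    also have "\<dots> \<le> (\<integral>\<^sup>+i. hausdorff_content k (sphere 0 t \<inter> cball (fst i) (snd i)) \<partial>count_space C)"
    proof (rule hausdorff_premeasure_le_countable[OF C(1)])
      have "sphere 0 t \<subseteq> U" using t by (auto simp: U_def)
      then show "sphere 0 t \<subseteq> (\<Union>i\<in>C. sphere 0 t \<inter> cball (fst i) (snd i))"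
        using C(2) by (auto simp: split_beta')
      show "bounded (sphere 0 t \<inter> cball (fst i) (snd i))" for i :: "'a \<times> real" by (simp add: bounded_Int)
      fix i assume "i \<in> C"
      then have "0 < snd i" "snd i \<le> \<delta> / 2" using C(3)[of "fst i" "snd i"] by auto
      moreover have "diameter (sphere 0 t \<inter> cball (fst i) (snd i)) \<le> diameter (cball (fst i) (snd i))"
        by (intro diameter_subset) auto
      ultimately show "diameter (sphere 0 t \<inter> cball (fst i) (snd i)) \<le> \<delta>" by simp
    qed (use \<delta> in simp)
    also have "\<dots> \<le> (\<integral>\<^sup>+i. ennreal ?c * g i t \<partial>count_space C)"
      using slice[OF t] by (intro nn_integral_mono) auto
    finally show ?thesis .
  qed
  \<comment> \<open>The left side is constant in \<open>t\<close>. Hence no good radius has to be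
    selected: the slices only have to be economical on average over the shell.\<close>
  have "ennreal \<eta> * ?P = (\<integral>\<^sup>+t. ?P * indicator {1<..<1 + \<eta>} t \<partial>lborel)"
    using \<eta> by (simp add: nn_integral_cmult_indicator mult.commute)
  also have "\<dots> \<le> (\<integral>\<^sup>+t. \<integral>\<^sup>+i. ennreal ?c * g i t \<partial>count_space C \<partial>lborel)"
    using P_le by (intro nn_integral_mono) (auto simp: indicator_def)
  also have "\<dots> = (\<integral>\<^sup>+i. \<integral>\<^sup>+t. ennreal ?c * g i t \<partial>lborel \<partial>count_space C)"
    by (intro nn_integral_count_space_nn_integral C) measurable
  also have "\<dots> = (\<integral>\<^sup>+i. ennreal ?c * (case i of (x, r) \<Rightarrow> emeasure lborel (cball x r)) \<partial>count_space C)"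
  proof (intro nn_integral_cong)
    fix i assume "i \<in> space (count_space C)"
    then obtain x r where xr: "i = (x, r)" "0 < r" using C(3) by (cases i) auto
    have "(\<integral>\<^sup>+t. g i t \<partial>lborel) = ennreal (unit_ball_vol (real (Suc k)) * r ^ Suc k)"
      using nn_integral_ball_slices[OF xr(2), of k "norm x"] by (simp add: g_def xr)
    also have "Suc k = DIM('a)" by (simp add: k_def)
    finally have "(\<integral>\<^sup>+t. g i t \<partial>lborel) = emeasure lborel (cball x r)" using xr by (simp add: emeasure_cball)
    then show "(\<integral>\<^sup>+t. ennreal ?c * g i t \<partial>lborel) = ennreal ?c * (case i of (x, r) \<Rightarrow> emeasure lborel (cball x r))"
      by (subst nn_integral_cmult) (auto simp: xr)
  qed
  also have "\<dots> = ennreal ?c * (\<integral>\<^sup>+i. (case i of (x, r) \<Rightarrow> emeasure lborel (cball x r)) \<partial>count_space C)"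
    by (rule nn_integral_cmult) simp
  also have "\<dots> \<le> ennreal ?c * (emeasure lborel U + ennreal \<epsilon>)"
    using C(4) by (intro mult_left_mono) auto
  finally show ?thesis by (simp add: U_def)
qed

lemma tendsto_shell_ratio: "((\<lambda>\<eta>::real. ((1 + \<eta>) ^ n - 1) / \<eta>) \<longlongrightarrow> real n) (at_right 0)"
proof -
  have "((\<lambda>x::real. x ^ n) has_field_derivative real n) (at 1)"
    by (auto intro!: derivative_eq_intros)
  then have "((\<lambda>\<eta>::real. ((1 + \<eta>) ^ n - 1) / \<eta>) \<longlongrightarrow> real n) (at 0)"
    by (simp add: DERIV_def)
  then show ?thesis by (rule tendsto_within_subset) simp
qed

lemma hausdorff_outer_measure_sphere_le:
  "hausdorff_outer_measure (DIM('a) - 1) (sphere (0::'a::euclidean_space) 1) \<le> ennreal (real DIM('a) * unit_ball_vol (real DIM('a)))"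
proof (rule hausdorff_outer_measure_least)
  fix \<delta> :: real assume \<delta>: "0 < \<delta>"
  let ?P = "hausdorff_premeasure (DIM('a) - 1) \<delta> (sphere (0::'a) 1)"
  let ?w = "unit_ball_vol (real DIM('a))"
  \<comment> \<open>The volume wasted by the cover is taken to be \<open>\<eta>^2\<close>, which is
    still negligible after division by the thickness \<eta>.\<close>
  let ?F = "\<lambda>\<eta>. sqrt (1 + \<eta>) ^ (DIM('a) - 1) * (?w * (((1 + \<eta>) ^ DIM('a) - 1) / \<eta>) + \<eta>)"
  have "?P \<le> ennreal (?F \<eta>)" if \<eta>: "\<eta> > 0" for \<eta>
  proof -
    have one: "1 \<le> (1 + \<eta>) ^ DIM('a)" using \<eta> by (intro one_le_power) auto
    have "?P = ennreal (1 / \<eta>) * (ennreal \<eta> * ?P)"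
      using \<eta> by (simp add: mult.assoc[symmetric] ennreal_mult[symmetric])
    also have "\<dots> \<le> ennreal (1 / \<eta>) * (ennreal (sqrt (1 + \<eta>) ^ (DIM('a) - 1)) * (emeasure lborel (ball (0::'a) (1 + \<eta>) - cball 0 1) + ennreal (\<eta>\<^sup>2)))"
      using \<eta> \<delta> by (intro mult_left_mono hausdorff_premeasure_sphere_shell) auto
    also have "\<dots> = ennreal (1 / \<eta> * (sqrt (1 + \<eta>) ^ (DIM('a) - 1) * (?w * ((1 + \<eta>) ^ DIM('a) - 1) + \<eta>\<^sup>2)))"
    proof -
      have gen: "ennreal a * (ennreal b * (ennreal v + ennreal w)) = ennreal (a * (b * (v + w)))"
        if "0 \<le> a" "0 \<le> b" "0 \<le> v" "0 \<le> w" for a b v w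
        using that by (simp add: ennreal_mult ennreal_plus)
      show ?thesis
        unfolding emeasure_shell[OF less_imp_le[OF \<eta>]] using \<eta> one by (intro gen) auto
    qed
    also have "1 / \<eta> * (sqrt (1 + \<eta>) ^ (DIM('a) - 1) * (?w * ((1 + \<eta>) ^ DIM('a) - 1) + \<eta>\<^sup>2)) = ?F \<eta>"
      using \<eta> by (simp add: field_simps power2_eq_square)
    finally show ?thesis .
  qed
  then have "eventually (\<lambda>\<eta>. ?P \<le> ennreal (?F \<eta>)) (at_right 0)"
    by (auto simp: eventually_at_filter)
  moreover have "((\<lambda>\<eta>. ennreal (?F \<eta>)) \<longlongrightarrow> ennreal (sqrt (1 + 0) ^ (DIM('a) - 1) * (?w * real DIM('a) + 0))) (at_right 0)"
    by (intro tendsto_ennrealI tendsto_mult tendsto_power tendsto_real_sqrt tendsto_add tendsto_const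
        tendsto_shell_ratio tendsto_ident_at)
  ultimately have "?P \<le> ennreal (sqrt (1 + 0) ^ (DIM('a) - 1) * (?w * real DIM('a) + 0))"
    by (intro tendsto_lowerbound[OF _ _ trivial_limit_at_right_real])
  then show "?P \<le> ennreal (real DIM('a) * ?w)" by (simp add: mult.commute)
qed

section \<open>Lower bound for the sphere by sectors of a shell\<close>

text \<open>The piece of the shell over a set \<open>C\<close> of the cover lies, after symmetrisation, in a flat
  cylinder whose base is a ball of almost the same diameter as \<open>C\<close>.\<close>

lemma emeasure_shell_sector_le:
  fixes C :: "'a::euclidean_space set" and \<eta> \<delta> :: real
  defines "k \<equiv> DIM('a) - 1"
  assumes C: "bounded C" "diameter C \<le> \<delta>" and \<eta>: "0 < \<eta>" and \<delta>: "0 < \<delta>" "\<delta> \<le> 1"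
  defines "D \<equiv> (\<lambda>(t, w). t *\<^sub>R w) ` ({1..1 + \<eta>} \<times> closure (C \<inter> sphere 0 1))"
  shows "D \<in> sets borel" and
    "emeasure lborel D \<le> ennreal ((\<eta> + \<delta>\<^sup>2) * (1 + 2 * \<eta>) ^ k) * hausdorff_content k C"
proof -
  let ?W = "closure (C \<inter> sphere 0 1)"
  \<comment> \<open>The closure makes the sector compact, hence Borel, and does not change the
    diameter of its base.\<close>
  have W_sphere: "?W \<subseteq> sphere 0 1" by (rule closure_minimal) auto
  have bW: "bounded (C \<inter> sphere 0 1)" using C(1) by (simp add: bounded_Int)
  have "compact ?W" using bW by (simp add: compact_closure)
  then have "compact D" unfolding D_def
    by (intro compact_continuous_image compact_Times) (auto intro!: continuous_intros simp: split_beta')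
  then show D_b: "D \<in> sets borel" by (rule borel_compact)
  show "emeasure lborel D \<le> ennreal ((\<eta> + \<delta>\<^sup>2) * (1 + 2 * \<eta>) ^ k) * hausdorff_content k C"
  proof (cases "C \<inter> sphere 0 1 = {}")
    case True
    then show ?thesis by (simp add: D_def)
  next
    case False
    then obtain p where p: "p \<in> C" "norm p = 1" by auto
    define d where "d = diameter C"
    have d: "0 \<le> d" "d \<le> \<delta>" using C diameter_ge_0 by (auto simp: d_def)
    have dist: "norm (w - v) \<le> d" if "w \<in> ?W" "v \<in> ?W" for w v
    proof -
      have "dist w v \<le> diameter ?W" using that bW by (intro diameter_bounded_bound) auto
      also have "\<dots> = diameter (C \<inter> sphere 0 1)" using bW by (rule diameter_closure)
      also have "\<dots> \<le> d" unfolding d_def using C by (intro diameter_subset) auto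
      finally show ?thesis by (simp add: dist_norm)
    qed
    have pW: "p \<in> ?W" using p closure_subset[of "C \<inter> sphere 0 1"] by auto
    \<comment> \<open>For a unit vector \<open>w\<close>,
      \<open>w \<bullet> p = 1 - (norm (w - p))^2 / 2\<close>, so heights along \<open>p\<close> in
      the sector range over an interval from \<open>1 - d^2 / 2\<close> to
      \<open>1 + \<eta>\<close>. Laterally, the difference of directions contributes at most
      \<open>(1 + \<eta>) * d\<close> and the difference of radii at most \<open>\<eta> * d\<close>.
      Halving the differences gives the two bounds.\<close>
    define E where "E = {x. \<bar>x \<bullet> p\<bar> \<le> (\<eta> + d\<^sup>2) / 2 \<and> norm (x - (x \<bullet> p) *\<^sub>R p) \<le> (1 + 2 * \<eta>) * d / 2}"
    define P where "P x = x - (x \<bullet> p) *\<^sub>R p" for x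
    have P_lin: "P (a *\<^sub>R x + b *\<^sub>R y) = a *\<^sub>R P x + b *\<^sub>R P y" for a b x y
      by (simp add: P_def inner_add_left algebra_simps)
    have pp: "p \<bullet> p = 1" using p by (simp add: norm_eq_1)
    have P_p: "P p = 0" by (simp add: P_def pp)
    have P_le: "norm (P x) \<le> norm x" for x
    proof -
      have "(norm (P x))\<^sup>2 = (norm x)\<^sup>2 - (x \<bullet> p)\<^sup>2"
        unfolding power2_norm_eq_inner P_def
        by (simp add: inner_diff inner_commute pp power2_eq_square algebra_simps)
      also have "\<dots> \<le> (norm x)\<^sup>2" by simp
      finally show ?thesis by (simp add: power2_le_iff_abs_le)
    qed
    have ip: "w \<bullet> p \<le> 1" "1 - d\<^sup>2 / 2 \<le> w \<bullet> p" if "w \<in> ?W" for w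
    proof -
      have w1: "w \<bullet> w = 1" using that W_sphere by (auto simp: norm_eq_1[symmetric])
      have "(norm (w - p))\<^sup>2 = 2 - 2 * (w \<bullet> p)"
        unfolding power2_norm_eq_inner by (simp add: inner_diff inner_commute w1 pp)
      moreover have "(norm (w - p))\<^sup>2 \<le> d\<^sup>2" using dist[OF that pW] by (intro power_mono) auto
      ultimately show "1 - d\<^sup>2 / 2 \<le> w \<bullet> p" "w \<bullet> p \<le> 1" using zero_le_power2[of "norm (w - p)"] by linarith+
    qed
    have d2: "d\<^sup>2 \<le> \<delta>\<^sup>2" using d by (intro power_mono) auto
    have "d\<^sup>2 \<le> 1" using d \<delta> power_le_one[of d 2] by auto
    have diffE: "(x - y) /\<^sub>R 2 \<in> E" if xy: "x \<in> D" "y \<in> D" for x y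
    proof -
      obtain t w where x: "x = t *\<^sub>R w" "1 \<le> t" "t \<le> 1 + \<eta>" "w \<in> ?W" using xy(1) by (auto simp: D_def)
      obtain s v where y: "y = s *\<^sub>R v" "1 \<le> s" "s \<le> 1 + \<eta>" "v \<in> ?W" using xy(2) by (auto simp: D_def)
      have bounds: "1 - d\<^sup>2 / 2 \<le> a * (u \<bullet> p) \<and> a * (u \<bullet> p) \<le> 1 + \<eta>"
        if "1 \<le> a" "a \<le> 1 + \<eta>" "u \<in> ?W" for a u
      proof
        have "1 * (1 - d\<^sup>2 / 2) \<le> a * (u \<bullet> p)"
          using that ip[OF that(3)] \<open>d\<^sup>2 \<le> 1\<close> by (intro mult_mono) auto
        then show "1 - d\<^sup>2 / 2 \<le> a * (u \<bullet> p)" by simp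
        have "a * (u \<bullet> p) \<le> a * 1" using that ip[OF that(3)] by (intro mult_left_mono) auto
        then show "a * (u \<bullet> p) \<le> 1 + \<eta>" using that by linarith
      qed
      have "\<bar>t * (w \<bullet> p) - s * (v \<bullet> p)\<bar> \<le> \<eta> + d\<^sup>2"
        using bounds[OF x(2-4), THEN conjunct1] bounds[OF x(2-4), THEN conjunct2]
          bounds[OF y(2-4), THEN conjunct1] bounds[OF y(2-4), THEN conjunct2] zero_le_power2[of d]
        unfolding abs_le_iff by linarith
      then have 1: "\<bar>((x - y) /\<^sub>R 2) \<bullet> p\<bar> \<le> (\<eta> + d\<^sup>2) / 2"
        by (simp add: x(1) y(1) inner_diff_left abs_mult)
      \<comment> \<open>Because \<open>P\<close> annihilates \<open>p\<close>, the radial term sees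
        only \<open>v - p\<close>, of norm at most \<open>d\<close>. A bound by \<eta> alone would
        not shrink with \<open>d\<close> and would spoil the comparison with the content of
        \<open>C\<close>.\<close>
      have "x - y = t *\<^sub>R (w - v) + (t - s) *\<^sub>R v" by (simp add: x(1) y(1) algebra_simps)
      then have "P (x - y) = t *\<^sub>R P (w - v) + (t - s) *\<^sub>R P v" by (simp only: P_lin)
      also have "P v = P (v - p)" using P_lin[of 1 v "-1" p] by (simp add: P_p)
      finally have "norm (P (x - y)) \<le> t * norm (P (w - v)) + \<bar>t - s\<bar> * norm (P (v - p))"
        using x norm_triangle_ineq[of "t *\<^sub>R P (w - v)" "(t - s) *\<^sub>R P (v - p)"] by simp
      also have "\<dots> \<le> (1 + \<eta>) * d + \<eta> * d"
      proof -
        have "norm (P (w - v)) \<le> d" "norm (P (v - p)) \<le> d"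
          using order_trans[OF P_le dist[OF x(4) y(4)]] order_trans[OF P_le dist[OF y(4) pW]] by auto
        moreover have "\<bar>t - s\<bar> \<le> \<eta>" using x y by linarith
        ultimately show ?thesis using x \<eta> by (intro add_mono mult_mono) auto
      qed
      finally have "norm (P (x - y)) \<le> (1 + 2 * \<eta>) * d" by (simp add: algebra_simps)
      moreover have "P ((x - y) /\<^sub>R 2) = P (x - y) /\<^sub>R 2" using P_lin[of "inverse 2" "x - y" 0 0] by (simp only: scaleR_zero_left add_0_right)
      ultimately have "norm (P ((x - y) /\<^sub>R 2)) \<le> (1 + 2 * \<eta>) * d / 2" by (simp only: norm_scaleR) simp
      with 1 show ?thesis unfolding E_def P_def by (intro CollectI conjI)
    qed
    have "E \<in> sets borel" unfolding E_def by measurable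
    then have "emeasure lborel D \<le> emeasure lborel E"
      by (rule emeasure_le_half_difference_set[OF D_b _ diffE])
    also have "\<dots> \<le> ennreal (2 * ((\<eta> + d\<^sup>2) / 2) * (unit_ball_vol (real k) * ((1 + 2 * \<eta>) * d / 2) ^ k))"
      unfolding E_def k_def using p(2) d \<eta> by (intro emeasure_cylinder_le) auto
    also have "2 * ((\<eta> + d\<^sup>2) / 2) * (unit_ball_vol (real k) * ((1 + 2 * \<eta>) * d / 2) ^ k)
        = (\<eta> + d\<^sup>2) * (1 + 2 * \<eta>) ^ k * (unit_ball_vol (real k) * (d / 2) ^ k)"
    proof -
      have "((1 + 2 * \<eta>) * d / 2) ^ k = (1 + 2 * \<eta>) ^ k * (d / 2) ^ k"
        by (metis power_mult_distrib times_divide_eq_right)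
      moreover have "2 * ((\<eta> + d\<^sup>2) / 2) = \<eta> + d\<^sup>2" by simp
      ultimately show ?thesis by (simp only: ac_simps)
    qed
    also have "\<dots> \<le> ennreal ((\<eta> + \<delta>\<^sup>2) * (1 + 2 * \<eta>) ^ k * (unit_ball_vol (real k) * (d / 2) ^ k))"
      using d2 \<eta> d by (intro ennreal_leI mult_right_mono add_left_mono) auto
    also have "\<dots> = ennreal ((\<eta> + \<delta>\<^sup>2) * (1 + 2 * \<eta>) ^ k) * hausdorff_content k C"
      using p d \<eta> by (subst ennreal_mult) (auto simp: hausdorff_content_def d_def)
    finally show ?thesis .
  qed
qed

text \<open>The sectors over a cover of the sphere cover the shell. The factor is asymptotic to the
  thickness \<eta> as soon as \<eta> tends to 0 and \<open>\<delta>^2\<close> is small compared with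
  \<eta>.\<close>

lemma shell_le_hausdorff_premeasure_sphere:
  fixes \<eta> \<delta> :: real
  defines "k \<equiv> DIM('a::euclidean_space) - 1"
  assumes \<eta>: "0 < \<eta>" and \<delta>: "0 < \<delta>" "\<delta> \<le> 1"
  shows "emeasure lborel (ball (0::'a) (1 + \<eta>) - cball 0 1)
    \<le> ennreal ((\<eta> + \<delta>\<^sup>2) * (1 + 2 * \<eta>) ^ k) * hausdorff_premeasure k \<delta> (sphere (0::'a) 1)"
proof -
  let ?V = "emeasure lborel (ball (0::'a) (1 + \<eta>) - cball 0 1)"
  define c where "c = (\<eta> + \<delta>\<^sup>2) * (1 + 2 * \<eta>) ^ k"
  have c: "c > 0" using \<eta> by (auto simp: c_def intro!: mult_pos_pos add_pos_nonneg)
  have "ennreal (1 / c) * ?V \<le> hausdorff_premeasure k \<delta> (sphere (0::'a) 1)"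
  proof (rule hausdorff_premeasure_greatest)
    fix C :: "nat \<Rightarrow> 'a set"
    assume C: "sphere 0 1 \<subseteq> (\<Union>i. C i)" "\<And>i. bounded (C i)" "\<And>i. diameter (C i) \<le> \<delta>"
    define D where "D i = (\<lambda>(t, w). t *\<^sub>R w) ` ({1..1 + \<eta>} \<times> closure (C i \<inter> sphere 0 1))" for i
    have D: "D i \<in> sets borel" "emeasure lborel (D i) \<le> ennreal c * hausdorff_content k (C i)" for i
      using emeasure_shell_sector_le[OF C(2,3) \<eta> \<delta>] by (auto simp: D_def c_def k_def)
    have "ball (0::'a) (1 + \<eta>) - cball 0 1 \<subseteq> (\<Union>i. D i)"
    proof
      fix x :: 'a assume "x \<in> ball 0 (1 + \<eta>) - cball 0 1"
      then have x: "1 < norm x" "norm x < 1 + \<eta>" by auto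
      then have "norm x \<noteq> 0" by linarith
      then have "x /\<^sub>R norm x \<in> sphere 0 1" by (simp add: dist_norm)
      then obtain i where "x /\<^sub>R norm x \<in> C i \<inter> sphere 0 1" using C(1) by blast
      then have "x /\<^sub>R norm x \<in> closure (C i \<inter> sphere 0 1)" by (rule subsetD[OF closure_subset])
      then have "(norm x, x /\<^sub>R norm x) \<in> {1..1 + \<eta>} \<times> closure (C i \<inter> sphere 0 1)"
        using x by (intro SigmaI) auto
      moreover have "x = (case (norm x, x /\<^sub>R norm x) of (t, w) \<Rightarrow> t *\<^sub>R w)"
        using \<open>norm x \<noteq> 0\<close> by simp
      ultimately have "x \<in> D i" unfolding D_def by (rule image_eqI[rotated])
      then show "x \<in> (\<Union>i. D i)" by blast
    qed
    then have "?V \<le> emeasure lborel (\<Union>i. D i)" using D by (intro emeasure_mono) auto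
    also have "\<dots> \<le> (\<Sum>i. emeasure lborel (D i))" using D by (intro emeasure_subadditive_countably) auto
    also have "\<dots> \<le> (\<Sum>i. ennreal c * hausdorff_content k (C i))" by (intro suminf_le D) auto
    also have "\<dots> = ennreal c * (\<Sum>i. hausdorff_content k (C i))" by simp
    finally have "ennreal (1 / c) * ?V \<le> ennreal (1 / c) * (ennreal c * (\<Sum>i. hausdorff_content k (C i)))"
      by (rule mult_left_mono) simp
    also have "\<dots> = (\<Sum>i. hausdorff_content k (C i))"
      using c by (simp add: mult.assoc[symmetric] ennreal_mult[symmetric])
    finally show "ennreal (1 / c) * ?V \<le> (\<Sum>i. hausdorff_content k (C i))" .
  qed
  then have "ennreal c * (ennreal (1 / c) * ?V) \<le> ennreal c * hausdorff_premeasure k \<delta> (sphere (0::'a) 1)"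
    by (rule mult_left_mono) simp
  moreover have "ennreal c * (ennreal (1 / c) * ?V) = ?V"
    using c by (simp add: mult.assoc[symmetric] ennreal_mult[symmetric])
  ultimately show ?thesis by (simp add: c_def)
qed

lemma hausdorff_outer_measure_sphere_ge:
  "ennreal (real DIM('a) * unit_ball_vol (real DIM('a))) \<le> hausdorff_outer_measure (DIM('a) - 1) (sphere (0::'a::euclidean_space) 1)"
proof (cases "hausdorff_outer_measure (DIM('a) - 1) (sphere (0::'a) 1)")
  case (real h)
  let ?w = "unit_ball_vol (real DIM('a))"
  \<comment> \<open>The scale of the covers is tied to the thickness, \<delta> = \<eta>, so that
    \<open>\<eta> + \<delta>^2\<close> divided by \<eta> tends to 1.\<close>
  let ?F = "\<lambda>\<eta>. (1 + \<eta>) * (1 + 2 * \<eta>) ^ (DIM('a) - 1) * h"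
  have le: "?w * (((1 + \<eta>) ^ DIM('a) - 1) / \<eta>) \<le> ?F \<eta>" if \<eta>: "\<eta> > 0" "\<eta> < 1" for \<eta>
  proof -
    have "ennreal (?w * ((1 + \<eta>) ^ DIM('a) - 1)) = emeasure lborel (ball (0::'a) (1 + \<eta>) - cball 0 1)"
      using \<eta> by (simp add: emeasure_shell)
    also have "\<dots> \<le> ennreal ((\<eta> + \<eta>\<^sup>2) * (1 + 2 * \<eta>) ^ (DIM('a) - 1)) * hausdorff_premeasure (DIM('a) - 1) \<eta> (sphere (0::'a) 1)"
      using \<eta> by (intro shell_le_hausdorff_premeasure_sphere) auto
    also have "\<dots> \<le> ennreal ((\<eta> + \<eta>\<^sup>2) * (1 + 2 * \<eta>) ^ (DIM('a) - 1)) * ennreal h"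
      unfolding real(2)[symmetric] using \<eta> by (intro mult_left_mono hausdorff_premeasure_le_outer) auto
    also have "\<dots> = ennreal ((\<eta> + \<eta>\<^sup>2) * (1 + 2 * \<eta>) ^ (DIM('a) - 1) * h)"
      using \<eta> real by (simp add: ennreal_mult)
    finally have "?w * ((1 + \<eta>) ^ DIM('a) - 1) \<le> (\<eta> + \<eta>\<^sup>2) * (1 + 2 * \<eta>) ^ (DIM('a) - 1) * h"
      using \<eta> real by (subst (asm) ennreal_le_iff) auto
    also have "\<dots> = \<eta> * ?F \<eta>" by (simp add: power2_eq_square algebra_simps)
    finally show ?thesis using \<eta> by (simp add: pos_divide_le_eq mult.commute)
  qed
  have "?w * real DIM('a) \<le> (1 + 0) * (1 + 2 * 0) ^ (DIM('a) - 1) * h"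
  proof (rule tendsto_le[OF trivial_limit_at_right_real])
    show "((\<lambda>\<eta>. ?w * (((1 + \<eta>) ^ DIM('a) - 1) / \<eta>)) \<longlongrightarrow> ?w * real DIM('a)) (at_right 0)"
      by (intro tendsto_mult tendsto_const tendsto_shell_ratio)
    show "(?F \<longlongrightarrow> (1 + 0) * (1 + 2 * 0) ^ (DIM('a) - 1) * h) (at_right 0)"
      by (intro tendsto_intros)
    show "\<forall>\<^sub>F \<eta> in at_right 0. ?w * (((1 + \<eta>) ^ DIM('a) - 1) / \<eta>) \<le> ?F \<eta>"
    proof (rule eventually_mono[OF eventually_at_right_real[of 0 "1::real"]])
      show "?w * (((1 + \<eta>) ^ DIM('a) - 1) / \<eta>) \<le> ?F \<eta>" if "\<eta> \<in> {0<..<1}" for \<eta>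
        using that by (intro le) auto
    qed simp
  qed
  then show ?thesis unfolding real(2) by (intro ennreal_leI) (simp add: mult.commute)
qed simp

section \<open>The constant of the limit\<close>

lemma emeasure_hausdorff_sphere:
  "emeasure (hausdorff_measure (DIM('a) - 1)) (sphere (0::'a::euclidean_space) 1) = ennreal (real DIM('a) * unit_ball_vol (real DIM('a)))"
  using hausdorff_outer_measure_sphere_ge[where 'a='a] hausdorff_outer_measure_sphere_le[where 'a='a]
  by (subst emeasure_hausdorff_measure) (auto intro: antisym)

text \<open>The radial weight \<open>indicator {1}\<close> turns the rotation argument into a
  statement on the sphere: the integral is the measure of the sphere divided by the
  dimension.\<close>

lemma nn_integral_hausdorff_sphere_inner_square:
  fixes e :: "'a::euclidean_space"
  assumes e: "norm e = 1"
  shows "(\<integral>\<^sup>+\<omega>\<in>sphere 0 1. ennreal (\<bar>\<omega> \<bullet> e\<bar>\<^sup>2) \<partial>hausdorff_measure (DIM('a) - 1)) = ennreal (unit_ball_vol (real DIM('a)))"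
proof -
  let ?H = "hausdorff_measure (DIM('a) - 1) :: 'a measure"
  let ?I = "\<integral>\<^sup>+\<omega>\<in>sphere 0 1. ennreal (\<bar>\<omega> \<bullet> e\<bar>\<^sup>2) \<partial>?H"
  have sph: "indicator (sphere 0 1) x = (indicator {1} (norm x) :: ennreal)" for x :: 'a
    by (simp add: indicator_def)
  have "of_nat DIM('a) * ?I = (\<integral>\<^sup>+x. ennreal ((norm x)\<^sup>2) * indicator {1} (norm x) \<partial>?H)"
    using nn_integral_inner_square_rotation_invariant[of ?H "indicator {1}" e] e
    by (simp add: sph distr_hausdorff_measure_isometry dist_orthogonal_transformation orthogonal_transformation_surj)
  also have "\<dots> = (\<integral>\<^sup>+x. indicator (sphere 0 1) x \<partial>?H)"
    by (intro nn_integral_cong) (simp add: indicator_def)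
  also have "\<dots> = ennreal (real DIM('a)) * ennreal (unit_ball_vol (real DIM('a)))"
    by (simp add: emeasure_hausdorff_sphere[simplified] ennreal_mult)
  finally have "of_nat DIM('a) * ?I = of_nat DIM('a) * ennreal (unit_ball_vol (real DIM('a)))"
    by (simp add: ennreal_of_nat_eq_real_of_nat)
  then show ?thesis
    by (subst (asm) ennreal_mult_cancel_left) (auto simp: of_nat_eq_0_iff)
qed

section \<open>Smooth bumps and the fundamental lemma\<close>

lemma Ck_on_SucD: "Ck_on (Suc k) f S \<Longrightarrow> Ck_on k f S"
proof (induction k arbitrary: f)
  case 0
  then have "f differentiable_on S" by (auto simp: differentiable_on_def intro: differentiable_at_withinI)
  then show ?case by (simp add: differentiable_imp_continuous_on)
qed auto

lemma Ck_on_const: "Ck_on k (\<lambda>x. c) S"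
  by (induction k arbitrary: c) (auto simp: frechet_derivative_const)

text \<open>Lets an explicit derivative stand for \<open>frechet_derivative\<close>. The two agree
  only on \<open>S\<close>; openness of \<open>S\<close> makes all higher derivatives on
  \<open>S\<close> insensitive to values elsewhere, which is the inner congruence.\<close>

lemma Ck_on_SucI:
  assumes "\<And>x. x \<in> S \<Longrightarrow> (f has_derivative D x) (at x)" "\<And>v. Ck_on k (\<lambda>x. D x v) S" "open S"
  shows "Ck_on (Suc k) f S"
proof -
  have cong: "Ck_on k g S \<longleftrightarrow> Ck_on k h S" if "\<And>x. x \<in> S \<Longrightarrow> g x = h x" for g h :: "'a \<Rightarrow> 'b"
    using that
  proof (induction k arbitrary: g h)
    case 0 then show ?case by (simp cong: continuous_on_cong)
  next
    case (Suc k)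
    have der: "(g has_derivative E) (at x) \<longleftrightarrow> (h has_derivative E) (at x)" if "x \<in> S" for E x
      using has_derivative_transform_within_open[OF _ assms(3) that] Suc.prems by metis
    then have "frechet_derivative g (at x) = frechet_derivative h (at x)" if "x \<in> S" for x
      unfolding frechet_derivative_def using that by simp
    then have "Ck_on k (\<lambda>x. frechet_derivative g (at x) v) S \<longleftrightarrow> Ck_on k (\<lambda>x. frechet_derivative h (at x) v) S" for v
      by (intro Suc.IH) simp
    moreover have "g differentiable at x \<longleftrightarrow> h differentiable at x" if "x \<in> S" for x
      unfolding differentiable_def using der[OF that] by simp
    ultimately show ?case by simp
  qed
  have "frechet_derivative f (at x) = D x" if "x \<in> S" for x
    using frechet_derivative_at[OF assms(1)[OF that]] by simp
  then have "Ck_on k (\<lambda>x. frechet_derivative f (at x) v) S" for v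
    using assms(2)[of v] cong[of "\<lambda>x. frechet_derivative f (at x) v" "\<lambda>x. D x v"] by simp
  then show ?thesis using assms(1) by (auto simp: differentiable_def)
qed

lemma Ck_on_has_derivative:
  "Ck_on (Suc k) f S \<Longrightarrow> x \<in> S \<Longrightarrow> (f has_derivative frechet_derivative f (at x)) (at x)"
  by (simp add: frechet_derivative_works)

lemma Ck_on_add:
  assumes "open S" "Ck_on k f S" "Ck_on k g S"
  shows "Ck_on k (\<lambda>x. f x + g x) S"
  using assms(2,3)
proof (induction k arbitrary: f g)
  case (Suc k)
  show ?case
  proof (rule Ck_on_SucI[where D="\<lambda>x v. frechet_derivative f (at x) v + frechet_derivative g (at x) v"])
    show "((\<lambda>x. f x + g x) has_derivative (\<lambda>v. frechet_derivative f (at x) v + frechet_derivative g (at x) v)) (at x)"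
      if "x \<in> S" for x using that Suc.prems by (intro has_derivative_add Ck_on_has_derivative)
    show "Ck_on k (\<lambda>x. frechet_derivative f (at x) v + frechet_derivative g (at x) v) S" for v
      using Suc.prems by (intro Suc.IH) simp_all
  qed fact
qed (auto intro: continuous_intros)

lemma Ck_on_mult:
  fixes f g :: "'a::real_normed_vector \<Rightarrow> 'b::real_normed_algebra"
  assumes "open S" "Ck_on k f S" "Ck_on k g S"
  shows "Ck_on k (\<lambda>x. f x * g x) S"
  using assms(2,3)
proof (induction k arbitrary: f g)
  case (Suc k)
  show ?case
  proof (rule Ck_on_SucI[where D="\<lambda>x v. f x * frechet_derivative g (at x) v + frechet_derivative f (at x) v * g x"])
    show "((\<lambda>x. f x * g x) has_derivative (\<lambda>v. f x * frechet_derivative g (at x) v + frechet_derivative f (at x) v * g x)) (at x)"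
      if "x \<in> S" for x using that Suc.prems by (intro has_derivative_mult Ck_on_has_derivative)
    show "Ck_on k (\<lambda>x. f x * frechet_derivative g (at x) v + frechet_derivative f (at x) v * g x) S" for v
      using Suc by (intro Ck_on_add Suc.IH assms(1)) (auto intro: Ck_on_SucD)
  qed fact
qed (auto intro: continuous_intros)

lemma Ck_on_bounded_linear:
  assumes "open S" "bounded_linear h" "Ck_on k f S"
  shows "Ck_on k (\<lambda>x. h (f x)) S"
  using assms(3)
proof (induction k arbitrary: f)
  case 0
  then show ?case using assms(2) by (auto intro: bounded_linear.continuous_on)
next
  case (Suc k)
  show ?case
  proof (rule Ck_on_SucI[where D="\<lambda>x v. h (frechet_derivative f (at x) v)"])
    show "((\<lambda>x. h (f x)) has_derivative (\<lambda>v. h (frechet_derivative f (at x) v))) (at x)" if "x \<in> S" for x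
      by (rule bounded_linear.has_derivative[OF assms(2) Ck_on_has_derivative[OF Suc.prems that]])
    show "Ck_on k (\<lambda>x. h (frechet_derivative f (at x) v)) S" for v
      using Suc.prems by (intro Suc.IH) simp
  qed fact
qed

text \<open>With \<open>y = 1 / t\<close>, the derivative in \<open>t\<close> of
  \<open>p(y) * exp (- y)\<close> is \<open>y^2 * (p(y) - p'(y)) * exp (- y)\<close>; the polynomial
  \<open>[:0, 0, 1:]\<close> is the factor \<open>y^2\<close>.\<close>

primrec flat_poly :: "nat \<Rightarrow> real poly" where
  "flat_poly 0 = 1"
| "flat_poly (Suc n) = [:0, 0, 1:] * (flat_poly n - pderiv (flat_poly n))"

text \<open>The \<open>n\<close>-th derivative of the function \<open>exp (- 1 / t)\<close>, extended by zero to \<open>t \<le> 0\<close>.\<close>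

definition flat :: "nat \<Rightarrow> real \<Rightarrow> real" where
  "flat n t = (if t \<le> 0 then 0 else poly (flat_poly n) (1 / t) * exp (- (1 / t)))"

lemma tendsto_poly_exp_minus: "((\<lambda>y. poly p y * exp (- y)) \<longlongrightarrow> 0) at_top" for p :: "real poly"
proof -
  \<comment> \<open>The additional power absorbs the factor \<open>y\<close> that each
    \<open>pCons\<close> step brings in.\<close>
  have "((\<lambda>y. y ^ k * poly p y * exp (- y)) \<longlongrightarrow> 0) at_top" for k
  proof (induction p arbitrary: k)
    case (pCons a p)
    have "((\<lambda>y::real. a * (y ^ k / exp y) + y ^ Suc k * poly p y * exp (- y)) \<longlongrightarrow> a * 0 + 0) at_top"
      by (intro tendsto_intros tendsto_power_div_exp_0 pCons.IH)
    then show ?case by (simp add: exp_minus field_simps)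
  qed simp
  from this[of 0] show ?thesis by simp
qed

lemma DERIV_flat: "(flat n has_field_derivative flat (Suc n) t) (at t)"
proof -
  consider "t < 0" | "t = 0" | "t > 0" by linarith
  then show ?thesis
  proof cases
    case 1
    have "((\<lambda>_. 0) has_field_derivative 0) (at t)" by simp
    then have "(flat n has_field_derivative 0) (at t)"
      by (rule has_field_derivative_transform_within_open[where S="{..<0}"]) (use 1 in \<open>auto simp: flat_def\<close>)
    then show ?thesis using 1 by (simp add: flat_def)
  next
    case 3
    have "((\<lambda>t. poly (flat_poly n) (1 / t) * exp (- (1 / t))) has_field_derivative flat (Suc n) t) (at t)"
      using 3 by (auto intro!: derivative_eq_intros DERIV_chain2[OF poly_DERIV] simp: flat_def field_simps power2_eq_square)
    then show ?thesis
      by (rule has_field_derivative_transform_within_open[where S="{0<..}"]) (use 3 in \<open>auto simp: flat_def\<close>)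
  next
    case 2
    have "((\<lambda>h. flat n h / h) \<longlongrightarrow> 0) (at_right 0)"
    proof -
      \<comment> \<open>In terms of \<open>y = 1 / h\<close> the difference quotient at 0 is
        \<open>y * flat n h\<close>, again a polynomial in \<open>y\<close> times
        \<open>exp (- y)\<close>; \<open>pCons 0\<close> supplies the factor
        \<open>y\<close>.\<close>
      have "((\<lambda>h. poly (pCons 0 (flat_poly n)) (inverse h) * exp (- inverse h)) \<longlongrightarrow> 0) (at_right 0)"
        by (rule filterlim_compose[OF tendsto_poly_exp_minus filterlim_inverse_at_top_right])
      then show ?thesis
        by (rule Lim_transform_eventually)
           (auto simp: flat_def eventually_at_filter divide_inverse mult_ac)
    qed
    moreover have "((\<lambda>h. flat n h / h) \<longlongrightarrow> 0) (at_left 0)"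
      by (rule Lim_transform_eventually[OF tendsto_const]) (auto simp: flat_def eventually_at_filter)
    ultimately have "((\<lambda>h. flat n h / h) \<longlongrightarrow> 0) (at 0)" by (simp add: filterlim_at_split)
    then have "((\<lambda>h. (flat n (0 + h) - flat n 0) / h) \<longlongrightarrow> 0) (at 0)" by (simp add: flat_def)
    then show ?thesis unfolding DERIV_def 2 by (simp add: flat_def)
  qed
qed

text \<open>The induction runs over all \<open>n\<close> simultaneously: a derivative of
  \<open>flat n\<close> of the quadratic is \<open>flat (Suc n)\<close> of it times an affine
  function, so the order drops while \<open>n\<close> rises.\<close>

lemma Ck_on_flat_bump:
  fixes p :: "'a::euclidean_space"
  shows "Ck_on k (\<lambda>x. flat n (m * (r\<^sup>2 - (norm (x - p))\<^sup>2))) UNIV"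
proof (induction k arbitrary: n)
  case 0
  have "continuous_on UNIV (flat n)"
    using DERIV_flat by (intro DERIV_continuous_on) (auto intro: has_field_derivative_at_within)
  then show ?case
    by (auto intro!: continuous_on_compose2[of UNIV "flat n"] continuous_intros)
next
  case (Suc k)
  let ?q = "\<lambda>x. m * (r\<^sup>2 - (norm (x - p))\<^sup>2)"
  have lin: "Ck_on k (\<lambda>x. - (2 * m) * ((x - p) \<bullet> v)) UNIV" for v
  proof (cases k)
    case 0 then show ?thesis by (auto intro!: continuous_intros)
  next
    case (Suc l)
    then show ?thesis
      by (simp only:, intro Ck_on_SucI[where D="\<lambda>x w. - (2 * m) * (w \<bullet> v)"])
         (auto intro!: derivative_eq_intros Ck_on_const)
  qed
  show ?case
  proof (rule Ck_on_SucI[where D="\<lambda>x v. flat (Suc n) (?q x) * (- (2 * m) * ((x - p) \<bullet> v))"])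
    fix x :: 'a
    have q: "(?q has_derivative (\<lambda>v. - (2 * m) * ((x - p) \<bullet> v))) (at x)"
      unfolding power2_norm_eq_inner
      by (auto intro!: derivative_eq_intros simp: inner_commute algebra_simps)
    show "((\<lambda>x. flat n (?q x)) has_derivative (\<lambda>v. flat (Suc n) (?q x) * (- (2 * m) * ((x - p) \<bullet> v)))) (at x)"
      by (rule has_derivative_compose[OF q DERIV_flat[unfolded has_field_derivative_def]])
    show "Ck_on k (\<lambda>x. flat (Suc n) (?q x) * (- (2 * m) * ((x - p) \<bullet> v))) UNIV" for v
      by (intro Ck_on_mult open_UNIV Suc lin)
  qed simp
qed

text \<open>The squared norm keeps the composition smooth at the centre. Large \<open>m\<close>
  drives the exponent to 0 inside the ball, so that the bumps converge to its indicator.\<close>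

definition bump :: "'a::euclidean_space \<Rightarrow> real \<Rightarrow> nat \<Rightarrow> 'a \<Rightarrow> real" where
  "bump p r m x = flat 0 (real (Suc m) * (r\<^sup>2 - (norm (x - p))\<^sup>2))"

lemma bump_bounds: "0 \<le> bump p r m x" "bump p r m x \<le> 1"
  by (auto simp: bump_def flat_def)

lemma bump_eq_0: "0 \<le> r \<Longrightarrow> x \<notin> ball p r \<Longrightarrow> bump p r m x = 0"
  by (auto simp: bump_def flat_def dist_norm norm_minus_commute mult_le_0_iff power_mono)

lemma bump_tendsto:
  assumes "0 < r"
  shows "(\<lambda>m. bump p r m x) \<longlonglongrightarrow> indicator (ball p r) x"
proof (cases "x \<in> ball p r")
  case True
  define t where "t = r\<^sup>2 - (norm (x - p))\<^sup>2"
  have t: "t > 0" using True by (simp add: t_def dist_norm norm_minus_commute power_strict_mono)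
  have "(\<lambda>m. exp (- (inverse (real (Suc m)) * (1 / t)))) \<longlonglongrightarrow> exp (- (0 * (1 / t)))"
    by (intro tendsto_intros LIMSEQ_inverse_real_of_nat)
  moreover have "bump p r m x = exp (- (inverse (real (Suc m)) * (1 / t)))" for m
    using t by (simp add: bump_def flat_def t_def[symmetric] divide_inverse mult_le_0_iff)
  ultimately show ?thesis using True by simp
next
  case False
  then show ?thesis using assms by (simp add: bump_eq_0)
qed

lemma bump_test_function:
  assumes "0 < r" "cball p r \<subseteq> \<Omega>"
  shows "(\<lambda>x. complex_of_real (bump p r m x)) \<in> test_functions \<Omega>"
proof -
  have sub: "closure {x. complex_of_real (bump p r m x) \<noteq> 0} \<subseteq> cball p r"
    using bump_eq_0[of r _ p m] assms(1) by (intro closure_minimal) (auto simp: less_imp_le subset_eq, force)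
  moreover have "compact (closure {x. complex_of_real (bump p r m x) \<noteq> 0})"
    using sub bounded_subset[OF bounded_cball sub] by (simp add: compact_eq_bounded_closed)
  moreover have "Ck_on k (\<lambda>x. complex_of_real (bump p r m x)) UNIV" for k
    unfolding bump_def by (intro Ck_on_bounded_linear[OF open_UNIV bounded_linear_of_real] Ck_on_flat_bump)
  ultimately show ?thesis using assms by (auto simp: test_functions_def)
qed

section \<open>Fundamental lemma of the calculus of variations: from balls to Borel sets\<close>

lemma integral_bump_zero_imp_ball_zero:
  fixes g :: "real^'n \<Rightarrow> complex"
  assumes loc: "set_integrable lebesgue (cball p r) g" and r: "0 < r" and sub: "cball p r \<subseteq> \<Omega>"
    and zero: "\<And>\<phi>. \<phi> \<in> test_functions \<Omega> \<Longrightarrow> (LINT x:\<Omega>|lebesgue. g x * \<phi> x) = 0"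
  shows "(LINT x:ball p r|lebesgue. g x) = 0"
proof -
  let ?g = "\<lambda>x. indicator (cball p r) x *\<^sub>R g x"
  have int: "integrable lebesgue ?g" using loc by (simp add: set_integrable_def)
  have bump_eq: "indicator \<Omega> x *\<^sub>R (g x * complex_of_real (bump p r m x)) = bump p r m x *\<^sub>R ?g x" for m x
    using bump_eq_0[of r x p m] r sub by (auto simp: indicator_def scaleR_conv_of_real mult.commute)
  have meas: "(\<lambda>x. bump p r m x) \<in> borel_measurable lebesgue" for m
  proof -
    have "continuous_on UNIV (bump p r m)" using Ck_on_flat_bump[of 0] by (simp add: bump_def[abs_def])
    then have "bump p r m \<in> borel_measurable borel" by (rule borel_measurable_continuous_onI)
    then show ?thesis by (simp add: measurable_completion)
  qed
  have "(\<lambda>m. LINT x|lebesgue. bump p r m x *\<^sub>R ?g x) \<longlonglongrightarrow> (LINT x|lebesgue. indicator (ball p r) x *\<^sub>R ?g x)"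
  proof (rule integral_dominated_convergence[where w="\<lambda>x. norm (?g x)"])
    show "AE x in lebesgue. (\<lambda>m. bump p r m x *\<^sub>R ?g x) \<longlonglongrightarrow> indicator (ball p r) x *\<^sub>R ?g x"
      by (intro AE_I2 tendsto_scaleR bump_tendsto r tendsto_const)
    show "AE x in lebesgue. norm (bump p r m x *\<^sub>R ?g x) \<le> norm (?g x)" for m
    proof (rule AE_I2)
      fix x
      show "norm (bump p r m x *\<^sub>R ?g x) \<le> norm (?g x)"
        unfolding norm_scaleR[of "bump p r m x"] abs_of_nonneg[OF bump_bounds(1)]
        by (rule mult_left_le_one_le[OF norm_ge_zero bump_bounds])
    qed
    show "(\<lambda>x. indicator (ball p r) x *\<^sub>R ?g x) \<in> borel_measurable lebesgue"
      by (intro borel_measurable_integrable integrable_mult_indicator int) auto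
    show "integrable lebesgue (\<lambda>x. norm (?g x))" using int by (rule integrable_norm)
    show "(\<lambda>x. bump p r m x *\<^sub>R ?g x) \<in> borel_measurable lebesgue" for m
      by (rule borel_measurable_scaleR[OF meas borel_measurable_integrable[OF int]])
  qed
  moreover have "(LINT x|lebesgue. bump p r m x *\<^sub>R ?g x) = 0" for m
    using zero[OF bump_test_function[OF r sub]] by (simp add: set_lebesgue_integral_def bump_eq)
  ultimately have "(LINT x|lebesgue. indicator (ball p r) x *\<^sub>R ?g x) = 0"
    by (simp add: LIMSEQ_const_iff)
  moreover have "indicator (ball p r) x *\<^sub>R ?g x = indicator (ball p r) x *\<^sub>R g x" for x
    by (auto simp: indicator_def)
  ultimately show ?thesis by (simp only: set_lebesgue_integral_def)
qed

lemma set_lebesgue_integral_countable_family_zero: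
  fixes g :: "'a \<Rightarrow> complex"
  assumes "countable I" and sets: "\<And>i. i \<in> I \<Longrightarrow> B i \<in> sets M" and disj: "disjoint_family_on B I"
    and int: "set_integrable M (\<Union>i\<in>I. B i) g" and zero: "\<And>i. i \<in> I \<Longrightarrow> (LINT x:B i|M. g x) = 0"
  shows "(LINT x:(\<Union>i\<in>I. B i)|M. g x) = 0"
proof -
  define D where "D n = (if n \<in> to_nat_on I ` I then B (from_nat_into I n) else {})" for n
  have D: "D (to_nat_on I i) = B i" if "i \<in> I" for i using that assms(1) by (auto simp: D_def)
  have D': "D n = {} \<or> (\<exists>i\<in>I. n = to_nat_on I i)" for n by (auto simp: D_def)
  have U: "(\<Union>n. D n) = (\<Union>i\<in>I. B i)"
  proof (intro equalityI subsetI)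
    fix x assume "x \<in> (\<Union>n. D n)"
    then obtain n where "x \<in> D n" by blast
    then obtain i where "i \<in> I" "n = to_nat_on I i" using D'[of n] by blast
    then show "x \<in> (\<Union>i\<in>I. B i)" using D \<open>x \<in> D n\<close> by auto
  next
    fix x assume "x \<in> (\<Union>i\<in>I. B i)"
    then show "x \<in> (\<Union>n. D n)" using D by auto
  qed
  have Ds: "D n \<in> sets M" for n
    using D'[of n] D sets by (elim disjE bexE) simp_all
  have Dd: "D m \<inter> D n = {}" if "m \<noteq> n" for m n
  proof -
    have "D m \<inter> D n = {}" if "i \<in> I" "m = to_nat_on I i" "j \<in> I" "n = to_nat_on I j" for i j
    proof -
      have "i \<noteq> j" using that \<open>m \<noteq> n\<close> by auto
      then show ?thesis using disj that D by (simp add: disjoint_family_on_def)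
    qed
    then show ?thesis using D'[of m] D'[of n] by blast
  qed
  have "(LINT x:(\<Union>n. D n)|M. g x) = (\<Sum>n. LINT x:D n|M. g x)"
    using Ds Dd int by (intro lebesgue_integral_countable_add) (simp_all add: U)
  also have "\<dots> = (\<Sum>n. 0)"
  proof (intro suminf_cong)
    fix n show "(LINT x:D n|M. g x) = 0"
      using D'[of n] D zero by (elim disjE bexE) (simp_all add: set_lebesgue_integral_def)
  qed
  finally show ?thesis by (simp add: U)
qed

text \<open>The bumps settle balls only; Vitali's theorem fills an open set with disjoint balls up
  to a null set. The surrounding compact \<open>K\<close> supplies the integrability for summing
  over infinitely many balls.\<close>

lemma integral_open_subset_zero:
  fixes g :: "real^'n \<Rightarrow> complex"
  assumes loc: "\<And>K. compact K \<Longrightarrow> K \<subseteq> \<Omega> \<Longrightarrow> set_integrable lebesgue K g"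
    and zero: "\<And>\<phi>. \<phi> \<in> test_functions \<Omega> \<Longrightarrow> (LINT x:\<Omega>|lebesgue. g x * \<phi> x) = 0"
    and K: "compact K" "K \<subseteq> \<Omega>" and U: "open U" "U \<subseteq> K"
  shows "(LINT x:U|lebesgue. g x) = 0"
proof -
  let ?B = "\<lambda>i :: (real^'n) \<times> real. ball (fst i) (snd i)"
  define J where "J = {(x, r). 0 < r \<and> cball x r \<subseteq> U}"
  have J: "0 < snd i" "cball (fst i) (snd i) \<subseteq> U" if "i \<in> J" for i using that by (auto simp: J_def split_beta')
  have "\<exists>i. i \<in> J \<and> x \<in> ?B i \<and> snd i < d" if x: "x \<in> U" "0 < d" for x d
  proof -
    obtain e where e: "e > 0" "cball x e \<subseteq> U" using U x(1) by (meson open_contains_cball)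
    have "cball x (min e (d / 2)) \<subseteq> cball x e" by auto
    then have "(x, min e (d / 2)) \<in> J" using e x by (auto simp: J_def)
    then show ?thesis using e x by (intro exI[of _ "(x, min e (d / 2))"]) auto
  qed
  then obtain C where C: "countable C" "C \<subseteq> J"
      "pairwise (\<lambda>i j. disjnt (?B i) (?B j)) C" "negligible (U - (\<Union>i\<in>C. ?B i))"
    by (rule Vitali_covering_theorem_balls)
  have intK: "set_integrable lebesgue K g" using loc K by blast
  have sub: "(\<Union>i\<in>C. ?B i) \<subseteq> U" 
  proof (intro UN_least)
    fix i assume "i \<in> C"
    then have "cball (fst i) (snd i) \<subseteq> U" using J C(2) by blast
    then show "?B i \<subseteq> U" using ball_subset_cball by (rule order_trans[rotated])
  qed
  have UB: "open (\<Union>i\<in>C. ?B i)" by (intro open_UN ballI open_ball)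
  have intU: "set_integrable lebesgue V g" if "open V" "V \<subseteq> U" for V
    by (rule set_integrable_subset[OF intK]) (use that U in auto)
  have "(LINT x:(\<Union>i\<in>C. ?B i)|lebesgue. g x) = 0"
  proof (rule set_lebesgue_integral_countable_family_zero[OF C(1)])
    show "disjoint_family_on ?B C" using C(3) by (auto simp: disjoint_family_on_def pairwise_def disjnt_def)
    show "set_integrable lebesgue (\<Union>i\<in>C. ?B i) g" by (rule intU[OF UB sub])
    fix i assume i: "i \<in> C"
    then have "i \<in> J" using C(2) by blast
    then have "cball (fst i) (snd i) \<subseteq> \<Omega>" using J(2)[of i] U(2) K(2) by blast
    then show "(LINT x:?B i|lebesgue. g x) = 0"
      using J(1)[OF \<open>i \<in> J\<close>] zero by (intro integral_bump_zero_imp_ball_zero[of _ _ _ \<Omega>] loc) auto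
  qed simp
  moreover have "(LINT x:(\<Union>i\<in>C. ?B i)|lebesgue. g x) = (LINT x:U|lebesgue. g x)"
    unfolding set_lebesgue_integral_def
  proof (rule integral_cong_AE)
    show "(\<lambda>x. indicator (\<Union>i\<in>C. ?B i) x *\<^sub>R g x) \<in> borel_measurable lebesgue"
      using intU[OF UB sub] by (simp add: set_integrable_def borel_measurable_integrable)
    show "(\<lambda>x. indicator U x *\<^sub>R g x) \<in> borel_measurable lebesgue"
      using intU[OF U(1) order.refl] by (simp add: set_integrable_def borel_measurable_integrable)
    have "AE x in lebesgue. x \<notin> U - (\<Union>i\<in>C. ?B i)"
      using C(4) by (intro AE_not_in) (simp add: negligible_iff_null_sets)
    then show "AE x in lebesgue. indicator (\<Union>i\<in>C. ?B i) x *\<^sub>R g x = indicator U x *\<^sub>R g x"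
    proof eventually_elim
      case (elim x)
      then show ?case using subsetD[OF sub, of x]
        by (cases "x \<in> U"; cases "x \<in> (\<Union>i\<in>C. ?B i)") (simp_all del: UN_iff)
    qed
  qed
  ultimately show ?thesis by simp
qed

lemma integral_borel_subset_zero:
  fixes g :: "real^'n \<Rightarrow> complex"
  assumes int: "integrable lebesgue g" and op: "\<And>U. open U \<Longrightarrow> (LINT x:U|lebesgue. g x) = 0"
    and A: "A \<in> sets borel"
  shows "(LINT x:A|lebesgue. g x) = 0"
proof -
  have gen: "sets (borel :: (real^'n) measure) = sigma_sets UNIV {U. open U}"
    by (simp add: borel_def)
  have si: "set_integrable lebesgue A g" if "A \<in> sets borel" for A
    unfolding set_integrable_def using that int by (intro integrable_mult_indicator) auto
  have "Int_stable {U :: (real^'n) set. open U}" by (auto simp: Int_stable_def)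
  moreover have "{U :: (real^'n) set. open U} \<subseteq> Pow UNIV" by simp
  moreover have "A \<in> sigma_sets UNIV {U. open U}" using A gen by simp
  ultimately show ?thesis
  proof (induction rule: sigma_sets_induct_disjoint)
    case (basic A) then show ?case using op by simp
  next
    case empty show ?case by (simp add: set_lebesgue_integral_def)
  next
    case (compl A)
    then have A: "A \<in> sets borel" by (simp add: gen)
    have "(LINT x:UNIV|lebesgue. g x) = (LINT x:A \<union> (UNIV - A)|lebesgue. g x)" by (simp add: Un_absorb1)
    also have "\<dots> = (LINT x:A|lebesgue. g x) + (LINT x:UNIV - A|lebesgue. g x)"
      using A by (intro set_integral_Un si) auto
    finally show ?case using compl op[of UNIV] by simp
  next
    case (union A)
    then have A: "A i \<in> sets borel" for i using gen by auto
    have "(LINT x:(\<Union>i. A i)|lebesgue. g x) = (\<Sum>i. LINT x:A i|lebesgue. g x)"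
      using A union(1) by (intro lebesgue_integral_countable_add si) (auto simp: disjoint_family_on_def)
    then show ?case using union by simp
  qed
qed

lemma AE_zero_of_integral_borel_zero:
  fixes f :: "'a::euclidean_space \<Rightarrow> real"
  assumes int: "integrable lebesgue f" and zero: "\<And>A. A \<in> sets borel \<Longrightarrow> (LINT x:A|lebesgue. f x) = 0"
  shows "AE x in lebesgue. f x \<le> 0"
proof -
  define S where "S = {x. f x > 0}"
  have f: "f \<in> borel_measurable lebesgue" using int by (rule borel_measurable_integrable)
  have S: "S \<in> sets lebesgue" using f by (simp add: S_def borel_measurable_iff_greater)
  \<comment> \<open>The set of positivity is only Lebesgue measurable, while the hypothesis speaks
    of Borel sets; the Borel part \<open>C\<close> differs from it by a null set.\<close>
  then obtain C T N where CT: "S = C \<union> T" "T \<subseteq> N" "N \<in> null_sets lborel" "C \<in> sets lborel"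
    by (rule sets_completionE)
  then have C: "C \<in> sets borel" by simp
  have TN: "AE x in lebesgue. x \<notin> T"
    using AE_completion[OF AE_not_in[OF CT(3)]] by eventually_elim (use CT(2) in blast)
  have "(LINT x|lebesgue. indicator S x * f x) = (LINT x:C|lebesgue. f x)"
    unfolding set_lebesgue_integral_def
  proof (rule integral_cong_AE)
    show "AE x in lebesgue. indicator S x * f x = indicator C x *\<^sub>R f x"
      using TN by eventually_elim (use CT(1) in \<open>auto simp: indicator_def\<close>)
  qed (use f S C in \<open>auto intro!: borel_measurable_times borel_measurable_indicator\<close>)
  then have "(LINT x|lebesgue. indicator S x * f x) = 0" using zero[OF C] by simp
  moreover have "integrable lebesgue (\<lambda>x. indicator S x * f x)"
    using integrable_mult_indicator[OF S int] by simp
  ultimately have "AE x in lebesgue. indicator S x * f x = 0"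
    by (subst (asm) integral_nonneg_eq_0_iff_AE) (auto simp: S_def indicator_def)
  then show ?thesis by eventually_elim (auto simp: S_def indicator_def split: if_splits)
qed

text \<open>As \<open>g\<close> is only locally integrable, the argument is made on each of
  countably many closed boxes that exhaust \<Omega>, after cutting \<open>g\<close> off to the box.
  The boundary of a box is null, so open sets can be intersected with its interior.\<close>

lemma fundamental_lemma_calculus_of_variations:
  fixes g :: "real^'n \<Rightarrow> complex"
  assumes "open \<Omega>" and loc: "\<And>K. compact K \<Longrightarrow> K \<subseteq> \<Omega> \<Longrightarrow> set_integrable lebesgue K g"
    and zero: "\<And>\<phi>. \<phi> \<in> test_functions \<Omega> \<Longrightarrow> (LINT x:\<Omega>|lebesgue. g x * \<phi> x) = 0"
  shows "AE x in lebesgue. x \<in> \<Omega> \<longrightarrow> g x = 0"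
proof -
  obtain \<D> where \<D>: "countable \<D>" "\<D> \<subseteq> Pow \<Omega>" "\<And>X. X \<in> \<D> \<Longrightarrow> \<exists>a b. X = cbox a b" "\<Union>\<D> = \<Omega>"
    using open_countable_Union_open_cbox[OF assms(1)] by metis
  have "AE x in lebesgue. x \<in> X \<longrightarrow> g x = 0" if X: "X \<in> \<D>" for X
  proof -
    obtain a b where ab: "X = cbox a b" using \<D>(3) X by blast
    have K: "compact X" "X \<subseteq> \<Omega>" using ab X \<D>(2) by auto
    let ?g = "\<lambda>x. indicator X x *\<^sub>R g x"
    have int: "integrable lebesgue ?g" using loc[OF K] by (simp add: set_integrable_def)
    have null: "AE x in lebesgue. x \<notin> cbox a b - box a b"
      by (rule AE_completion[OF AE_not_in[OF null_sets_cbox_Diff_box]])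
    have op: "(LINT x:U|lebesgue. ?g x) = 0" if U: "open U" for U
    proof -
      have "(LINT x:U|lebesgue. ?g x) = (LINT x:U \<inter> box a b|lebesgue. g x)"
        unfolding set_lebesgue_integral_def
      proof (rule integral_cong_AE)
        show "(\<lambda>x. indicator U x *\<^sub>R ?g x) \<in> borel_measurable lebesgue"
          using U by (intro borel_measurable_integrable integrable_mult_indicator int) auto
        have "set_integrable lebesgue (U \<inter> box a b) g"
          by (rule set_integrable_subset[OF loc[OF K]]) (use U ab box_subset_cbox in auto)
        then show "(\<lambda>x. indicator (U \<inter> box a b) x *\<^sub>R g x) \<in> borel_measurable lebesgue"
          by (simp add: set_integrable_def borel_measurable_integrable)
        show "AE x in lebesgue. indicator U x *\<^sub>R ?g x = indicator (U \<inter> box a b) x *\<^sub>R g x"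
          using null by eventually_elim (use box_subset_cbox[of a b] ab in \<open>auto simp: indicator_def\<close>)
      qed
      also have "\<dots> = 0"
        by (rule integral_open_subset_zero[OF loc zero K]) (use U ab box_subset_cbox[of a b] in auto)
      finally show ?thesis .
    qed
    have bor: "(LINT x:A|lebesgue. ?g x) = 0" if "A \<in> sets borel" for A
      using integral_borel_subset_zero[OF int _ that] op by blast
    \<comment> \<open>Only a one-sided inequality results for each real functional; real and
      imaginary part, each with both signs, together give zero.\<close>
    have part: "AE x in lebesgue. h (?g x) \<le> 0" if h: "bounded_linear h" for h :: "complex \<Rightarrow> real"
    proof (rule AE_zero_of_integral_borel_zero)
      show "integrable lebesgue (\<lambda>x. h (?g x))" by (rule integrable_bounded_linear[OF h int])
      fix A :: "(real^'n) set" assume A: "A \<in> sets borel"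
      have "integrable lebesgue (\<lambda>x. indicator A x *\<^sub>R ?g x)" using A by (intro integrable_mult_indicator int) auto
      then have "(LINT x|lebesgue. h (indicator A x *\<^sub>R ?g x)) = h (LINT x|lebesgue. indicator A x *\<^sub>R ?g x)"
        by (rule integral_bounded_linear[OF h])
      also have "\<dots> = h 0" using bor[OF A] by (simp only: set_lebesgue_integral_def)
      finally show "(LINT x:A|lebesgue. h (?g x)) = 0"
        using h by (simp only: set_lebesgue_integral_def linear_simps)
    qed
    have "AE x in lebesgue. ?g x = 0"
      using part[OF bounded_linear_Re] part[OF bounded_linear_Im]
        part[OF bounded_linear_minus[OF bounded_linear_Re]] part[OF bounded_linear_minus[OF bounded_linear_Im]]
      by eventually_elim (auto simp: complex_eq_iff)
    then show ?thesis by eventually_elim (auto simp: indicator_def split: if_splits)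
  qed
  then have "AE x in lebesgue. \<forall>X\<in>\<D>. x \<in> X \<longrightarrow> g x = 0"
    using AE_ball_countable[OF \<D>(1), where P="\<lambda>x X. x \<in> X \<longrightarrow> g x = 0"] by blast
  then show ?thesis by eventually_elim (use \<D>(4) in blast)
qed

section \<open>Weak gradients\<close>

definition grad :: "(real^'n \<Rightarrow> complex) \<Rightarrow> real^'n \<Rightarrow> complex^'n" where
  "grad \<phi> x = (\<chi> j. frechet_derivative \<phi> (at x) (axis j 1))"

lemma test_function_has_derivative:
  assumes "\<phi> \<in> test_functions \<Omega>"
  shows "(\<phi> has_derivative frechet_derivative \<phi> (at x)) (at x)"
proof -
  have "Ck_on (Suc 0) \<phi> UNIV" using assms by (simp add: test_functions_def)
  then show ?thesis by (rule Ck_on_has_derivative) simp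
qed

lemma test_function_continuous: "\<phi> \<in> test_functions \<Omega> \<Longrightarrow> continuous_on UNIV \<phi>"
  unfolding test_functions_def by (metis (mono_tags, lifting) Ck_on.simps(1) mem_Collect_eq)

lemma test_function_derivative_continuous:
  assumes "\<phi> \<in> test_functions \<Omega>"
  shows "continuous_on UNIV (\<lambda>x. frechet_derivative \<phi> (at x) v)"
proof -
  have "Ck_on (Suc 0) \<phi> UNIV" using assms by (simp add: test_functions_def)
  then show ?thesis by simp
qed

lemma grad_continuous:
  assumes "\<phi> \<in> test_functions \<Omega>"
  shows "continuous_on UNIV (grad \<phi>)"
  unfolding grad_def[abs_def] by (intro continuous_on_vec_lambda test_function_derivative_continuous[OF assms])

lemma has_derivative_locally_zero:
  fixes \<phi> :: "'a::real_normed_vector \<Rightarrow> 'b::real_normed_vector"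
  assumes "open S" "x \<in> S" "\<And>y. y \<in> S \<Longrightarrow> \<phi> y = 0"
  shows "frechet_derivative \<phi> (at x) v = 0"
proof -
  have "((\<lambda>_. 0) has_derivative (\<lambda>_. 0)) (at x)" by simp
  then have "(\<phi> has_derivative (\<lambda>_. 0)) (at x)"
    by (rule has_derivative_transform_within_open[OF _ assms(1,2)]) (simp add: assms(3))
  then have "frechet_derivative \<phi> (at x) = (\<lambda>_. 0)" by (rule frechet_derivative_at[symmetric])
  then show ?thesis by simp
qed

lemma test_function_support:
  assumes "\<phi> \<in> test_functions \<Omega>"
  obtains K where "compact K" "K \<subseteq> \<Omega>" "\<And>x. x \<notin> K \<Longrightarrow> \<phi> x = 0"
    "\<And>x v. x \<notin> K \<Longrightarrow> frechet_derivative \<phi> (at x) v = 0" "\<And>x. x \<notin> K \<Longrightarrow> grad \<phi> x = 0"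
proof -
  define K where "K = closure {x. \<phi> x \<noteq> 0}"
  have K: "compact K" "K \<subseteq> \<Omega>" using assms by (auto simp: test_functions_def K_def)
  have z: "\<phi> x = 0" if "x \<notin> K" for x
  proof (rule ccontr)
    assume "\<phi> x \<noteq> 0"
    then have "x \<in> K" unfolding K_def by (intro subsetD[OF closure_subset]) simp
    then show False using that by simp
  qed
  have d: "frechet_derivative \<phi> (at x) v = 0" if "x \<notin> K" for x v
  proof (rule has_derivative_locally_zero)
    show "open (- K)" using compact_imp_closed[OF K(1)] by (rule open_Compl)
  qed (use that z in auto)
  show ?thesis by (rule that[OF K z d]) (simp_all add: grad_def d vec_eq_iff)
qed

lemma frechet_derivative_grad:
  assumes "\<phi> \<in> test_functions \<Omega>"
  shows "frechet_derivative \<phi> (at x) v = (\<Sum>j\<in>UNIV. of_real (v $ j) * grad \<phi> x $ j)"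
proof -
  have lin: "linear (frechet_derivative \<phi> (at x))"
    using test_function_has_derivative[OF assms] by (rule has_derivative_linear)
  have "v = (\<Sum>j\<in>UNIV. v $ j *\<^sub>R axis j 1)"
    using basis_expansion[of v] by (simp add: scalar_mult_eq_scaleR)
  then have "frechet_derivative \<phi> (at x) v = frechet_derivative \<phi> (at x) (\<Sum>j\<in>UNIV. v $ j *\<^sub>R axis j 1)" by simp
  also have "\<dots> = (\<Sum>j\<in>UNIV. v $ j *\<^sub>R frechet_derivative \<phi> (at x) (axis j 1))"
    by (simp add: linear_sum[OF lin] linear_scale[OF lin])
  finally show ?thesis by (simp add: grad_def scaleR_conv_of_real)
qed

section \<open>Integration by parts for test functions\<close>

lemma integrable_continuous_compact_support:
  fixes f :: "'a::euclidean_space \<Rightarrow> 'b::euclidean_space"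
  assumes "continuous_on UNIV f" "compact K" "\<And>x. x \<notin> K \<Longrightarrow> f x = 0"
  shows "integrable lborel f"
proof -
  have "integrable lborel (\<lambda>x. indicator K x *\<^sub>R f x)"
    using assms by (intro borel_integrable_compact) (auto intro: continuous_on_subset)
  moreover have "indicator K x *\<^sub>R f x = f x" for x using assms(3)[of x] by (simp add: indicator_def)
  ultimately show ?thesis by simp
qed

text \<open>Difference quotients have integral zero by translation invariance, and they converge to
  the derivative under a common integrable bound. This replaces iterated one-dimensional
  integration.\<close>

lemma integral_directional_derivative_zero:
  fixes f :: "'a::euclidean_space \<Rightarrow> complex"
  assumes der: "\<And>x. (f has_derivative D x) (at x)" and cont: "continuous_on UNIV (\<lambda>x. D x v)"
    and K: "compact K" "\<And>x. x \<notin> K \<Longrightarrow> f x = 0" "\<And>x. x \<notin> K \<Longrightarrow> D x v = 0"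
  shows "(LINT x|lborel. D x v) = 0"
proof -
  obtain R where R: "\<And>x. x \<in> K \<Longrightarrow> norm x \<le> R" using compact_imp_bounded[OF K(1)] by (auto simp: bounded_iff)
  obtain B where B: "\<And>x. norm (D x v) \<le> B"
  proof -
    have "compact ((\<lambda>x. D x v) ` K)" using K cont by (intro compact_continuous_image) (auto intro: continuous_on_subset)
    then have "bounded ((\<lambda>x. D x v) ` K)" by (rule compact_imp_bounded)
    then obtain B where "\<And>x. x \<in> K \<Longrightarrow> norm (D x v) \<le> B" by (auto simp: bounded_iff)
    then have "norm (D x v) \<le> max 0 B" for x using K(3)[of x] by (cases "x \<in> K") (auto simp: le_max_iff_disj)
    then show ?thesis by (rule that)
  qed
  have cf: "continuous_on UNIV f"
    using der by (intro continuous_at_imp_continuous_on ballI) (auto intro: has_derivative_continuous)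
  have fint: "integrable lborel f" by (rule integrable_continuous_compact_support[OF cf K(1,2)])
  define c where "c m = inverse (real (Suc m))" for m
  have c: "0 < c m" "c m \<le> 1" for m by (auto simp: c_def inverse_le_1_iff)
  define q where "q m x = (f (x + c m *\<^sub>R v) - f x) /\<^sub>R c m" for m x
  have "(\<lambda>m. LINT x|lborel. q m x) \<longlonglongrightarrow> (LINT x|lborel. D x v)"
  \<comment> \<open>All increments \<open>c m\<close> are at most 1, so every quotient vanishes
    outside the ball of radius \<open>R + norm v\<close>; inside, the mean value theorem bounds it
    by \<open>B\<close>.\<close>
  proof (rule integral_dominated_convergence[where w="\<lambda>x. indicator (cball 0 (R + norm v)) x *\<^sub>R B"])
    show "(\<lambda>x. D x v) \<in> borel_measurable lborel"
      using cont by (simp add: borel_measurable_continuous_onI)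
    have cq: "continuous_on UNIV (q m)" for m
      unfolding q_def by (intro continuous_intros continuous_on_compose2[OF cf]) auto
    show "q m \<in> borel_measurable lborel" for m
      using cq by (simp add: borel_measurable_continuous_onI)
    show "integrable lborel (\<lambda>x::'a. indicator (cball 0 (R + norm v)) x *\<^sub>R B)"
      by (rule borel_integrable_compact) auto
    show "AE x in lborel. (\<lambda>m. q m x) \<longlonglongrightarrow> D x v"
    proof (rule AE_I2)
      fix x
      have "((\<lambda>t. x + t *\<^sub>R v) has_derivative (\<lambda>t. t *\<^sub>R v)) (at 0)"
        by (auto intro!: derivative_eq_intros)
      moreover have "(f has_derivative D x) (at (x + 0 *\<^sub>R v))" using der by simp
      ultimately have "((\<lambda>t. f (x + t *\<^sub>R v)) has_derivative (\<lambda>t. D x (t *\<^sub>R v))) (at 0)"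
        by (rule has_derivative_compose)
      moreover have "(\<lambda>t. D x (t *\<^sub>R v)) = (\<lambda>t. t *\<^sub>R D x v)"
        using linear_scale[OF has_derivative_linear[OF der]] by auto
      ultimately have "((\<lambda>t. f (x + t *\<^sub>R v)) has_derivative (\<lambda>t. t *\<^sub>R D x v)) (at 0)" by simp
      then have lim: "((\<lambda>t. norm (f (x + (0 + t) *\<^sub>R v) - f (x + 0 *\<^sub>R v) - t *\<^sub>R D x v) / norm t) \<longlongrightarrow> 0) (at 0)"
        unfolding has_derivative_at by blast
      have "((\<lambda>t. (f (x + t *\<^sub>R v) - f x) /\<^sub>R t - D x v) \<longlongrightarrow> 0) (at 0)"
      proof (rule tendsto_norm_zero_cancel, rule Lim_transform_eventually[OF lim])
        have "norm (f (x + (0 + t) *\<^sub>R v) - f (x + 0 *\<^sub>R v) - t *\<^sub>R D x v) / norm t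
            = norm ((f (x + t *\<^sub>R v) - f x) /\<^sub>R t - D x v)" if "t \<noteq> 0" for t
        proof -
          have "(f (x + t *\<^sub>R v) - f x) /\<^sub>R t - D x v = (f (x + t *\<^sub>R v) - f x - t *\<^sub>R D x v) /\<^sub>R t"
            using that by (simp add: scaleR_diff_right)
          then show ?thesis by (simp add: divide_inverse_commute)
        qed
        then show "\<forall>\<^sub>F t in at 0. norm (f (x + (0 + t) *\<^sub>R v) - f (x + 0 *\<^sub>R v) - t *\<^sub>R D x v) / norm t
            = norm ((f (x + t *\<^sub>R v) - f x) /\<^sub>R t - D x v)"
          by (auto simp: eventually_at_filter)
      qed
      then have "((\<lambda>t. (f (x + t *\<^sub>R v) - f x) /\<^sub>R t) \<longlongrightarrow> D x v) (at 0)" by (rule LIM_zero_cancel)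
      moreover have "filterlim c (at 0) sequentially"
        using LIMSEQ_inverse_real_of_nat c by (auto simp: filterlim_at c_def[abs_def] intro!: always_eventually)
      ultimately show "(\<lambda>m. q m x) \<longlonglongrightarrow> D x v"
        unfolding q_def by (rule filterlim_compose)
    qed
    show "AE x in lborel. norm (q m x) \<le> indicator (cball 0 (R + norm v)) x *\<^sub>R B" for m
    proof (rule AE_I2)
      fix x
      show "norm (q m x) \<le> indicator (cball 0 (R + norm v)) x *\<^sub>R B"
      proof (cases "x \<in> cball 0 (R + norm v)")
        case False
        have "x \<notin> K" using R[of x] False norm_ge_zero[of v] by fastforce
        moreover have "x + c m *\<^sub>R v \<notin> K"
        proof
          assume "x + c m *\<^sub>R v \<in> K"
          then have "norm (x + c m *\<^sub>R v) \<le> R" by (rule R)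
          moreover have "norm x \<le> norm (x + c m *\<^sub>R v) + norm (c m *\<^sub>R v)"
            using norm_triangle_ineq4[of "x + c m *\<^sub>R v" "c m *\<^sub>R v"] by simp
          moreover have "norm (c m *\<^sub>R v) \<le> norm v" using c[of m] by (simp add: mult_left_le_one_le)
          ultimately show False using False by simp
        qed
        ultimately show ?thesis using False K(2) by (simp add: q_def)
      next
        case True
        have "norm (f (x + c m *\<^sub>R v) - f (x + 0 *\<^sub>R v)) \<le> B * norm (c m - 0)"
        proof (rule differentiable_bound[of UNIV])
          fix t :: real
          have "((\<lambda>t. x + t *\<^sub>R v) has_derivative (\<lambda>t. t *\<^sub>R v)) (at t)"
            by (auto intro!: derivative_eq_intros)
          from has_derivative_compose[OF this der]
          show "((\<lambda>t. f (x + t *\<^sub>R v)) has_derivative (\<lambda>s. D (x + t *\<^sub>R v) (s *\<^sub>R v))) (at t within UNIV)" .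
          have "norm (D (x + t *\<^sub>R v) (s *\<^sub>R v)) \<le> B * norm s" for s
            using linear_scale[OF has_derivative_linear[OF der[of "x + t *\<^sub>R v"]], of s v] B[of "x + t *\<^sub>R v"]
            by (simp add: mult.commute[of B] mult_left_mono)
          then show "onorm (\<lambda>s. D (x + t *\<^sub>R v) (s *\<^sub>R v)) \<le> B"
            by (intro onorm_le)
        qed auto
        then have "norm (q m x) \<le> B" using c[of m] by (simp add: q_def divide_inverse_commute[symmetric] pos_divide_le_eq)
        then show ?thesis using True by simp
      qed
    qed
  qed
  moreover have "(LINT x|lborel. q m x) = 0" for m
  proof -
    have tr: "(LINT x|lborel. f (x + c m *\<^sub>R v)) = (LINT x|lborel. f x)"
      and "integrable lborel (\<lambda>x. f (x + c m *\<^sub>R v))"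
    proof -
      have m: "f \<in> borel_measurable borel" using cf by (rule borel_measurable_continuous_onI)
      have "integrable (distr lborel borel ((+) (c m *\<^sub>R v))) f" using fint by (simp add: lborel_distr_plus)
      then show "integrable lborel (\<lambda>x. f (x + c m *\<^sub>R v))"
        by (subst (asm) integrable_distr_eq) (auto simp: m add.commute)
      have "(LINT x|lborel. f x) = (LINT x|distr lborel borel ((+) (c m *\<^sub>R v)). f x)" by (simp add: lborel_distr_plus)
      also have "\<dots> = (LINT x|lborel. f (x + c m *\<^sub>R v))" by (subst integral_distr) (auto simp: m add.commute)
      finally show "(LINT x|lborel. f (x + c m *\<^sub>R v)) = (LINT x|lborel. f x)" by simp
    qed
    then show ?thesis unfolding q_def using fint by (simp add: integral_scaleR_right Bochner_Integration.integral_diff)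
  qed
  ultimately show ?thesis by (simp add: LIMSEQ_const_iff)
qed

lemma set_integrable_mult_test_function:
  fixes g :: "real^'n \<Rightarrow> complex"
  assumes "open \<Omega>" and loc: "\<And>K. compact K \<Longrightarrow> K \<subseteq> \<Omega> \<Longrightarrow> set_integrable lebesgue K g"
    and h: "continuous_on UNIV h" and K: "compact K" "K \<subseteq> \<Omega>" "\<And>x. x \<notin> K \<Longrightarrow> h x = 0"
  shows "set_integrable lebesgue \<Omega> (\<lambda>x. g x * h x)"
proof -
  have int: "integrable lebesgue (\<lambda>x. indicator K x *\<^sub>R g x)" using loc[OF K(1,2)] by (simp add: set_integrable_def)
  have "compact (h ` K)" using K h by (intro compact_continuous_image) (auto intro: continuous_on_subset)
  then have "bounded (h ` K)" by (rule compact_imp_bounded)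
  then obtain B where B: "\<And>x. x \<in> K \<Longrightarrow> norm (h x) \<le> B" by (auto simp: bounded_iff)
  have hm: "h \<in> borel_measurable lebesgue"
    using borel_measurable_continuous_onI[OF h] by (simp add: measurable_completion)
  have "integrable lebesgue (\<lambda>x. (indicator K x *\<^sub>R g x) * h x)"
  proof (rule Bochner_Integration.integrable_bound)
    show "integrable lebesgue (\<lambda>x. B *\<^sub>R norm (indicator K x *\<^sub>R g x))"
      by (intro integrable_scaleR_right integrable_norm int)
    show "(\<lambda>x. (indicator K x *\<^sub>R g x) * h x) \<in> borel_measurable lebesgue"
      by (intro borel_measurable_times borel_measurable_integrable[OF int] hm)
    show "AE x in lebesgue. norm ((indicator K x *\<^sub>R g x) * h x) \<le> norm (B *\<^sub>R norm (indicator K x *\<^sub>R g x))"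
    proof (rule AE_I2)
      fix x
      show "norm ((indicator K x *\<^sub>R g x) * h x) \<le> norm (B *\<^sub>R norm (indicator K x *\<^sub>R g x))"
      proof (cases "x \<in> K")
        case True
        have "norm (h x) \<le> \<bar>B\<bar>" using B[OF True] by simp
        then show ?thesis using True by (simp add: norm_mult abs_mult mult.commute[of "cmod (g x)"] mult_right_mono)
      qed simp
    qed
  qed
  moreover have "(\<lambda>x. (indicator K x *\<^sub>R g x) * h x) = (\<lambda>x. indicator \<Omega> x *\<^sub>R (g x * h x))"
    using K(2,3) by (auto simp: indicator_def fun_eq_iff)
  ultimately show ?thesis by (simp add: set_integrable_def)
qed

lemma set_integrable_vec_nth:
  fixes G :: "'a \<Rightarrow> complex^'n"
  assumes "set_integrable M K G"
  shows "set_integrable M K (\<lambda>x. G x $ j)"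
proof -
  have "integrable M (\<lambda>x. (indicator K x *\<^sub>R G x) $ j)"
    using assms unfolding set_integrable_def by (rule integrable_bounded_linear[OF bounded_linear_vec_nth])
  then show ?thesis by (simp add: set_integrable_def)
qed

text \<open>The operator \<open>weak_gradient\<close> makes independent choices for \<open>u\<close>
  and for \<open>u - \<phi>\<close>. Uniqueness almost everywhere is what makes these choices
  compatible.\<close>

lemma has_weak_gradient_unique:
  assumes "open \<Omega>" "has_weak_gradient u G \<Omega>" "has_weak_gradient u H \<Omega>"
  shows "AE x in lebesgue. x \<in> \<Omega> \<longrightarrow> G x = H x"
proof -
  have "AE x in lebesgue. x \<in> \<Omega> \<longrightarrow> G x $ j - H x $ j = 0" for j
  proof (rule fundamental_lemma_calculus_of_variations[OF assms(1)])
    have G: "set_integrable lebesgue K (\<lambda>x. G x $ j)" "set_integrable lebesgue K (\<lambda>x. H x $ j)"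
      if "compact K" "K \<subseteq> \<Omega>" for K
      using assms(2,3) that by (auto simp: has_weak_gradient_def intro!: set_integrable_vec_nth)
    then show "set_integrable lebesgue K (\<lambda>x. G x $ j - H x $ j)" if "compact K" "K \<subseteq> \<Omega>" for K
      using that by (intro set_integral_diff) auto
    fix \<phi> assume \<phi>: "\<phi> \<in> test_functions \<Omega>"
    then obtain K where K: "compact K" "K \<subseteq> \<Omega>" "\<And>x. x \<notin> K \<Longrightarrow> \<phi> x = 0" by (rule test_function_support) blast
    have int: "set_integrable lebesgue \<Omega> (\<lambda>x. G x $ j * \<phi> x)" "set_integrable lebesgue \<Omega> (\<lambda>x. H x $ j * \<phi> x)"
      by (rule set_integrable_mult_test_function[OF assms(1) G(1) test_function_continuous[OF \<phi>] K], assumption+)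
         (rule set_integrable_mult_test_function[OF assms(1) G(2) test_function_continuous[OF \<phi>] K], assumption+)
    have "(LINT x:\<Omega>|lebesgue. (G x $ j - H x $ j) * \<phi> x) = (LINT x:\<Omega>|lebesgue. G x $ j * \<phi> x) - (LINT x:\<Omega>|lebesgue. H x $ j * \<phi> x)"
      using set_integral_diff(2)[OF int] by (simp add: left_diff_distrib)
    also have "(LINT x:\<Omega>|lebesgue. G x $ j * \<phi> x) = (LINT x:\<Omega>|lebesgue. H x $ j * \<phi> x)"
      using assms(2,3) \<phi> by (simp add: has_weak_gradient_def)
    finally show "(LINT x:\<Omega>|lebesgue. (G x $ j - H x $ j) * \<phi> x) = 0" by simp
  qed
  then have "AE x in lebesgue. \<forall>j. x \<in> \<Omega> \<longrightarrow> G x $ j - H x $ j = 0"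
    using AE_all_countable[where P="\<lambda>j x. x \<in> \<Omega> \<longrightarrow> G x $ j - H x $ j = 0"] by blast
  then show ?thesis by eventually_elim (simp add: vec_eq_iff)
qed

lemma set_integrable_continuous_compact:
  fixes f :: "'a::euclidean_space \<Rightarrow> 'b::euclidean_space"
  assumes "continuous_on UNIV f" "compact K"
  shows "set_integrable lebesgue K f"
proof -
  have "integrable lborel (\<lambda>x. indicator K x *\<^sub>R f x)"
    using assms by (intro borel_integrable_compact) (auto intro: continuous_on_subset)
  then show ?thesis unfolding set_integrable_def
    using integrable_completion[of "\<lambda>x. indicator K x *\<^sub>R f x" lborel] borel_measurable_integrable by blast
qed

lemma test_function_integration_by_parts:
  fixes \<phi> \<psi> :: "real^'n \<Rightarrow> complex"
  assumes \<phi>: "\<phi> \<in> test_functions \<Omega>" and \<psi>: "\<psi> \<in> test_functions \<Omega>"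
  shows "(LINT x:\<Omega>|lebesgue. \<phi> x * frechet_derivative \<psi> (at x) v)
    = - (LINT x:\<Omega>|lebesgue. frechet_derivative \<phi> (at x) v * \<psi> x)"
proof -
  obtain K where K: "compact K" "K \<subseteq> \<Omega>" "\<And>x. x \<notin> K \<Longrightarrow> \<phi> x = 0" "\<And>x v. x \<notin> K \<Longrightarrow> frechet_derivative \<phi> (at x) v = 0"
    using \<phi> by (rule test_function_support) blast
  let ?f = "\<lambda>x. \<phi> x * frechet_derivative \<psi> (at x) v" and ?g = "\<lambda>x. frechet_derivative \<phi> (at x) v * \<psi> x"
  note cont = test_function_continuous[OF \<phi>] test_function_continuous[OF \<psi>]
    test_function_derivative_continuous[OF \<phi>, of v] test_function_derivative_continuous[OF \<psi>, of v]
  have cf: "continuous_on UNIV ?f" and cg: "continuous_on UNIV ?g"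
    by (intro continuous_on_mult cont)+
  have int: "integrable lborel ?f" "integrable lborel ?g"
    by (rule integrable_continuous_compact_support[OF cf K(1)], simp add: K)
       (rule integrable_continuous_compact_support[OF cg K(1)], simp add: K)
  have "(LINT x|lborel. ?f x + ?g x) = 0"
  proof (rule integral_directional_derivative_zero[OF _ _ K(1)])
    show "((\<lambda>x. \<phi> x * \<psi> x) has_derivative (\<lambda>v. \<phi> x * frechet_derivative \<psi> (at x) v + frechet_derivative \<phi> (at x) v * \<psi> x)) (at x)" for x
      by (intro has_derivative_mult test_function_has_derivative[OF \<phi>] test_function_has_derivative[OF \<psi>])
    show "continuous_on UNIV (\<lambda>x. ?f x + ?g x)" by (intro continuous_on_add cf cg)
  qed (simp_all add: K)
  then have *: "(LINT x|lborel. ?f x) = - (LINT x|lborel. ?g x)"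
    using int by (simp add: eq_neg_iff_add_eq_0)
  have eq: "(LINT x:\<Omega>|lebesgue. h x) = (LINT x|lborel. h x)"
    if "continuous_on UNIV h" "\<And>x. x \<notin> K \<Longrightarrow> h x = 0" for h :: "real^'n \<Rightarrow> complex"
  proof -
    have "(\<lambda>x. indicator \<Omega> x *\<^sub>R h x) = h" using that(2) K(2) by (auto simp: fun_eq_iff indicator_def)
    moreover have "h \<in> borel_measurable lborel" using borel_measurable_continuous_onI[OF that(1)] by simp
    ultimately show ?thesis by (simp add: set_lebesgue_integral_def integral_completion)
  qed
  show ?thesis using * by (subst (1 2) eq) (simp_all add: cf cg K)
qed

lemma has_weak_gradient_diff_test_function:
  fixes u \<phi> :: "real^'n \<Rightarrow> complex"
  assumes "open \<Omega>" and u: "has_weak_gradient u G \<Omega>" and \<phi>: "\<phi> \<in> test_functions \<Omega>"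
  shows "has_weak_gradient (\<lambda>x. u x - \<phi> x) (\<lambda>x. G x - grad \<phi> x) \<Omega>"
  unfolding has_weak_gradient_def
proof (intro conjI allI impI ballI)
  fix K :: "(real^'n) set" assume K: "compact K \<and> K \<subseteq> \<Omega>"
  have uK: "set_integrable lebesgue K u" "set_integrable lebesgue K G"
    using u K by (auto simp: has_weak_gradient_def)
  show "set_integrable lebesgue K (\<lambda>x. u x - \<phi> x)"
    by (intro set_integral_diff(1) uK set_integrable_continuous_compact test_function_continuous[OF \<phi>] conjunct1[OF K])
  show "set_integrable lebesgue K (\<lambda>x. G x - grad \<phi> x)"
    by (intro set_integral_diff(1) uK set_integrable_continuous_compact grad_continuous[OF \<phi>] conjunct1[OF K])
next
  fix \<psi> j assume \<psi>: "\<psi> \<in> test_functions \<Omega>"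
  let ?v = "axis j 1 :: real^'n"
  let ?D = "\<lambda>\<phi> x. frechet_derivative \<phi> (at x) ?v"
  obtain K where K: "compact K" "K \<subseteq> \<Omega>" "\<And>x. x \<notin> K \<Longrightarrow> \<psi> x = 0" "\<And>x v. x \<notin> K \<Longrightarrow> frechet_derivative \<psi> (at x) v = 0"
    using \<psi> by (rule test_function_support) blast
  have loc: "set_integrable lebesgue K u" "set_integrable lebesgue K (\<lambda>x. G x $ j)"
     "set_integrable lebesgue K \<phi>" "set_integrable lebesgue K (\<lambda>x. grad \<phi> x $ j)"
    if "compact K" "K \<subseteq> \<Omega>" for K
  proof -
    show "set_integrable lebesgue K u" "set_integrable lebesgue K (\<lambda>x. G x $ j)"
      using u that by (auto simp: has_weak_gradient_def intro!: set_integrable_vec_nth)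
    show "set_integrable lebesgue K \<phi>"
      by (rule set_integrable_continuous_compact[OF test_function_continuous[OF \<phi>] that(1)])
    show "set_integrable lebesgue K (\<lambda>x. grad \<phi> x $ j)"
      by (rule set_integrable_vec_nth[OF set_integrable_continuous_compact[OF grad_continuous[OF \<phi>] that(1)]])
  qed
  have int: "set_integrable lebesgue \<Omega> (\<lambda>x. g x * \<psi> x)" "set_integrable lebesgue \<Omega> (\<lambda>x. g x * ?D \<psi> x)"
    if "\<And>K. compact K \<Longrightarrow> K \<subseteq> \<Omega> \<Longrightarrow> set_integrable lebesgue K g" for g
    by (rule set_integrable_mult_test_function[OF assms(1) that test_function_continuous[OF \<psi>] K(1-3)], assumption+)
       (rule set_integrable_mult_test_function[OF assms(1) that test_function_derivative_continuous[OF \<psi>] K(1,2,4)], assumption+)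
  have "(LINT x:\<Omega>|lebesgue. (u x - \<phi> x) * ?D \<psi> x)
      = (LINT x:\<Omega>|lebesgue. u x * ?D \<psi> x) - (LINT x:\<Omega>|lebesgue. \<phi> x * ?D \<psi> x)"
    using set_integral_diff(2)[OF int(2)[OF loc(1)] int(2)[OF loc(3)]] by (simp add: left_diff_distrib)
  also have "\<dots> = - (LINT x:\<Omega>|lebesgue. G x $ j * \<psi> x) + (LINT x:\<Omega>|lebesgue. grad \<phi> x $ j * \<psi> x)"
    using u \<psi> test_function_integration_by_parts[OF \<phi> \<psi>, of ?v] by (simp add: has_weak_gradient_def grad_def)
  also have "\<dots> = - (LINT x:\<Omega>|lebesgue. (G x - grad \<phi> x) $ j * \<psi> x)"
    using set_integral_diff(2)[OF int(1)[OF loc(2)] int(1)[OF loc(4)]] by (simp add: left_diff_distrib)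
  finally show "(LINT x:\<Omega>|lebesgue. (u x - \<phi> x) * ?D \<psi> x) = - (LINT x:\<Omega>|lebesgue. (G x - grad \<phi> x) $ j * \<psi> x)" .
qed

text \<open>Translates closeness in \<open>H1A_norm\<close>, which involves the gradient chosen for
  the difference, into approximation of one fixed field by classical gradients of test
  functions.\<close>

lemma magnetic_gradient_diff_test_function:
  fixes u \<phi> :: "real^'n \<Rightarrow> complex"
  assumes "open \<Omega>" and u: "has_weak_gradient u G \<Omega>" and \<phi>: "\<phi> \<in> test_functions \<Omega>"
  shows "AE x in lebesgue. x \<in> \<Omega> \<longrightarrow> magnetic_gradient A \<Omega> (\<lambda>x. u x - \<phi> x) x
    = magnetic_gradient A \<Omega> u x - (\<chi> j. grad \<phi> x $ j - \<i> * complex_of_real (A x $ j) * \<phi> x)"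
proof -
  have wg: "has_weak_gradient w (weak_gradient \<Omega> w) \<Omega>" if "has_weak_gradient w H \<Omega>" for w H
    unfolding weak_gradient_def by (rule someI[of "\<lambda>G. has_weak_gradient w G \<Omega>", OF that])
  have "AE x in lebesgue. x \<in> \<Omega> \<longrightarrow> weak_gradient \<Omega> (\<lambda>x. u x - \<phi> x) x = weak_gradient \<Omega> u x - grad \<phi> x"
    using has_weak_gradient_diff_test_function[OF assms(1) wg[OF u] \<phi>]
    by (intro has_weak_gradient_unique[OF assms(1) wg])
  then show ?thesis
    by eventually_elim (simp add: magnetic_gradient_def vec_eq_iff algebra_simps)
qed

section \<open>Magnetic differences\<close>

definition hdot :: "real^'n \<Rightarrow> complex^'n \<Rightarrow> complex" where
  "hdot h D = (\<Sum>j\<in>UNIV. complex_of_real (h $ j) * D $ j)"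

text \<open>The magnetic gradient of a test function from classical derivatives: it depends on no
  choice and makes sense on the whole space.\<close>

definition mgrad :: "(real^'n \<Rightarrow> real^'n) \<Rightarrow> (real^'n \<Rightarrow> complex) \<Rightarrow> real^'n \<Rightarrow> complex^'n" where
  "mgrad A \<phi> x = (\<chi> j. grad \<phi> x $ j - \<i> * complex_of_real (A x $ j) * \<phi> x)"

text \<open>The numerator of the Gagliardo quotient at \<open>y = x + h\<close>.\<close>

definition mdiff :: "(real^'n \<Rightarrow> real^'n) \<Rightarrow> (real^'n \<Rightarrow> complex) \<Rightarrow> real^'n \<Rightarrow> real^'n \<Rightarrow> complex" where
  "mdiff A u h x = u x - exp (\<i> * complex_of_real (- (h \<bullet> A (x + h /\<^sub>R 2)))) * u (x + h)"

lemma norm_hdot_le: "norm (hdot h D) \<le> norm h * norm D"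
proof -
  have "norm (hdot h D) \<le> (\<Sum>j\<in>UNIV. \<bar>h $ j\<bar> * \<bar>norm (D $ j)\<bar>)"
    unfolding hdot_def by (rule order_trans[OF norm_sum]) (simp add: norm_mult)
  also have "\<dots> \<le> L2_set (\<lambda>j. h $ j) UNIV * L2_set (\<lambda>j. norm (D $ j)) UNIV"
    by (rule L2_set_mult_ineq)
  also have "\<dots> = norm h * norm D" by (simp add: norm_vec_def L2_set_def)
  finally show ?thesis .
qed

lemma hdot_diff: "hdot h (D - E) = hdot h D - hdot h E"
  by (simp add: hdot_def sum.distrib sum_subtractf algebra_simps)

lemma hdot_measurable[measurable (raw)]:
  assumes [measurable]: "f \<in> borel_measurable M" "g \<in> borel_measurable M"
  shows "(\<lambda>x. hdot (f x) (g x)) \<in> borel_measurable M"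
proof -
  have "(\<lambda>x. f x $ j) \<in> borel_measurable M" "(\<lambda>x. g x $ j) \<in> borel_measurable M" for j
    by (rule measurable_compose[OF assms(1)] measurable_compose[OF assms(2)],
        intro borel_measurable_continuous_onI continuous_intros)+
  then show ?thesis unfolding hdot_def by measurable
qed

lemma mdiff_diff: "mdiff A (\<lambda>x. u x - v x) h x = mdiff A u h x - mdiff A v h x"
  by (simp add: mdiff_def algebra_simps)

lemma power2_norm_add_le:
  fixes a b :: "'a::real_normed_vector"
  shows "(norm (a + b))\<^sup>2 \<le> 2 * (norm a)\<^sup>2 + 2 * (norm b)\<^sup>2"
proof -
  have "(norm (a + b))\<^sup>2 \<le> (norm a + norm b)\<^sup>2" by (intro power_mono norm_triangle_ineq) auto
  also have "\<dots> \<le> 2 * (norm a)\<^sup>2 + 2 * (norm b)\<^sup>2"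
    using sum_squares_bound[of "norm a" "norm b"] by (simp add: power2_sum)
  finally show ?thesis .
qed

lemma nn_integral_power2_add_le:
  fixes f g :: "'a::euclidean_space \<Rightarrow> 'b::{real_normed_vector, second_countable_topology}"
  assumes [measurable]: "f \<in> borel_measurable borel" "g \<in> borel_measurable borel"
  shows "(\<integral>\<^sup>+x. ennreal ((norm (f x + g x))\<^sup>2) \<partial>lborel)
    \<le> 2 * (\<integral>\<^sup>+x. ennreal ((norm (f x))\<^sup>2) \<partial>lborel) + 2 * (\<integral>\<^sup>+x. ennreal ((norm (g x))\<^sup>2) \<partial>lborel)"
proof -
  have "(\<integral>\<^sup>+x. ennreal ((norm (f x + g x))\<^sup>2) \<partial>lborel) \<le> (\<integral>\<^sup>+x. 2 * ennreal ((norm (f x))\<^sup>2) + 2 * ennreal ((norm (g x))\<^sup>2) \<partial>lborel)"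
  proof (rule nn_integral_mono)
    fix x
    have "ennreal ((norm (f x + g x))\<^sup>2) \<le> ennreal (2 * (norm (f x))\<^sup>2 + 2 * (norm (g x))\<^sup>2)"
      by (intro ennreal_leI power2_norm_add_le)
    then show "ennreal ((norm (f x + g x))\<^sup>2) \<le> 2 * ennreal ((norm (f x))\<^sup>2) + 2 * ennreal ((norm (g x))\<^sup>2)"
      by (simp add: ennreal_plus ennreal_mult)
  qed
  also have "\<dots> = 2 * (\<integral>\<^sup>+x. ennreal ((norm (f x))\<^sup>2) \<partial>lborel) + 2 * (\<integral>\<^sup>+x. ennreal ((norm (g x))\<^sup>2) \<partial>lborel)"
    by (simp add: nn_integral_add nn_integral_cmult)
  finally show ?thesis .
qed

lemma mdiff_measurable:
  assumes [measurable]: "A \<in> borel_measurable borel" "u \<in> borel_measurable borel"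
  shows "mdiff A u h \<in> borel_measurable borel"
  unfolding mdiff_def[abs_def] by measurable

text \<open>The phase has modulus one and translations preserve the integral, hence the bound is
  uniform in \<open>h\<close> and in \<open>A\<close>. It controls large steps, and for small steps
  the part of \<open>u\<close> left over by a sufficiently close test function.\<close>

lemma nn_integral_mdiff_le_L2:
  fixes u :: "real^'n \<Rightarrow> complex"
  assumes A[measurable]: "A \<in> borel_measurable borel" and u[measurable]: "u \<in> borel_measurable borel"
  shows "(\<integral>\<^sup>+x. ennreal ((norm (mdiff A u h x))\<^sup>2) \<partial>lborel) \<le> 4 * (\<integral>\<^sup>+x. ennreal ((norm (u x))\<^sup>2) \<partial>lborel)"
proof -
  let ?e = "\<lambda>x. exp (\<i> * complex_of_real (- (h \<bullet> A (x + h /\<^sub>R 2))))"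
  have "(\<integral>\<^sup>+x. ennreal ((norm (mdiff A u h x))\<^sup>2) \<partial>lborel) = (\<integral>\<^sup>+x. ennreal ((norm (u x + - (?e x * u (x + h))))\<^sup>2) \<partial>lborel)"
    by (simp add: mdiff_def)
  also have "\<dots> \<le> 2 * (\<integral>\<^sup>+x. ennreal ((norm (u x))\<^sup>2) \<partial>lborel) + 2 * (\<integral>\<^sup>+x. ennreal ((norm (- (?e x * u (x + h))))\<^sup>2) \<partial>lborel)"
    by (rule nn_integral_power2_add_le) measurable
  also have "(\<integral>\<^sup>+x. ennreal ((norm (- (?e x * u (x + h))))\<^sup>2) \<partial>lborel) = (\<integral>\<^sup>+x. ennreal ((norm (u (h + x)))\<^sup>2) \<partial>lborel)"
    by (intro nn_integral_cong) (simp only: norm_minus_cancel norm_mult norm_exp_i_times mult_1 add.commute)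
  also have "\<dots> = (\<integral>\<^sup>+x. ennreal ((norm (u x))\<^sup>2) \<partial>lborel)"
    by (rule nn_integral_lborel_translate) measurable
  finally show ?thesis by (simp add: distrib_right[symmetric])
qed

text \<open>Jensen's inequality on the unit interval, from integrating the nonnegative
  \<open>(norm (F t - c))^2\<close>.\<close>

lemma power2_norm_integral_01_le:
  fixes F :: "real \<Rightarrow> complex"
  assumes F: "(F has_integral c) {0..1}" and cont: "continuous_on {0..1} F"
  shows "(norm c)\<^sup>2 \<le> integral {0..1} (\<lambda>t. (norm (F t))\<^sup>2)"
proof -
  have "((\<lambda>t. c \<bullet> F t) has_integral c \<bullet> c) {0..1}"
    by (rule has_integral_linear[OF F bounded_linear_inner_right, unfolded o_def])
  then have "((\<lambda>t. 2 * (c \<bullet> F t)) has_integral 2 * (c \<bullet> c)) {0..1}"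
    by (rule has_integral_mult_right)
  moreover have "((\<lambda>t::real. c \<bullet> c) has_integral (c \<bullet> c)) {0..1}"
    using has_integral_const_real[of "c \<bullet> c" 0 1] by simp
  ultimately have "((\<lambda>t. 2 * (c \<bullet> F t) - c \<bullet> c) has_integral 2 * (c \<bullet> c) - c \<bullet> c) {0..1}"
    by (rule has_integral_diff)
  moreover have "((\<lambda>t. (norm (F t))\<^sup>2) has_integral integral {0..1} (\<lambda>t. (norm (F t))\<^sup>2)) {0..1}"
    by (intro integrable_integral integrable_continuous_real continuous_intros cont)
  ultimately have "2 * (c \<bullet> c) - c \<bullet> c \<le> integral {0..1} (\<lambda>t. (norm (F t))\<^sup>2)"
  proof (rule has_integral_le)
    fix t :: real
    have "0 \<le> (F t - c) \<bullet> (F t - c)" by simp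
    then show "2 * (c \<bullet> F t) - c \<bullet> c \<le> (norm (F t))\<^sup>2"
      by (simp add: power2_norm_eq_inner inner_diff inner_commute)
  qed
  then show ?thesis by (simp add: power2_norm_eq_inner)
qed

section \<open>Bounds of order \<open>norm h\<close> for test functions\<close>

lemma test_function_diff:
  assumes "\<phi> \<in> test_functions \<Omega>" "\<psi> \<in> test_functions \<Omega>"
  shows "(\<lambda>x. \<phi> x - \<psi> x) \<in> test_functions \<Omega>"
proof -
  have "Ck_on k (\<lambda>x. \<phi> x - \<psi> x) UNIV" for k
  proof -
    have "Ck_on k (\<lambda>x. - \<psi> x) UNIV"
      using assms(2) by (intro Ck_on_bounded_linear[OF open_UNIV bounded_linear_minus[OF bounded_linear_ident]]) (simp add: test_functions_def)
    then have "Ck_on k (\<lambda>x. \<phi> x + - \<psi> x) UNIV"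
      using assms(1) by (intro Ck_on_add) (auto simp: test_functions_def)
    then show ?thesis by simp
  qed
  moreover have sub: "closure {x. \<phi> x - \<psi> x \<noteq> 0} \<subseteq> closure {x. \<phi> x \<noteq> 0} \<union> closure {x. \<psi> x \<noteq> 0}"
    unfolding closure_Un[symmetric] by (rule closure_mono) auto
  moreover have "compact (closure {x. \<phi> x - \<psi> x \<noteq> 0})"
  proof -
    have "compact (closure {x. \<phi> x \<noteq> 0} \<union> closure {x. \<psi> x \<noteq> 0})"
      using assms by (intro compact_Un) (auto simp: test_functions_def)
    then have "bounded (closure {x. \<phi> x - \<psi> x \<noteq> 0})"
      using bounded_subset[OF compact_imp_bounded sub] by blast
    then show ?thesis by (simp only: compact_eq_bounded_closed closed_closure)
  qed
  ultimately show ?thesis using assms by (auto simp: test_functions_def)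
qed

lemma grad_diff:
  assumes "\<phi> \<in> test_functions \<Omega>" "\<psi> \<in> test_functions \<Omega>"
  shows "grad (\<lambda>x. \<phi> x - \<psi> x) x = grad \<phi> x - grad \<psi> x"
proof -
  have "frechet_derivative (\<lambda>x. \<phi> x - \<psi> x) (at x) = (\<lambda>v. frechet_derivative \<phi> (at x) v - frechet_derivative \<psi> (at x) v)"
    by (intro frechet_derivative_at[symmetric] has_derivative_diff test_function_has_derivative[OF assms(1)] test_function_has_derivative[OF assms(2)])
  then show ?thesis by (simp add: grad_def vec_eq_iff)
qed

lemma mgrad_diff:
  assumes "\<phi> \<in> test_functions \<Omega>" "\<psi> \<in> test_functions \<Omega>"
  shows "mgrad A (\<lambda>x. \<phi> x - \<psi> x) x = mgrad A \<phi> x - mgrad A \<psi> x"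
  by (simp add: mgrad_def vec_eq_iff grad_diff[OF assms] algebra_simps)

text \<open>The fundamental theorem of calculus along the segment from \<open>x\<close> to
  \<open>x + h\<close> and Jensen's inequality in its parameter; after exchanging the integrals,
  each translate contributes the same gradient norm.\<close>

lemma nn_integral_translation_difference_le:
  fixes \<phi> :: "real^'n \<Rightarrow> complex"
  assumes \<phi>: "\<phi> \<in> test_functions \<Omega>"
  shows "(\<integral>\<^sup>+x. ennreal ((norm (\<phi> (x + h) - \<phi> x))\<^sup>2) \<partial>lborel)
    \<le> ennreal ((norm h)\<^sup>2) * (\<integral>\<^sup>+x. ennreal ((norm (grad \<phi> x))\<^sup>2) \<partial>lborel)"
proof -
  have gm[measurable]: "grad \<phi> \<in> borel_measurable borel" by (rule borel_measurable_continuous_onI[OF grad_continuous[OF \<phi>]])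
  let ?I = "\<lambda>x. \<integral>\<^sup>+t. ennreal ((norm (grad \<phi> (t *\<^sub>R h + x)))\<^sup>2) * indicator {0..1} t \<partial>lborel"
  have pt: "ennreal ((norm (\<phi> (x + h) - \<phi> x))\<^sup>2) \<le> ennreal ((norm h)\<^sup>2) * ?I x" for x
  proof -
    let ?F = "\<lambda>t. hdot h (grad \<phi> (t *\<^sub>R h + x))"
    have der: "((\<lambda>t. \<phi> (t *\<^sub>R h + x)) has_vector_derivative ?F t) (at t within {0..1})" for t
    proof -
      have "((\<lambda>t. t *\<^sub>R h + x) has_derivative (\<lambda>s. s *\<^sub>R h)) (at t within {0..1})"
        by (auto intro!: derivative_eq_intros)
      from has_derivative_compose[OF this test_function_has_derivative[OF \<phi>]]
      have "((\<lambda>t. \<phi> (t *\<^sub>R h + x)) has_derivative (\<lambda>s. frechet_derivative \<phi> (at (t *\<^sub>R h + x)) (s *\<^sub>R h))) (at t within {0..1})" .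
      moreover have "frechet_derivative \<phi> (at (t *\<^sub>R h + x)) (s *\<^sub>R h) = s *\<^sub>R ?F t" for s
        using linear_scale[OF has_derivative_linear[OF test_function_has_derivative[OF \<phi>]]] frechet_derivative_grad[OF \<phi>]
        by (simp add: hdot_def)
      ultimately show ?thesis by (simp add: has_vector_derivative_def)
    qed
    have cont: "continuous_on {0..1} (\<lambda>t. grad \<phi> (t *\<^sub>R h + x))"
      by (rule continuous_on_compose2[OF grad_continuous[OF \<phi>]]) (auto intro!: continuous_intros)
    have "(?F has_integral \<phi> (1 *\<^sub>R h + x) - \<phi> (0 *\<^sub>R h + x)) {0..1}"
      by (rule fundamental_theorem_of_calculus[OF _ der]) simp
    then have "(norm (\<phi> (1 *\<^sub>R h + x) - \<phi> (0 *\<^sub>R h + x)))\<^sup>2 \<le> integral {0..1} (\<lambda>t. (norm (?F t))\<^sup>2)"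
      unfolding hdot_def by (rule power2_norm_integral_01_le) (intro continuous_intros cont)
    also have "\<dots> \<le> integral {0..1} (\<lambda>t. (norm h)\<^sup>2 * (norm (grad \<phi> (t *\<^sub>R h + x)))\<^sup>2)"
    proof (rule integral_le)
      show "(\<lambda>t. (norm (?F t))\<^sup>2) integrable_on {0..1}"
        unfolding hdot_def by (intro integrable_continuous_real continuous_intros cont)
      show "(\<lambda>t. (norm h)\<^sup>2 * (norm (grad \<phi> (t *\<^sub>R h + x)))\<^sup>2) integrable_on {0..1}"
        by (intro integrable_continuous_real continuous_intros cont)
      show "(norm (?F t))\<^sup>2 \<le> (norm h)\<^sup>2 * (norm (grad \<phi> (t *\<^sub>R h + x)))\<^sup>2" for t
        using norm_hdot_le[of h "grad \<phi> (t *\<^sub>R h + x)"] by (metis norm_ge_zero power_mono power_mult_distrib)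
    qed
    also have "\<dots> = (norm h)\<^sup>2 * integral {0..1} (\<lambda>t. (norm (grad \<phi> (t *\<^sub>R h + x)))\<^sup>2)"
      by (rule integral_mult_right)
    finally have le: "(norm (\<phi> (x + h) - \<phi> x))\<^sup>2 \<le> (norm h)\<^sup>2 * integral {0..1} (\<lambda>t. (norm (grad \<phi> (t *\<^sub>R h + x)))\<^sup>2)"
      by (simp add: add.commute)
    have "((\<lambda>t. (norm (grad \<phi> (t *\<^sub>R h + x)))\<^sup>2) has_integral integral {0..1} (\<lambda>t. (norm (grad \<phi> (t *\<^sub>R h + x)))\<^sup>2)) {0..1}"
      by (intro integrable_integral integrable_continuous_real continuous_intros cont)
    from nn_integral_has_integral_lebesgue[OF _ this]
    have "?I x = ennreal (integral {0..1} (\<lambda>t. (norm (grad \<phi> (t *\<^sub>R h + x)))\<^sup>2))"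
      by (simp add: nn_integral_completion ennreal_mult' ennreal_indicator mult.commute)
    then show ?thesis using le by (simp add: ennreal_mult'[symmetric] ennreal_leI)
  qed
  have "(\<integral>\<^sup>+x. ennreal ((norm (\<phi> (x + h) - \<phi> x))\<^sup>2) \<partial>lborel) \<le> (\<integral>\<^sup>+x. ennreal ((norm h)\<^sup>2) * ?I x \<partial>lborel)"
    by (intro nn_integral_mono pt)
  also have "\<dots> = ennreal ((norm h)\<^sup>2) * (\<integral>\<^sup>+x. ?I x \<partial>lborel)"
    by (rule nn_integral_cmult) measurable
  also have "(\<integral>\<^sup>+x. ?I x \<partial>lborel) = (\<integral>\<^sup>+t. \<integral>\<^sup>+x. ennreal ((norm (grad \<phi> (t *\<^sub>R h + x)))\<^sup>2) * indicator {0..1} t \<partial>lborel \<partial>lborel)"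
    by (rule lborel_pair.Fubini') measurable
  also have "\<dots> = (\<integral>\<^sup>+t. (\<integral>\<^sup>+x. ennreal ((norm (grad \<phi> x))\<^sup>2) \<partial>lborel) * indicator {0..1::real} t \<partial>lborel)"
  proof (rule nn_integral_cong)
    fix t :: real
    have "(\<integral>\<^sup>+x. ennreal ((norm (grad \<phi> (t *\<^sub>R h + x)))\<^sup>2) * indicator {0..1} t \<partial>lborel)
        = (\<integral>\<^sup>+x. ennreal ((norm (grad \<phi> (t *\<^sub>R h + x)))\<^sup>2) \<partial>lborel) * indicator {0..1} t"
      by (rule nn_integral_multc) measurable
    also have "(\<integral>\<^sup>+x. ennreal ((norm (grad \<phi> (t *\<^sub>R h + x)))\<^sup>2) \<partial>lborel) = (\<integral>\<^sup>+x. ennreal ((norm (grad \<phi> x))\<^sup>2) \<partial>lborel)"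
      by (rule nn_integral_lborel_translate) measurable
    finally show "(\<integral>\<^sup>+x. ennreal ((norm (grad \<phi> (t *\<^sub>R h + x)))\<^sup>2) * indicator {0..1} t \<partial>lborel)
      = (\<integral>\<^sup>+x. ennreal ((norm (grad \<phi> x))\<^sup>2) \<partial>lborel) * indicator {0..1} t" .
  qed
  also have "\<dots> = (\<integral>\<^sup>+x. ennreal ((norm (grad \<phi> x))\<^sup>2) \<partial>lborel)"
    by (simp add: nn_integral_cmult_indicator)
  finally show ?thesis .
qed

lemma nn_integral_power2_add_le_ennreal:
  fixes f g :: "'a::euclidean_space \<Rightarrow> 'b::{real_normed_vector, second_countable_topology}"
  assumes "f \<in> borel_measurable borel" "g \<in> borel_measurable borel"
    and "(\<integral>\<^sup>+x. ennreal ((norm (f x))\<^sup>2) \<partial>lborel) \<le> ennreal a" "(\<integral>\<^sup>+x. ennreal ((norm (g x))\<^sup>2) \<partial>lborel) \<le> ennreal b"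
    and "0 \<le> a" "0 \<le> b"
  shows "(\<integral>\<^sup>+x. ennreal ((norm (f x + g x))\<^sup>2) \<partial>lborel) \<le> ennreal (2 * a + 2 * b)"
proof -
  have "(\<integral>\<^sup>+x. ennreal ((norm (f x + g x))\<^sup>2) \<partial>lborel) \<le> 2 * ennreal a + 2 * ennreal b"
    by (rule order_trans[OF nn_integral_power2_add_le[OF assms(1,2)]]) (intro add_mono mult_left_mono assms(3,4), auto)
  also have "\<dots> = ennreal (2 * a + 2 * b)" using assms(5,6) by (simp add: ennreal_plus ennreal_mult)
  finally show ?thesis .
qed

lemma nn_integral_power2_le_mult:
  fixes f :: "'a::euclidean_space \<Rightarrow> 'b::{real_normed_vector, second_countable_topology}"
    and g :: "'a \<Rightarrow> 'c::{real_normed_vector, second_countable_topology}"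
  assumes [measurable]: "g \<in> borel_measurable borel" and c: "0 \<le> c"
    and le: "\<And>x. norm (f x) \<le> c * norm (g x)"
  shows "(\<integral>\<^sup>+x. ennreal ((norm (f x))\<^sup>2) \<partial>lborel) \<le> ennreal (c\<^sup>2) * (\<integral>\<^sup>+x. ennreal ((norm (g x))\<^sup>2) \<partial>lborel)"
proof -
  have "(\<integral>\<^sup>+x. ennreal ((norm (f x))\<^sup>2) \<partial>lborel) \<le> (\<integral>\<^sup>+x. ennreal (c\<^sup>2) * ennreal ((norm (g x))\<^sup>2) \<partial>lborel)"
  proof (rule nn_integral_mono)
    fix x
    have "(norm (f x))\<^sup>2 \<le> (c * norm (g x))\<^sup>2" using le by (intro power_mono) auto
    then show "ennreal ((norm (f x))\<^sup>2) \<le> ennreal (c\<^sup>2) * ennreal ((norm (g x))\<^sup>2)"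
      by (simp add: ennreal_mult[symmetric] power_mult_distrib ennreal_leI)
  qed
  also have "\<dots> = ennreal (c\<^sup>2) * (\<integral>\<^sup>+x. ennreal ((norm (g x))\<^sup>2) \<partial>lborel)"
    by (rule nn_integral_cmult) measurable
  finally show ?thesis .
qed

lemma norm_exp_i_minus_1_le: "norm (exp (\<i> * complex_of_real t) - 1) \<le> \<bar>t\<bar>"
proof -
  have "norm (exp (\<i> * complex_of_real t) - 1) = 2 * \<bar>sin (t / 2)\<bar>" by (rule dist_exp_i_1)
  also have "\<dots> \<le> 2 * \<bar>t / 2\<bar>" by (intro mult_left_mono abs_sin_x_le_abs_x) auto
  finally show ?thesis by simp
qed

lemma norm_vec_mult_of_real:
  fixes a :: "real^'n"
  shows "norm (\<chi> j. \<i> * complex_of_real (a $ j) * z :: complex^'n) = norm a * norm z"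
proof -
  have "norm (\<chi> j. \<i> * complex_of_real (a $ j) * z :: complex^'n) = L2_set (\<lambda>j. norm z * (a $ j)) UNIV"
    by (simp add: norm_vec_def norm_mult L2_set_def power_mult_distrib mult.commute)
  also have "\<dots> = norm z * norm a" 
  proof -
    have "norm a = L2_set (\<lambda>j. a $ j) UNIV" by (simp add: norm_vec_def L2_set_def)
    then show ?thesis by (simp only: L2_set_right_distrib[OF norm_ge_zero])
  qed
  finally show ?thesis by (simp add: mult.commute)
qed

lemma vec_mult_of_real_measurable:
  fixes A :: "real^'n \<Rightarrow> real^'n"
  assumes [measurable]: "A \<in> borel_measurable borel" "\<phi> \<in> borel_measurable borel"
  shows "(\<lambda>x. (\<chi> j. \<i> * complex_of_real (A x $ j) * \<phi> x) :: complex^'n) \<in> borel_measurable borel"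
proof -
  have "(\<lambda>p :: (real^'n) \<times> complex. \<chi> j. \<i> * complex_of_real (fst p $ j) * snd p) \<in> borel_measurable borel"
    by (intro borel_measurable_continuous_onI continuous_intros)
  moreover have "(\<lambda>x. (A x, \<phi> x)) \<in> borel_measurable borel" by measurable
  ultimately have "(\<lambda>x. (\<lambda>p :: (real^'n) \<times> complex. \<chi> j. \<i> * complex_of_real (fst p $ j) * snd p) (A x, \<phi> x)) \<in> borel_measurable borel"
    by (rule measurable_compose[rotated])
  then show ?thesis by simp
qed

lemma mgrad_eq: "mgrad A \<phi> x = grad \<phi> x - (\<chi> j. \<i> * complex_of_real (A x $ j) * \<phi> x)"
  by (simp add: mgrad_def vec_eq_iff)

lemma mgrad_measurable:
  assumes "A \<in> borel_measurable borel" "\<phi> \<in> test_functions \<Omega>"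
  shows "mgrad A \<phi> \<in> borel_measurable borel"
  unfolding mgrad_eq[abs_def]
  by (intro borel_measurable_diff vec_mult_of_real_measurable assms(1)
      borel_measurable_continuous_onI grad_continuous[OF assms(2)] test_function_continuous[OF assms(2)])

text \<open>The difference splits into a plain increment and the deviation of the phase from 1,
  which is at most \<open>norm h * M\<close>. The squared norm of \<open>grad \<phi>\<close> is at
  most \<open>2 * b + 2 * M^2 * a\<close>; doubling it and adding twice \<open>M^2 * a\<close> for
  the phase gives the constant.\<close>

lemma nn_integral_mdiff_test_function_le:
  fixes A :: "real^'n \<Rightarrow> real^'n"
  assumes A: "A \<in> borel_measurable borel" and M: "\<And>x. norm (A x) \<le> M" and \<phi>: "\<phi> \<in> test_functions \<Omega>"
    and a: "(\<integral>\<^sup>+x. ennreal ((norm (\<phi> x))\<^sup>2) \<partial>lborel) \<le> ennreal a" "0 \<le> a"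
    and b: "(\<integral>\<^sup>+x. ennreal ((norm (mgrad A \<phi> x))\<^sup>2) \<partial>lborel) \<le> ennreal b" "0 \<le> b"
  shows "(\<integral>\<^sup>+x. ennreal ((norm (mdiff A \<phi> h x))\<^sup>2) \<partial>lborel) \<le> ennreal ((norm h)\<^sup>2 * (4 * b + 6 * M\<^sup>2 * a))"
proof -
  have M0: "0 \<le> M" using M[of 0] norm_ge_zero order_trans by blast
  have \<phi>m: "\<phi> \<in> borel_measurable borel" by (rule borel_measurable_continuous_onI[OF test_function_continuous[OF \<phi>]])
  note [measurable] = A \<phi>m mgrad_measurable[OF A \<phi>] vec_mult_of_real_measurable[OF A \<phi>m]
  let ?V = "\<lambda>x. (\<chi> j. \<i> * complex_of_real (A x $ j) * \<phi> x) :: complex^'n"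
  let ?e = "\<lambda>x. exp (\<i> * complex_of_real (- (h \<bullet> A (x + h /\<^sub>R 2))))"
  have V: "(\<integral>\<^sup>+x. ennreal ((norm (?V x))\<^sup>2) \<partial>lborel) \<le> ennreal (M\<^sup>2 * a)"
  proof -
    have "(\<integral>\<^sup>+x. ennreal ((norm (?V x))\<^sup>2) \<partial>lborel) \<le> ennreal (M\<^sup>2) * (\<integral>\<^sup>+x. ennreal ((norm (\<phi> x))\<^sup>2) \<partial>lborel)"
      using M M0 by (intro nn_integral_power2_le_mult) (auto simp: norm_vec_mult_of_real intro!: mult_right_mono \<phi>m)
    also have "\<dots> \<le> ennreal (M\<^sup>2) * ennreal a" by (intro mult_left_mono a) auto
    finally show ?thesis using a by (simp add: ennreal_mult)
  qed
  have "grad \<phi> x = mgrad A \<phi> x + ?V x" for x by (simp add: mgrad_eq)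
  then have G: "(\<integral>\<^sup>+x. ennreal ((norm (grad \<phi> x))\<^sup>2) \<partial>lborel) \<le> ennreal (2 * b + 2 * (M\<^sup>2 * a))"
    using nn_integral_power2_add_le_ennreal[of "mgrad A \<phi>" ?V b "M\<^sup>2 * a"] b a V by simp
  have T1: "(\<integral>\<^sup>+x. ennreal ((norm (\<phi> x - \<phi> (x + h)))\<^sup>2) \<partial>lborel) \<le> ennreal ((norm h)\<^sup>2 * (2 * b + 2 * (M\<^sup>2 * a)))"
  proof -
    have "(\<integral>\<^sup>+x. ennreal ((norm (\<phi> x - \<phi> (x + h)))\<^sup>2) \<partial>lborel) = (\<integral>\<^sup>+x. ennreal ((norm (\<phi> (x + h) - \<phi> x))\<^sup>2) \<partial>lborel)"
      by (simp only: norm_minus_commute)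
    also have "\<dots> \<le> ennreal ((norm h)\<^sup>2) * (\<integral>\<^sup>+x. ennreal ((norm (grad \<phi> x))\<^sup>2) \<partial>lborel)"
      by (rule nn_integral_translation_difference_le[OF \<phi>])
    also have "\<dots> \<le> ennreal ((norm h)\<^sup>2) * ennreal (2 * b + 2 * (M\<^sup>2 * a))" by (intro mult_left_mono G) auto
    finally show ?thesis using a b by (subst (asm) ennreal_mult[symmetric]) auto
  qed
  have T2: "(\<integral>\<^sup>+x. ennreal ((norm ((1 - ?e x) * \<phi> (x + h)))\<^sup>2) \<partial>lborel) \<le> ennreal ((norm h)\<^sup>2 * (M\<^sup>2 * a))"
  proof -
    have "(\<integral>\<^sup>+x. ennreal ((norm ((1 - ?e x) * \<phi> (x + h)))\<^sup>2) \<partial>lborel)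
      \<le> ennreal ((norm h * M)\<^sup>2) * (\<integral>\<^sup>+x. ennreal ((norm (\<phi> (x + h)))\<^sup>2) \<partial>lborel)"
    proof (rule nn_integral_power2_le_mult)
      fix x
      have "norm (1 - ?e x) \<le> \<bar>h \<bullet> A (x + h /\<^sub>R 2)\<bar>"
        using norm_exp_i_minus_1_le[of "- (h \<bullet> A (x + h /\<^sub>R 2))"] by (simp add: norm_minus_commute)
      also have "\<dots> \<le> norm h * norm (A (x + h /\<^sub>R 2))" by (rule Cauchy_Schwarz_ineq2)
      also have "\<dots> \<le> norm h * M" using M by (intro mult_left_mono) auto
      finally show "norm ((1 - ?e x) * \<phi> (x + h)) \<le> norm h * M * norm (\<phi> (x + h))"
        by (simp only: norm_mult mult_right_mono norm_ge_zero)
    qed (use M0 in \<open>simp_all, measurable\<close>)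
    also have "(\<integral>\<^sup>+x. ennreal ((norm (\<phi> (x + h)))\<^sup>2) \<partial>lborel) = (\<integral>\<^sup>+x. ennreal ((norm (\<phi> x))\<^sup>2) \<partial>lborel)"
      using nn_integral_lborel_translate[of "\<lambda>x. ennreal ((norm (\<phi> x))\<^sup>2)" h] by (simp add: add.commute)
    also have "ennreal ((norm h * M)\<^sup>2) * \<dots> \<le> ennreal ((norm h * M)\<^sup>2) * ennreal a" by (intro mult_left_mono a) auto
    finally show ?thesis using a by (simp add: ennreal_mult[symmetric] power_mult_distrib mult.assoc)
  qed
  have "mdiff A \<phi> h x = (\<phi> x - \<phi> (x + h)) + (1 - ?e x) * \<phi> (x + h)" for x
    by (simp add: mdiff_def left_diff_distrib)
  then have "(\<integral>\<^sup>+x. ennreal ((norm (mdiff A \<phi> h x))\<^sup>2) \<partial>lborel)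
      \<le> ennreal (2 * ((norm h)\<^sup>2 * (2 * b + 2 * (M\<^sup>2 * a))) + 2 * ((norm h)\<^sup>2 * (M\<^sup>2 * a)))"
    using nn_integral_power2_add_le_ennreal[OF _ _ T1 T2] a b by simp
  also have "2 * ((norm h)\<^sup>2 * (2 * b + 2 * (M\<^sup>2 * a))) + 2 * ((norm h)\<^sup>2 * (M\<^sup>2 * a)) = (norm h)\<^sup>2 * (4 * b + 6 * M\<^sup>2 * a)"
    by (simp add: algebra_simps)
  finally show ?thesis .
qed

section \<open>First-order expansion of the magnetic difference\<close>

lemma compact_support_uniformly_continuous:
  fixes f :: "'a::euclidean_space \<Rightarrow> 'b::real_normed_vector"
  assumes cont: "continuous_on UNIV f" and K: "compact K" "\<And>x. x \<notin> K \<Longrightarrow> f x = 0" and e: "e > 0"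
  obtains d where "d > 0" "\<And>x y. dist x y < d \<Longrightarrow> dist (f x) (f y) < e"
proof -
  obtain R where R: "\<And>x. x \<in> K \<Longrightarrow> norm x \<le> R" using compact_imp_bounded[OF K(1)] by (auto simp: bounded_iff)
  have "uniformly_continuous_on (cball 0 (R + 1)) f"
    by (intro compact_uniformly_continuous continuous_on_subset[OF cont]) auto
  then obtain d where d: "d > 0" "\<And>x y. x \<in> cball 0 (R + 1) \<Longrightarrow> y \<in> cball 0 (R + 1) \<Longrightarrow> dist y x < d \<Longrightarrow> dist (f y) (f x) < e"
    using e unfolding uniformly_continuous_on_def by metis
  show ?thesis
  proof (rule that[of "min d 1"])
    fix x y :: 'a assume xy: "dist x y < min d 1"
    show "dist (f x) (f y) < e"
    proof (cases "x \<in> cball 0 (R + 1) \<and> y \<in> cball 0 (R + 1)")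
      case True
      then show ?thesis using d(2)[of y x] xy by simp
    next
      case False
      have "norm x \<le> norm y + dist x y" "norm y \<le> norm x + dist x y"
        using norm_triangle_ineq2[of x y] norm_triangle_ineq3[of x y] by (auto simp: dist_norm)
      then have "norm x > R" "norm y > R" using False xy by auto
      then have "x \<notin> K" "y \<notin> K" using R[of x] R[of y] by (auto simp: not_le[symmetric])
      then show ?thesis using K(2) e by simp
    qed
  qed (use d in simp)
qed

lemma exp_i_first_order:
  assumes "e > 0"
  obtains d where "d > 0" "\<And>t. \<bar>t\<bar> < d \<Longrightarrow> norm (exp (\<i> * complex_of_real t) - 1 - \<i> * complex_of_real t) \<le> e * \<bar>t\<bar>"
proof -
  have "((\<lambda>t. exp (\<i> * complex_of_real t)) has_derivative (\<lambda>t. \<i> * complex_of_real t)) (at 0)"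
  proof -
    have "((\<lambda>t. \<i> * complex_of_real t) has_derivative (\<lambda>t. \<i> * complex_of_real t)) (at 0)"
      by (intro bounded_linear_imp_has_derivative bounded_linear_const_mult bounded_linear_of_real)
    from has_derivative_compose[OF this DERIV_exp[unfolded has_field_derivative_def]]
    show ?thesis by simp
  qed
  then have "\<exists>d>0. \<forall>t. norm (t - 0) < d \<longrightarrow> norm (exp (\<i> * complex_of_real t) - exp (\<i> * complex_of_real 0) - \<i> * complex_of_real (t - 0)) \<le> e * norm (t - 0)"
    using assms unfolding has_derivative_at_alt by blast
  then show ?thesis using that by auto
qed

lemma test_function_first_order:
  fixes \<phi> :: "real^'n \<Rightarrow> complex"
  assumes \<phi>: "\<phi> \<in> test_functions \<Omega>" and osc: "\<And>y. dist y x \<le> norm h \<Longrightarrow> norm (grad \<phi> y - grad \<phi> x) \<le> e"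
  shows "norm (\<phi> (x + h) - \<phi> x - hdot h (grad \<phi> x)) \<le> e * norm h"
proof -
  have fd: "frechet_derivative \<phi> (at y) v = hdot v (grad \<phi> y)" for y v
    by (simp add: frechet_derivative_grad[OF \<phi>] hdot_def)
  have hl: "hdot v (grad \<phi> y) - hdot v (grad \<phi> x) = hdot v (grad \<phi> y - grad \<phi> x)" for v y
    by (simp add: hdot_diff)
  have lin: "((\<lambda>v. hdot v (grad \<phi> x)) has_derivative (\<lambda>v. hdot v (grad \<phi> x))) (at y within S)" for y S
  proof -
    have "bounded_linear (\<lambda>v. frechet_derivative \<phi> (at x) v)"
      using test_function_has_derivative[OF \<phi>] by (rule has_derivative_bounded_linear)
    then have "bounded_linear (\<lambda>v. hdot v (grad \<phi> x))" by (simp add: fd)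
    then show ?thesis by (rule bounded_linear_imp_has_derivative)
  qed
  have "norm ((\<phi> (x + h) - hdot (x + h) (grad \<phi> x)) - (\<phi> x - hdot x (grad \<phi> x))) \<le> e * norm (x + h - x)"
  proof (rule differentiable_bound[of "cball x (norm h)"])
    fix y assume y: "y \<in> cball x (norm h)"
    have "(\<phi> has_derivative (\<lambda>v. hdot v (grad \<phi> y))) (at y within cball x (norm h))"
      using test_function_has_derivative[OF \<phi>, of y] fd[of y] has_derivative_at_withinI by (metis (no_types, lifting) ext)
    then show "((\<lambda>y. \<phi> y - hdot y (grad \<phi> x)) has_derivative (\<lambda>v. hdot v (grad \<phi> y - grad \<phi> x))) (at y within cball x (norm h))"
      using has_derivative_diff[OF _ lin, of \<phi> "\<lambda>v. hdot v (grad \<phi> y)" y "cball x (norm h)"] by (simp only: hl)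
    show "onorm (\<lambda>v. hdot v (grad \<phi> y - grad \<phi> x)) \<le> e"
    proof (rule onorm_le)
      fix v
      have "norm (hdot v (grad \<phi> y - grad \<phi> x)) \<le> norm v * norm (grad \<phi> y - grad \<phi> x)" by (rule norm_hdot_le)
      also have "\<dots> \<le> norm v * e" using y by (intro mult_left_mono osc) (auto simp: dist_commute)
      finally show "norm (hdot v (grad \<phi> y - grad \<phi> x)) \<le> e * norm v" by (simp add: mult.commute)
    qed
  qed (auto simp: dist_norm)
  moreover have "hdot (x + h) (grad \<phi> x) = hdot x (grad \<phi> x) + hdot h (grad \<phi> x)"
    by (simp add: hdot_def distrib_right sum.distrib)
  ultimately show ?thesis by (simp add: algebra_simps)
qed

text \<open>The pointwise expansion with the analysis stripped off: \<open>r\<close> stands for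
  \<open>norm h\<close>, \<open>g\<close> for the derivative along \<open>h\<close>,
  \<open>E\<close> for the phase factor \<open>exp (- \<i> t)\<close>, and \<open>t\<close> and
  \<open>a\<close> for the products of \<open>h\<close> with \<open>A\<close> at the midpoint and at
  \<open>x\<close>.\<close>

lemma mdiff_first_order_algebra:
  fixes \<phi>x \<phi>y g E :: complex and t a :: real
  assumes R1: "norm (\<phi>y - \<phi>x - g) \<le> e * r" and \<phi>: "norm (\<phi>y - \<phi>x) \<le> e"
    and R2: "norm (E - 1 + \<i> * complex_of_real t) \<le> e * \<bar>t\<bar>" and t: "\<bar>t\<bar> \<le> M * r" and R3: "\<bar>a - t\<bar> \<le> e * r"
    and S: "norm \<phi>x \<le> S" "norm \<phi>y \<le> S" and pos: "0 \<le> e" "0 \<le> r" "0 \<le> M"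
  shows "norm (\<phi>x - E * \<phi>y + (g - \<i> * complex_of_real a * \<phi>x)) \<le> e * r * (1 + M + M * S + S)"
proof -
  have S0: "0 \<le> S" using S(1) norm_ge_zero order_trans by blast
  \<comment> \<open>Four errors: the expansion of the function, the phase acting on the increment,
    the expansion of the exponential, and the displacement of \<open>A\<close> from the midpoint to
    \<open>x\<close>.\<close>
  have "\<phi>x - E * \<phi>y + (g - \<i> * complex_of_real a * \<phi>x)
      = - (\<phi>y - \<phi>x - g) + \<i> * complex_of_real t * (\<phi>y - \<phi>x) - (E - 1 + \<i> * complex_of_real t) * \<phi>y - \<i> * complex_of_real (a - t) * \<phi>x"
    by (simp add: algebra_simps)
  also have "norm \<dots> \<le> norm (\<phi>y - \<phi>x - g) + \<bar>t\<bar> * norm (\<phi>y - \<phi>x) + norm (E - 1 + \<i> * complex_of_real t) * norm \<phi>y + \<bar>a - t\<bar> * norm \<phi>x"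
  proof -
    have 1: "norm (- (\<phi>y - \<phi>x - g)) = norm (\<phi>y - \<phi>x - g)" by (rule norm_minus_cancel)
    have 2: "norm (\<i> * complex_of_real t * (\<phi>y - \<phi>x)) = \<bar>t\<bar> * norm (\<phi>y - \<phi>x)" by (simp add: norm_mult)
    have 3: "norm (\<i> * complex_of_real (a - t) * \<phi>x) = \<bar>a - t\<bar> * norm \<phi>x" by (simp only: norm_mult norm_ii norm_of_real mult_1)
    have "norm (w + x - y - z) \<le> norm w + norm x + norm y + norm z" for w x y z :: complex
      using norm_triangle_ineq4[of "w + x - y" z] norm_triangle_ineq4[of "w + x" y] norm_triangle_ineq[of w x] by linarith
    from this[of "- (\<phi>y - \<phi>x - g)" "\<i> * complex_of_real t * (\<phi>y - \<phi>x)" "(E - 1 + \<i> * complex_of_real t) * \<phi>y" "\<i> * complex_of_real (a - t) * \<phi>x"]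
    show ?thesis unfolding 1 2 3 norm_mult[of "E - 1 + \<i> * complex_of_real t"] .
  qed
  also have "\<dots> \<le> e * r + (M * r) * e + (e * (M * r)) * S + (e * r) * S"
  proof (intro add_mono mult_mono R1 \<phi> t R3 S)
    show "norm (E - 1 + \<i> * complex_of_real t) \<le> e * (M * r)"
      using R2 mult_left_mono[OF t pos(1)] by linarith
  qed (use pos S0 in auto)
  also have "\<dots> = e * r * (1 + M + M * S + S)" by (simp add: algebra_simps)
  finally show ?thesis .
qed

text \<open>Nothing is known about continuity of \<open>A\<close> at the boundary or outside
  \<Omega>, so all evaluations that matter must stay in a compact subset. If neither
  \<open>x\<close> nor \<open>x + h\<close> is in the support, the expression is zero; otherwise
  \<open>x\<close> and the midpoint are within \<open>norm h\<close> of the support. The indicator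
  of \<open>K\<close> turns the uniform bound into an integrable one.\<close>

lemma mdiff_test_function_uniform:
  fixes A :: "real^'n \<Rightarrow> real^'n"
  assumes \<Omega>: "open \<Omega>" and M: "\<And>x. norm (A x) \<le> M" and cA: "continuous_on \<Omega> A"
    and \<phi>: "\<phi> \<in> test_functions \<Omega>"
  obtains K where "compact K"
    "\<And>e. e > 0 \<Longrightarrow> \<exists>d>0. \<forall>h. norm h < d \<longrightarrow> (\<forall>x. norm (mdiff A \<phi> h x + hdot h (mgrad A \<phi> x)) \<le> e * norm h * indicator K x)"
proof -
  have M0: "0 \<le> M" using M[of 0] norm_ge_zero order_trans by blast
  obtain K where K: "compact K" "K \<subseteq> \<Omega>" "\<And>x. x \<notin> K \<Longrightarrow> \<phi> x = 0" "\<And>x. x \<notin> K \<Longrightarrow> grad \<phi> x = 0"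
    using \<phi> by (rule test_function_support) blast
  obtain \<rho> where \<rho>: "\<rho> > 0" "(\<Union>x\<in>K. cball x \<rho>) \<subseteq> \<Omega>"
    using compact_subset_open_imp_cball_epsilon_subset[OF K(1) \<Omega> K(2)] by metis
  \<comment> \<open>The closed \<rho>-neighbourhood of the support: compact as a sum of compact
    sets, and inside \<Omega>, so \<open>A\<close> is uniformly continuous on it.\<close>
  define K' where "K' = (\<Union>x\<in>K. \<Union>y\<in>cball 0 \<rho>. {x + y})"
  have K'_c: "compact K'" unfolding K'_def by (intro compact_sums' K(1) compact_cball)
  have K'I: "z \<in> K'" if "x \<in> K" "dist x z \<le> \<rho>" for x z
  proof -
    have "z - x \<in> cball 0 \<rho>" using that by (simp add: dist_norm norm_minus_commute)
    moreover have "z = x + (z - x)" by simp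
    ultimately show ?thesis unfolding K'_def using that(1) by blast
  qed
  have K'_sub: "K' \<subseteq> \<Omega>"
  proof
    fix z assume "z \<in> K'"
    then obtain x y where "x \<in> K" "y \<in> cball 0 \<rho>" "z = x + y" unfolding K'_def by blast
    then have "x \<in> K" "z \<in> cball x \<rho>" by (auto simp: dist_norm)
    then show "z \<in> \<Omega>" using \<rho>(2) by blast
  qed
  have "bounded (\<phi> ` K)"
    using compact_continuous_image[OF continuous_on_subset[OF test_function_continuous[OF \<phi>]] K(1)]
    by (intro compact_imp_bounded) auto
  then obtain S0 where S0: "\<And>x. x \<in> K \<Longrightarrow> norm (\<phi> x) \<le> S0" by (auto simp: bounded_iff)
  define S where "S = max 0 S0"
  have S: "norm (\<phi> x) \<le> S" for x using S0[of x] K(3)[of x] by (cases "x \<in> K") (auto simp: S_def le_max_iff_disj)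
  have S_nonneg: "0 \<le> S" by (simp add: S_def)
  define C where "C = 1 + M + M * S + S"
  have C: "C > 0" using M0 S_nonneg by (auto simp: C_def intro!: add_pos_nonneg)
  show ?thesis
  proof (rule that[OF K'_c])
    fix e' :: real assume e': "e' > 0"
    define e where "e = e' / C"
    have e: "e > 0" using e' C by (simp add: e_def)
    obtain d1 where d1: "d1 > 0" "\<And>x y. dist x y < d1 \<Longrightarrow> dist (\<phi> x) (\<phi> y) < e"
      using compact_support_uniformly_continuous[OF test_function_continuous[OF \<phi>] K(1,3) e] by metis
    obtain d2 where d2: "d2 > 0" "\<And>x y. dist x y < d2 \<Longrightarrow> dist (grad \<phi> x) (grad \<phi> y) < e"
      using compact_support_uniformly_continuous[OF grad_continuous[OF \<phi>] K(1,4) e] by metis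
    obtain d3 where d3: "d3 > 0" "\<And>x y. x \<in> K' \<Longrightarrow> y \<in> K' \<Longrightarrow> dist y x < d3 \<Longrightarrow> dist (A y) (A x) < e"
      using compact_uniformly_continuous[OF continuous_on_subset[OF cA K'_sub] K'_c] e
      unfolding uniformly_continuous_on_def by metis
    obtain d4 where d4: "d4 > 0" "\<And>t. \<bar>t\<bar> < d4 \<Longrightarrow> norm (exp (\<i> * complex_of_real t) - 1 - \<i> * complex_of_real t) \<le> e * \<bar>t\<bar>"
      using exp_i_first_order[OF e] by metis
    \<comment> \<open>The bound \<rho> keeps \<open>x\<close> and the midpoint in \<open>K'\<close>;
      \<open>d4 / (M + 1)\<close> keeps the phase argument below \<open>d4\<close>, with
      \<open>M + 1\<close> in place of \<open>M\<close> to permit the division when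
      \<open>M = 0\<close>.\<close>
    define d where "d = min (min d1 d2) (min (min d3 \<rho>) (d4 / (M + 1)))"
    have d: "d > 0" "d \<le> d1" "d \<le> d2" "d \<le> d3" "d \<le> \<rho>" "d \<le> d4 / (M + 1)"
      using d1 d2 d3 d4 \<rho> M0 by (auto simp: d_def)
    show "\<exists>d>0. \<forall>h. norm h < d \<longrightarrow> (\<forall>x. norm (mdiff A \<phi> h x + hdot h (mgrad A \<phi> x)) \<le> e' * norm h * indicator K' x)"
    proof (intro exI[of _ d] conjI allI impI d(1))
      fix h x :: "real^'n" assume h: "norm h < d"
      show "norm (mdiff A \<phi> h x + hdot h (mgrad A \<phi> x)) \<le> e' * norm h * indicator K' x"
      proof (cases "x \<in> K \<or> x + h \<in> K")
        case False
        then have "mdiff A \<phi> h x + hdot h (mgrad A \<phi> x) = 0"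
          using K(3)[of x] K(3)[of "x + h"] K(4)[of x] by (simp add: mdiff_def hdot_def mgrad_def)
        then show ?thesis using e' by (simp add: indicator_def)
      next
        case True
        have xK: "x \<in> K'" "x + h /\<^sub>R 2 \<in> K'"
        proof -
          have n: "dist x (x + h /\<^sub>R 2) \<le> \<rho>" "dist (x + h) (x + h /\<^sub>R 2) \<le> \<rho>" "dist (x + h) x \<le> \<rho>" "dist x x \<le> \<rho>"
          proof -
            have "x + h - (x + h /\<^sub>R 2) = h /\<^sub>R 2" using scaleR_half_double[of h] by (simp add: algebra_simps)
            then have "dist (x + h) (x + h /\<^sub>R 2) = norm (h /\<^sub>R 2)" by (simp only: dist_norm)
            then have "dist (x + h) (x + h /\<^sub>R 2) = norm h / 2" by simp
            moreover have "dist x (x + h /\<^sub>R 2) = norm h / 2" by (simp add: dist_norm)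
            ultimately show "dist x (x + h /\<^sub>R 2) \<le> \<rho>" "dist (x + h) (x + h /\<^sub>R 2) \<le> \<rho>" using h d by auto
            show "dist (x + h) x \<le> \<rho>" "dist x x \<le> \<rho>" using h d \<rho> by (auto simp: dist_norm)
          qed
          show "x \<in> K'" "x + h /\<^sub>R 2 \<in> K'" using True K'I n by blast+
        qed
        let ?t = "h \<bullet> A (x + h /\<^sub>R 2)" and ?a = "h \<bullet> A x"
        have t: "\<bar>?t\<bar> \<le> M * norm h"
          using Cauchy_Schwarz_ineq2[of h "A (x + h /\<^sub>R 2)"] mult_left_mono[OF M[of "x + h /\<^sub>R 2"] norm_ge_zero[of h]]
          by (simp add: mult.commute)
        have "norm (\<phi> x - exp (\<i> * complex_of_real (- ?t)) * \<phi> (x + h) + (hdot h (grad \<phi> x) - \<i> * complex_of_real ?a * \<phi> x))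
            \<le> e * norm h * (1 + M + M * S + S)"
        proof (rule mdiff_first_order_algebra[OF _ _ _ t])
          show "norm (\<phi> (x + h) - \<phi> x - hdot h (grad \<phi> x)) \<le> e * norm h"
          proof (rule test_function_first_order[OF \<phi>])
            fix y assume "dist y x \<le> norm h"
            then show "norm (grad \<phi> y - grad \<phi> x) \<le> e" using d2(2)[of y x] h d by (simp add: dist_norm)
          qed
          show "norm (\<phi> (x + h) - \<phi> x) \<le> e" using d1(2)[of "x + h" x] h d by (simp add: dist_norm)
          have "\<bar>- ?t\<bar> < d4"
          proof -
            have "M * norm h \<le> (M + 1) * norm h" by (simp add: distrib_right)
            also have "(M + 1) * norm h < (M + 1) * (d4 / (M + 1))" using h d M0 by (intro mult_strict_left_mono) auto
            finally show ?thesis using t M0 by simp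
          qed
          from d4(2)[OF this]
          show "norm (exp (\<i> * complex_of_real (- ?t)) - 1 + \<i> * complex_of_real ?t) \<le> e * \<bar>?t\<bar>" by simp
          have "dist x (x + h /\<^sub>R 2) < d3" using h d by (simp add: dist_norm)
          then have "norm (A x - A (x + h /\<^sub>R 2)) \<le> e" using d3(2)[OF xK(2,1)] by (simp add: dist_norm)
          then show "\<bar>?a - ?t\<bar> \<le> e * norm h"
            using Cauchy_Schwarz_ineq2[of h "A x - A (x + h /\<^sub>R 2)"] mult_left_mono[of _ e "norm h"]
            by (simp add: inner_diff_right mult.commute[of e]) (meson norm_ge_zero order_trans)
        qed (use S e M0 in auto)
        moreover have "hdot h (mgrad A \<phi> x) = hdot h (grad \<phi> x) - \<i> * complex_of_real ?a * \<phi> x"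
          by (simp add: hdot_def mgrad_def inner_vec_def right_diff_distrib sum_subtractf sum_distrib_left sum_distrib_right mult_ac)
        ultimately show ?thesis using xK C by (simp add: mdiff_def e_def C_def[symmetric] mult.commute mult.left_commute)
      qed
    qed
  qed
qed

text \<open>Two approximants divide the work: a fixed \<phi> carries the uniform expansion and
  determines \<delta>, while a test function \<psi> depending on \<open>h\<close> bridges from
  \<open>u\<close> to \<phi>. Since \<open>\<psi> - \<phi>\<close> is a test function, the bound of
  order \<open>norm h\<close> applies to it directly, with a constant independent of the choice of
  \<psi>.\<close>

lemma mdiff_first_order_L2:
  fixes \<Omega> :: "(real^'n) set" and A :: "real^'n \<Rightarrow> real^'n" and u :: "real^'n \<Rightarrow> complex" and D :: "real^'n \<Rightarrow> complex^'n"
  assumes \<Omega>: "open \<Omega>" and A: "A \<in> borel_measurable borel" and M: "\<And>x. norm (A x) \<le> M" and cA: "continuous_on \<Omega> A"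
    and u: "u \<in> borel_measurable borel" and D: "D \<in> borel_measurable borel"
    and approx: "\<And>e. e > 0 \<Longrightarrow> \<exists>\<phi>\<in>test_functions \<Omega>. (\<integral>\<^sup>+x. ennreal ((norm (u x - \<phi> x))\<^sup>2) \<partial>lborel) \<le> ennreal e \<and>
        (\<integral>\<^sup>+x. ennreal ((norm (D x - mgrad A \<phi> x))\<^sup>2) \<partial>lborel) \<le> ennreal e"
    and \<epsilon>: "\<epsilon> > 0"
  obtains \<delta> where "\<delta> > 0"
    "\<And>h. 0 < norm h \<Longrightarrow> norm h < \<delta> \<Longrightarrow> (\<integral>\<^sup>+x. ennreal ((norm (mdiff A u h x + hdot h (D x)))\<^sup>2) \<partial>lborel) \<le> ennreal (\<epsilon> * (norm h)\<^sup>2)"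
proof -
  \<comment> \<open>The total coefficient of \<open>e * (norm h)^2\<close> in the sum of four
    squared errors at the end, including the doublings from splitting squares of sums.\<close>
  define C where "C = 88 + 96 * M\<^sup>2"
  have C: "C > 0" by (auto simp: C_def intro!: add_pos_nonneg)
  define e where "e = \<epsilon> / C"
  have e: "e > 0" using \<epsilon> C by (simp add: e_def)
  obtain \<phi> where \<phi>: "\<phi> \<in> test_functions \<Omega>" "(\<integral>\<^sup>+x. ennreal ((norm (u x - \<phi> x))\<^sup>2) \<partial>lborel) \<le> ennreal e"
      "(\<integral>\<^sup>+x. ennreal ((norm (D x - mgrad A \<phi> x))\<^sup>2) \<partial>lborel) \<le> ennreal e"
    using approx[OF e] by blast
  have tm: "\<psi> \<in> borel_measurable borel" if "\<psi> \<in> test_functions \<Omega>" for \<psi>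
    by (rule borel_measurable_continuous_onI[OF test_function_continuous[OF that]])
  note mg = mgrad_measurable[OF A]
  obtain K where K: "compact K"
    "\<And>e. e > 0 \<Longrightarrow> \<exists>d>0. \<forall>h. norm h < d \<longrightarrow> (\<forall>x. norm (mdiff A \<phi> h x + hdot h (mgrad A \<phi> x)) \<le> e * norm h * indicator K x)"
    using mdiff_test_function_uniform[OF \<Omega> M cA \<phi>(1)] by blast
  define v where "v = measure lborel K"
  have Kf: "emeasure lborel K < \<infinity>" using emeasure_bounded_finite[OF compact_imp_bounded[OF K(1)]] by simp
  then have v: "emeasure lborel K = ennreal v" "0 \<le> v" by (auto simp: v_def emeasure_eq_ennreal_measure)
  \<comment> \<open>Squared and integrated over \<open>K\<close>, the pointwise error
    \<open>e1 * norm h\<close> costs at most \<open>e * (norm h)^2\<close>; \<open>v + 1\<close>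
    also covers a null set \<open>K\<close>.\<close>
  define e1 where "e1 = sqrt (e / (v + 1))"
  have e1: "e1 > 0" using e v by (auto simp: e1_def)
  obtain d where d: "d > 0" "\<And>h x. norm h < d \<Longrightarrow> norm (mdiff A \<phi> h x + hdot h (mgrad A \<phi> x)) \<le> e1 * norm h * indicator K x"
    using K(2)[OF e1] by blast
  have f3: "(\<integral>\<^sup>+x. ennreal ((norm (mdiff A \<phi> h x + hdot h (mgrad A \<phi> x)))\<^sup>2) \<partial>lborel) \<le> ennreal (e * (norm h)\<^sup>2)"
    if h: "norm h < d" for h
  proof -
    have "(\<integral>\<^sup>+x. ennreal ((norm (mdiff A \<phi> h x + hdot h (mgrad A \<phi> x)))\<^sup>2) \<partial>lborel)
       \<le> (\<integral>\<^sup>+x. ennreal ((e1 * norm h)\<^sup>2) * indicator K x \<partial>lborel)"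
    proof (rule nn_integral_mono)
      fix x
      have "(norm (mdiff A \<phi> h x + hdot h (mgrad A \<phi> x)))\<^sup>2 \<le> (e1 * norm h * indicator K x)\<^sup>2"
        using d(2)[OF h] by (intro power_mono) auto
      then show "ennreal ((norm (mdiff A \<phi> h x + hdot h (mgrad A \<phi> x)))\<^sup>2) \<le> ennreal ((e1 * norm h)\<^sup>2) * indicator K x"
        by (cases "x \<in> K") (simp_all add: ennreal_leI)
    qed
    also have "\<dots> = ennreal ((e1 * norm h)\<^sup>2) * emeasure lborel K"
      using K(1) by (intro nn_integral_cmult_indicator) (simp add: borel_compact)
    also have "\<dots> = ennreal (e / (v + 1) * (norm h)\<^sup>2 * v)"
      using e v by (simp add: v(1) ennreal_mult[symmetric] power_mult_distrib e1_def)
    also have "\<dots> \<le> ennreal (e * (norm h)\<^sup>2)"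
    proof (rule ennreal_leI)
      have "v / (v + 1) \<le> 1" using v by simp
      then have "e * (norm h)\<^sup>2 * (v / (v + 1)) \<le> e * (norm h)\<^sup>2 * 1" using e by (intro mult_left_mono) auto
      then show "e / (v + 1) * (norm h)\<^sup>2 * v \<le> e * (norm h)\<^sup>2" by (simp add: mult_ac)
    qed
    finally show ?thesis .
  qed
  show ?thesis
  proof (rule that[of "min d 1"])
    show "min d 1 > 0" using d by simp
    fix h :: "real^'n" assume h0: "0 < norm h" and h1: "norm h < min d 1"
    let ?r = "(norm h)\<^sup>2"
    have r: "0 < ?r" "?r \<le> 1" using h0 h1 by (auto simp: power_le_one)
    have er: "e * ?r > 0" "e * ?r \<le> e" using e r by auto
    \<comment> \<open>The squared error of \<psi> is at most \<open>e * (norm h)^2\<close>, so even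
      the bound on \<open>mdiff\<close> without decay in \<open>h\<close> has the required order for
      \<open>u - \<psi>\<close>.\<close>
    obtain \<psi> where \<psi>: "\<psi> \<in> test_functions \<Omega>" "(\<integral>\<^sup>+x. ennreal ((norm (u x - \<psi> x))\<^sup>2) \<partial>lborel) \<le> ennreal (e * ?r)"
        "(\<integral>\<^sup>+x. ennreal ((norm (D x - mgrad A \<psi> x))\<^sup>2) \<partial>lborel) \<le> ennreal (e * ?r)"
      using approx[OF er(1)] by blast
    let ?\<chi> = "\<lambda>x. \<psi> x - \<phi> x"
    have \<chi>: "?\<chi> \<in> test_functions \<Omega>" by (rule test_function_diff[OF \<psi>(1) \<phi>(1)])
    note [measurable] = u D A tm[OF \<phi>(1)] tm[OF \<psi>(1)] mg[OF \<phi>(1)] mg[OF \<psi>(1)]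
    have \<chi>a: "(\<integral>\<^sup>+x. ennreal ((norm (?\<chi> x))\<^sup>2) \<partial>lborel) \<le> ennreal (4 * e)"
    proof -
      have "(\<integral>\<^sup>+x. ennreal ((norm ((u x - \<phi> x) + (\<psi> x - u x)))\<^sup>2) \<partial>lborel) \<le> ennreal (2 * e + 2 * (e * ?r))"
        by (rule nn_integral_power2_add_le_ennreal) (use \<phi> \<psi> e er in \<open>auto simp: norm_minus_commute\<close>)
      also have "\<dots> \<le> ennreal (4 * e)" using er by (intro ennreal_leI) simp
      finally show ?thesis by simp
    qed
    have \<chi>b: "(\<integral>\<^sup>+x. ennreal ((norm (mgrad A ?\<chi> x))\<^sup>2) \<partial>lborel) \<le> ennreal (4 * e)"
    proof -
      have "(\<integral>\<^sup>+x. ennreal ((norm ((D x - mgrad A \<phi> x) + (mgrad A \<psi> x - D x)))\<^sup>2) \<partial>lborel) \<le> ennreal (2 * e + 2 * (e * ?r))"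
        by (rule nn_integral_power2_add_le_ennreal) (use \<phi> \<psi> e er in \<open>auto simp: norm_minus_commute\<close>)
      also have "\<dots> \<le> ennreal (4 * e)" using er by (intro ennreal_leI) simp
      finally show ?thesis by (simp add: mgrad_diff[OF \<psi>(1) \<phi>(1)])
    qed
    \<comment> \<open>Telescoping: \<open>u\<close> to \<psi>, \<psi> to \<phi>, the expansion of
      \<phi>, and finally the gradient of \<phi> to \<open>D\<close>.\<close>
    let ?f1 = "mdiff A (\<lambda>x. u x - \<psi> x) h" and ?f2 = "mdiff A ?\<chi> h"
      and ?f3 = "\<lambda>x. mdiff A \<phi> h x + hdot h (mgrad A \<phi> x)" and ?f4 = "\<lambda>x. hdot h (D x - mgrad A \<phi> x)"
    have m: "?f1 \<in> borel_measurable borel" "?f2 \<in> borel_measurable borel" "?f3 \<in> borel_measurable borel" "?f4 \<in> borel_measurable borel"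
      by (intro mdiff_measurable borel_measurable_add hdot_measurable; measurable)+
    have f1: "(\<integral>\<^sup>+x. ennreal ((norm (?f1 x))\<^sup>2) \<partial>lborel) \<le> ennreal (4 * e * ?r)"
    proof -
      have "(\<integral>\<^sup>+x. ennreal ((norm (?f1 x))\<^sup>2) \<partial>lborel) \<le> 4 * (\<integral>\<^sup>+x. ennreal ((norm (u x - \<psi> x))\<^sup>2) \<partial>lborel)"
        by (rule nn_integral_mdiff_le_L2) measurable
      also have "\<dots> \<le> 4 * ennreal (e * ?r)" by (intro mult_left_mono \<psi>) auto
      also have "\<dots> = ennreal (4 * e * ?r)" using er by (simp add: ennreal_mult mult.assoc)
      finally show ?thesis .
    qed
    have f2: "(\<integral>\<^sup>+x. ennreal ((norm (?f2 x))\<^sup>2) \<partial>lborel) \<le> ennreal (?r * (4 * (4 * e) + 6 * M\<^sup>2 * (4 * e)))"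
      using e by (intro nn_integral_mdiff_test_function_le[OF A M \<chi> \<chi>a _ \<chi>b]) auto
    have f4: "(\<integral>\<^sup>+x. ennreal ((norm (?f4 x))\<^sup>2) \<partial>lborel) \<le> ennreal (?r * e)"
    proof -
      have "(\<integral>\<^sup>+x. ennreal ((norm (?f4 x))\<^sup>2) \<partial>lborel) \<le> ennreal ?r * (\<integral>\<^sup>+x. ennreal ((norm (D x - mgrad A \<phi> x))\<^sup>2) \<partial>lborel)"
        by (rule nn_integral_power2_le_mult) (simp_all add: norm_hdot_le)
      also have "\<dots> \<le> ennreal ?r * ennreal e" by (intro mult_left_mono \<phi>) auto
      finally show ?thesis using e by (simp add: ennreal_mult)
    qed
    have "(\<integral>\<^sup>+x. ennreal ((norm ((?f1 x + ?f2 x) + (?f3 x + ?f4 x)))\<^sup>2) \<partial>lborel)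
      \<le> ennreal (2 * (2 * (4 * e * ?r) + 2 * (?r * (4 * (4 * e) + 6 * M\<^sup>2 * (4 * e)))) + 2 * (2 * (e * ?r) + 2 * (?r * e)))"
      using e h1 by (intro nn_integral_power2_add_le_ennreal m borel_measurable_add f1 f2 f3 f4) auto
    also have "2 * (2 * (4 * e * ?r) + 2 * (?r * (4 * (4 * e) + 6 * M\<^sup>2 * (4 * e)))) + 2 * (2 * (e * ?r) + 2 * (?r * e)) = C * e * ?r"
      by (simp add: C_def algebra_simps)
    also have "C * e = \<epsilon>" using C by (simp add: e_def)
    also have "(\<lambda>x. (?f1 x + ?f2 x) + (?f3 x + ?f4 x)) = (\<lambda>x. mdiff A u h x + hdot h (D x))"
      by (simp add: mdiff_diff hdot_diff fun_eq_iff)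
    then have "(\<integral>\<^sup>+x. ennreal ((norm ((?f1 x + ?f2 x) + (?f3 x + ?f4 x)))\<^sup>2) \<partial>lborel) = (\<integral>\<^sup>+x. ennreal ((norm (mdiff A u h x + hdot h (D x)))\<^sup>2) \<partial>lborel)"
      by (simp only: fun_eq_iff)
    finally show "(\<integral>\<^sup>+x. ennreal ((norm (mdiff A u h x + hdot h (D x)))\<^sup>2) \<partial>lborel) \<le> ennreal (\<epsilon> * ?r)" .
  qed
qed

section \<open>Radial weights and the limit\<close>

text \<open>Polar coordinates for radial functions without any surface measure: the distribution of
  the norm is determined by the volumes of balls, whose derivative in the radius is the
  density.\<close>

lemma distr_lborel_norm:
  "distr (lborel :: 'a::euclidean_space measure) borel norm
    = density lborel (\<lambda>r. ennreal (indicator {0..} r * (real DIM('a) * unit_ball_vol (real DIM('a)) * r ^ (DIM('a) - 1))))"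
  (is "?L = ?R")
proof (rule measure_eqI_generator_eq[where E="range atMost" and \<Omega>=UNIV and A="\<lambda>n. {..real n}"])
  let ?w = "unit_ball_vol (real DIM('a))" and ?f = "\<lambda>r. real DIM('a) * unit_ball_vol (real DIM('a)) * r ^ (DIM('a) - 1)"
  have L: "emeasure ?L {..a} = emeasure lborel {x::'a. norm x \<le> a}" for a
    by (subst emeasure_distr) (auto simp: vimage_def)
  have eqL: "emeasure ?L {..a} = (if a < 0 then 0 else ennreal (?w * a ^ DIM('a)))" for a
  proof (cases "a < 0")
    case True
    then have "{x::'a. norm x \<le> a} = {}" by (auto dest: order_trans[OF norm_ge_zero])
    then show ?thesis using True by (simp add: L)
  next
    case False
    then show ?thesis using emeasure_cball[of a "0::'a"] by (simp add: L cball_def)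
  qed
  have eqR: "emeasure ?R {..a} = (if a < 0 then 0 else ennreal (?w * a ^ DIM('a)))" for a
  proof -
    have "emeasure ?R {..a} = (\<integral>\<^sup>+r. ennreal (?f r) * indicator {0..a} r \<partial>lborel)"
      by (subst emeasure_density) (auto intro!: nn_integral_cong simp: indicator_def)
    also have "\<dots> = (if a < 0 then 0 else ennreal (?w * a ^ DIM('a)))"
    proof (cases "a < 0")
      case False
      have "(\<integral>\<^sup>+r. ennreal (?f r) * indicator {0..a} r \<partial>lborel) = ennreal (?w * a ^ DIM('a) - ?w * 0 ^ DIM('a))"
        using False by (intro nn_integral_FTC_Icc) (auto intro!: derivative_eq_intros)
      then show ?thesis using False by simp
    qed simp
    finally show ?thesis .
  qed
  show "emeasure ?L X = emeasure ?R X" if "X \<in> range atMost" for X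
    using that eqL eqR by auto
  show "emeasure ?L {..real i} \<noteq> \<infinity>" for i by (simp add: eqL)
  show "Int_stable (range (atMost :: real \<Rightarrow> _))" by (auto simp: Int_stable_def)
  show "sets ?L = sigma_sets UNIV (range atMost)" "sets ?R = sigma_sets UNIV (range atMost)"
    by (simp_all add: borel_eq_atMost)
  show "(\<Union>i. {..real i}) = UNIV" by (auto intro: real_arch_simple)
qed auto

lemma nn_integral_radial:
  assumes [measurable]: "g \<in> borel_measurable borel"
  shows "(\<integral>\<^sup>+x. g (norm (x::'a::euclidean_space)) \<partial>lborel)
    = (\<integral>\<^sup>+r. ennreal (indicator {0..} r * (real DIM('a) * unit_ball_vol (real DIM('a)) * r ^ (DIM('a) - 1))) * g r \<partial>lborel)"
proof -
  have "(\<integral>\<^sup>+x. g (norm (x::'a)) \<partial>lborel) = (\<integral>\<^sup>+r. g r \<partial>distr (lborel :: 'a measure) borel norm)"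
    by (subst nn_integral_distr) auto
  also have "\<dots> = (\<integral>\<^sup>+r. ennreal (indicator {0..} r * (real DIM('a) * unit_ball_vol (real DIM('a)) * r ^ (DIM('a) - 1))) * g r \<partial>lborel)"
    unfolding distr_lborel_norm by (subst nn_integral_density) auto
  finally show ?thesis .
qed

lemma power_Suc_diff_powr:
  assumes "0 < r" "0 < n"
  shows "r ^ (n - 1) * r powr - (real n + p) = r powr (- 1 - p)"
proof -
  have "r ^ (n - 1) = r powr (real n - 1)" using assms by (simp add: powr_realpow[symmetric] of_nat_diff)
  then show ?thesis by (simp add: powr_add[symmetric])
qed

text \<open>In the radius the integrand is \<open>c * r powr (1 - 2 * s)\<close>, integrable at 0
  exactly because \<open>s < 1\<close>. The value grows like \<open>1 / (1 - s)\<close>, so the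
  prefactor \<open>1 - s\<close> leaves the limit \<open>c / 2\<close>, whatever \<delta>
  is.\<close>

lemma nn_integral_power_inside_ball:
  fixes s \<delta> :: real
  assumes s: "s < 1" and \<delta>: "\<delta> > 0"
  defines "c \<equiv> real DIM('a::euclidean_space) * unit_ball_vol (real DIM('a))"
  shows "(\<integral>\<^sup>+x. ennreal ((norm x)\<^sup>2) * (ennreal (norm x powr - (real DIM('a) + 2 * s)) * indicator {..<\<delta>} (norm x)) \<partial>(lborel :: 'a measure))
    = ennreal (c * (\<delta> powr (2 - 2 * s) / (2 - 2 * s)))"
proof -
  have c: "c \<ge> 0" by (simp add: c_def)
  have "(\<integral>\<^sup>+x. ennreal ((norm x)\<^sup>2) * (ennreal (norm x powr - (real DIM('a) + 2 * s)) * indicator {..<\<delta>} (norm x)) \<partial>(lborel :: 'a measure))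
     = (\<integral>\<^sup>+r. ennreal (indicator {0..} r * (c * r ^ (DIM('a) - 1))) * (ennreal (r\<^sup>2) * (ennreal (r powr - (real DIM('a) + 2 * s)) * indicator {..<\<delta>} r)) \<partial>lborel)"
    unfolding c_def by (rule nn_integral_radial) measurable
  also have "\<dots> = (\<integral>\<^sup>+r. ennreal (c * (r powr (1 - 2 * s))) * indicator {0..\<delta>} r \<partial>lborel)"
  proof (rule nn_integral_cong_AE)
    have "AE r in lborel. r \<notin> {0, \<delta>}" by (intro AE_not_in finite_imp_null_set_lborel) simp
    then show "AE r in lborel. ennreal (indicator {0..} r * (c * r ^ (DIM('a) - 1))) * (ennreal (r\<^sup>2) * (ennreal (r powr - (real DIM('a) + 2 * s)) * indicator {..<\<delta>} r))
      = ennreal (c * (r powr (1 - 2 * s))) * indicator {0..\<delta>} r"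
    proof eventually_elim
      case (elim r)
      show ?case
      proof (cases "0 < r \<and> r < \<delta>")
        case True
        have "r ^ (DIM('a) - 1) * r powr - (real DIM('a) + 2 * s) * r\<^sup>2 = r powr (- 1 - 2 * s) * r powr 2"
          using power_Suc_diff_powr[of r "DIM('a)" "2 * s"] True by (simp add: powr_numeral)
        also have "\<dots> = r powr (1 - 2 * s)" by (simp add: powr_add[symmetric])
        finally have "c * (r ^ (DIM('a) - 1) * r powr - (real DIM('a) + 2 * s) * r\<^sup>2) = c * (r powr (1 - 2 * s))" by simp
        then show ?thesis using True c by (simp add: ennreal_mult'[symmetric] mult_ac)
      next
        case False
        then show ?thesis using elim by (auto simp: indicator_def)
      qed
    qed
  qed
  also have "\<dots> = (\<integral>\<^sup>+r. ennreal (c * (r powr (1 - 2 * s)) * indicator {0..\<delta>} r) \<partial>lborel)"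
    using c by (intro nn_integral_cong) (auto simp: indicator_def)
  also have "\<dots> = ennreal (c * (\<delta> powr (2 - 2 * s) / (2 - 2 * s)))"
  proof -
    have "((\<lambda>r. r powr (1 - 2 * s)) has_integral (\<delta> powr (1 - 2 * s + 1) / (1 - 2 * s + 1))) {0..\<delta>}"
      using s \<delta> by (intro has_integral_powr_from_0) auto
    then have "((\<lambda>r. c * (r powr (1 - 2 * s))) has_integral c * (\<delta> powr (2 - 2 * s) / (2 - 2 * s))) {0..\<delta>}"
      by (intro has_integral_mult_right) (simp add: algebra_simps)
    from nn_integral_has_integral_lebesgue[OF _ this] c show ?thesis
      by (simp add: nn_integral_completion ennreal_mult' ennreal_indicator mult_ac)
  qed
  finally show ?thesis .
qed

text \<open>This value stays bounded as \<open>s\<close> tends to 1, so the prefactor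
  \<open>1 - s\<close> removes the contribution of all steps of length at least \<delta>.\<close>

lemma nn_integral_power_outside_ball:
  fixes s \<delta> :: real
  assumes s: "0 < s" and \<delta>: "\<delta> > 0"
  defines "c \<equiv> real DIM('a::euclidean_space) * unit_ball_vol (real DIM('a))"
  shows "(\<integral>\<^sup>+x. ennreal (norm x powr - (real DIM('a) + 2 * s)) * indicator {\<delta>..} (norm x) \<partial>(lborel :: 'a measure))
    = ennreal (c * (\<delta> powr (- 2 * s) / (2 * s)))"
proof -
  have c: "c \<ge> 0" by (simp add: c_def)
  have "(\<integral>\<^sup>+x. ennreal (norm x powr - (real DIM('a) + 2 * s)) * indicator {\<delta>..} (norm x) \<partial>(lborel :: 'a measure))
     = (\<integral>\<^sup>+r. ennreal (indicator {0..} r * (c * r ^ (DIM('a) - 1))) * (ennreal (r powr - (real DIM('a) + 2 * s)) * indicator {\<delta>..} r) \<partial>lborel)"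
    unfolding c_def by (rule nn_integral_radial) measurable
  also have "\<dots> = (\<integral>\<^sup>+r. ennreal (c * (r powr (- 1 - 2 * s)) * indicator {\<delta>..} r) \<partial>lborel)"
  proof (rule nn_integral_cong)
    fix r :: real
    show "ennreal (indicator {0..} r * (c * r ^ (DIM('a) - 1))) * (ennreal (r powr - (real DIM('a) + 2 * s)) * indicator {\<delta>..} r)
      = ennreal (c * (r powr (- 1 - 2 * s)) * indicator {\<delta>..} r)"
    proof (cases "\<delta> \<le> r")
      case True
      have "c * (r ^ (DIM('a) - 1) * r powr - (real DIM('a) + 2 * s)) = c * (r powr (- 1 - 2 * s))"
        using power_Suc_diff_powr[of r "DIM('a)" "2 * s"] True \<delta> by simp
      then show ?thesis using True c \<delta> by (simp add: ennreal_mult'[symmetric] mult_ac)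
    qed simp
  qed
  also have "\<dots> = ennreal (c * (\<delta> powr (- 2 * s) / (2 * s)))"
  proof -
    have "((\<lambda>r. r powr (- 1 - 2 * s)) has_integral - (\<delta> powr ((- 1 - 2 * s) + 1)) / ((- 1 - 2 * s) + 1)) {\<delta>..}"
      using s \<delta> by (intro has_integral_powr_to_inf) auto
    then have "((\<lambda>r. c * (r powr (- 1 - 2 * s))) has_integral c * (\<delta> powr (- 2 * s) / (2 * s))) {\<delta>..}"
      by (intro has_integral_mult_right) simp
    from nn_integral_has_integral_lebesgue[OF _ this] c show ?thesis
      by (simp add: nn_integral_completion ennreal_mult' ennreal_indicator mult_ac)
  qed
  finally show ?thesis .
qed

lemma nn_integral_inner_square_radial:
  fixes a :: "'a::euclidean_space" and g :: "real \<Rightarrow> ennreal"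
  assumes g[measurable]: "g \<in> borel_measurable borel"
  shows "of_nat DIM('a) * (\<integral>\<^sup>+h. ennreal ((h \<bullet> a)\<^sup>2) * g (norm h) \<partial>lborel)
    = ennreal ((norm a)\<^sup>2) * (\<integral>\<^sup>+h. ennreal ((norm h)\<^sup>2) * g (norm h) \<partial>(lborel :: 'a measure))"
proof (cases "a = 0")
  case False
  define e where "e = a /\<^sub>R norm a"
  have e: "norm e = 1" using False by (simp add: e_def)
  have a: "a = norm a *\<^sub>R e" using False by (simp add: e_def)
  have "(\<integral>\<^sup>+h. ennreal ((h \<bullet> a)\<^sup>2) * g (norm h) \<partial>lborel) = (\<integral>\<^sup>+h. ennreal ((norm a)\<^sup>2) * (ennreal ((h \<bullet> e)\<^sup>2) * g (norm h)) \<partial>lborel)"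
  proof (rule nn_integral_cong)
    fix h
    have "(h \<bullet> a)\<^sup>2 = (norm a)\<^sup>2 * (h \<bullet> e)\<^sup>2" by (subst a) (simp add: power_mult_distrib)
    then show "ennreal ((h \<bullet> a)\<^sup>2) * g (norm h) = ennreal ((norm a)\<^sup>2) * (ennreal ((h \<bullet> e)\<^sup>2) * g (norm h))"
      by (simp add: ennreal_mult mult.assoc)
  qed
  also have "\<dots> = ennreal ((norm a)\<^sup>2) * (\<integral>\<^sup>+h. ennreal ((h \<bullet> e)\<^sup>2) * g (norm h) \<partial>lborel)"
    by (rule nn_integral_cmult) measurable
  finally have I: "(\<integral>\<^sup>+h. ennreal ((h \<bullet> a)\<^sup>2) * g (norm h) \<partial>lborel)
    = ennreal ((norm a)\<^sup>2) * (\<integral>\<^sup>+h. ennreal ((h \<bullet> e)\<^sup>2) * g (norm h) \<partial>lborel)" .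
  have R: "of_nat DIM('a) * (\<integral>\<^sup>+h. ennreal ((h \<bullet> e)\<^sup>2) * g (norm h) \<partial>lborel)
    = (\<integral>\<^sup>+h. ennreal ((norm h)\<^sup>2) * g (norm h) \<partial>(lborel :: 'a measure))"
    by (rule nn_integral_inner_square_rotation_invariant[OF sets_lborel distr_lborel_orthogonal g e])
  show ?thesis unfolding I R[symmetric] by (rule mult.left_commute)
qed simp

text \<open>For real \<open>h\<close>, the squared modulus of \<open>hdot h D\<close> is the sum of
  the squares obtained from the real and imaginary parts of \<open>D\<close>, which reduces the
  claim to real vectors.\<close>

lemma nn_integral_hdot_square_radial:
  fixes D :: "complex^'n" and g :: "real \<Rightarrow> ennreal"
  assumes g[measurable]: "g \<in> borel_measurable borel"
  shows "of_nat CARD('n) * (\<integral>\<^sup>+h. ennreal ((norm (hdot h D))\<^sup>2) * g (norm h) \<partial>lborel)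
    = ennreal ((norm D)\<^sup>2) * (\<integral>\<^sup>+h. ennreal ((norm h)\<^sup>2) * g (norm h) \<partial>(lborel :: (real^'n) measure))"
proof -
  define a b :: "real^'n" where "a = (\<chi> j. Re (D $ j))" and "b = (\<chi> j. Im (D $ j))"
  have hd: "(norm (hdot h D))\<^sup>2 = (h \<bullet> a)\<^sup>2 + (h \<bullet> b)\<^sup>2" for h
    by (simp add: cmod_power2 hdot_def inner_vec_def a_def b_def)
  have nD: "(norm D)\<^sup>2 = (norm a)\<^sup>2 + (norm b)\<^sup>2"
    unfolding norm_vec_def L2_set_def
    by (simp add: sum_nonneg cmod_power2 sum.distrib a_def b_def)
  have "(\<integral>\<^sup>+h. ennreal ((norm (hdot h D))\<^sup>2) * g (norm h) \<partial>lborel)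
     = (\<integral>\<^sup>+h. ennreal ((h \<bullet> a)\<^sup>2) * g (norm h) + ennreal ((h \<bullet> b)\<^sup>2) * g (norm h) \<partial>lborel)"
    by (intro nn_integral_cong) (simp add: hd ennreal_plus distrib_right)
  also have "\<dots> = (\<integral>\<^sup>+h. ennreal ((h \<bullet> a)\<^sup>2) * g (norm h) \<partial>lborel) + (\<integral>\<^sup>+h. ennreal ((h \<bullet> b)\<^sup>2) * g (norm h) \<partial>lborel)"
    by (rule nn_integral_add) measurable
  finally show ?thesis
    using nn_integral_inner_square_radial[OF g, of a] nn_integral_inner_square_radial[OF g, of b]
    by (simp add: distrib_left nD ennreal_plus distrib_right)
qed

text \<open>Young's inequality with a weight that leaves the leading coefficient arbitrarily close
  to 1. The remainder is a sum because \<open>mdiff\<close> is close to minus the directional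
  term.\<close>

lemma power2_norm_le_weighted:
  fixes a b :: "'a::real_normed_vector"
  assumes t: "t > 0"
  shows "(norm a)\<^sup>2 \<le> (1 + t) * (norm b)\<^sup>2 + (1 + 1 / t) * (norm (a + b))\<^sup>2"
proof -
  let ?x = "norm (a + b)" and ?b = "norm b"
  have "norm a \<le> ?x + ?b" using norm_triangle_ineq4[of "a + b" b] by simp
  then have "(norm a)\<^sup>2 \<le> (?x + ?b)\<^sup>2" by (intro power_mono) auto
  also have "\<dots> = ?x\<^sup>2 + ?b\<^sup>2 + 2 * ?x * ?b" by (simp add: power2_sum)
  also have "2 * ?x * ?b \<le> ?x\<^sup>2 / t + t * ?b\<^sup>2"
  proof -
    have "0 \<le> (?x - t * ?b)\<^sup>2 / t" using t by simp
    also have "\<dots> = ?x\<^sup>2 / t + t * ?b\<^sup>2 - 2 * ?x * ?b" using t by (simp add: power2_diff power2_eq_square field_simps)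
    finally show ?thesis by simp
  qed
  finally show ?thesis by (simp add: algebra_simps)
qed

lemma nn_integral_power2_le_weighted:
  fixes f g :: "'a::euclidean_space \<Rightarrow> 'b::{real_normed_vector, second_countable_topology}"
  assumes [measurable]: "f \<in> borel_measurable borel" "g \<in> borel_measurable borel" and t: "t > 0"
  shows "(\<integral>\<^sup>+x. ennreal ((norm (f x))\<^sup>2) \<partial>lborel)
    \<le> ennreal (1 + t) * (\<integral>\<^sup>+x. ennreal ((norm (g x))\<^sup>2) \<partial>lborel) + ennreal (1 + 1 / t) * (\<integral>\<^sup>+x. ennreal ((norm (f x + g x))\<^sup>2) \<partial>lborel)"
proof -
  have "(\<integral>\<^sup>+x. ennreal ((norm (f x))\<^sup>2) \<partial>lborel)
    \<le> (\<integral>\<^sup>+x. ennreal (1 + t) * ennreal ((norm (g x))\<^sup>2) + ennreal (1 + 1 / t) * ennreal ((norm (f x + g x))\<^sup>2) \<partial>lborel)"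
  proof (rule nn_integral_mono)
    fix x
    have "ennreal ((norm (f x))\<^sup>2) \<le> ennreal ((1 + t) * (norm (g x))\<^sup>2 + (1 + 1 / t) * (norm (f x + g x))\<^sup>2)"
      by (intro ennreal_leI power2_norm_le_weighted t)
    also have "\<dots> = ennreal (1 + t) * ennreal ((norm (g x))\<^sup>2) + ennreal (1 + 1 / t) * ennreal ((norm (f x + g x))\<^sup>2)"
      using t by (subst ennreal_plus) (simp_all add: ennreal_mult)
    finally show "ennreal ((norm (f x))\<^sup>2) \<le> ennreal (1 + t) * ennreal ((norm (g x))\<^sup>2) + ennreal (1 + 1 / t) * ennreal ((norm (f x + g x))\<^sup>2)" .
  qed
  also have "\<dots> = ennreal (1 + t) * (\<integral>\<^sup>+x. ennreal ((norm (g x))\<^sup>2) \<partial>lborel) + ennreal (1 + 1 / t) * (\<integral>\<^sup>+x. ennreal ((norm (f x + g x))\<^sup>2) \<partial>lborel)"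
    by (subst nn_integral_add) (simp_all add: nn_integral_cmult)
  finally show ?thesis .
qed

text \<open>Shaped by the weighted inequality: each \<open>t\<close> comes with its own comparison
  functions, and the lower bound carries the factor \<open>1 + t\<close> on \<open>F\<close>,
  because it arises by exchanging the two sides of that inequality.\<close>

lemma tendsto_ennreal_sandwich:
  fixes F :: "'a \<Rightarrow> ennreal" and L \<kappa> :: real
  assumes L: "0 \<le> L" and \<kappa>: "0 \<le> \<kappa>"
    and up: "\<And>t. t > 0 \<Longrightarrow> \<exists>p. (\<forall>\<^sub>F s in G. F s \<le> ennreal (p s)) \<and> (p \<longlongrightarrow> L + t * \<kappa>) G"
    and lo: "\<And>t. t > 0 \<Longrightarrow> \<exists>q. (\<forall>\<^sub>F s in G. ennreal (q s) \<le> ennreal (1 + t) * F s) \<and> (q \<longlongrightarrow> L - t * \<kappa>) G"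
  shows "(F \<longlongrightarrow> ennreal L) G"
proof -
  have fin: "\<forall>\<^sub>F s in G. F s = ennreal (enn2real (F s))"
  proof -
    obtain p where "\<forall>\<^sub>F s in G. F s \<le> ennreal (p s)" using up[of 1] by auto
    then show ?thesis
      by (rule eventually_mono) (metis ennreal_enn2real ennreal_less_top le_less_trans)
  qed
  have cancel: "x / y * y = x" if "0 < y" for x y :: real using that by simp
  have "((\<lambda>s. enn2real (F s)) \<longlongrightarrow> L) G"
  proof (rule order_tendstoI)
    fix a assume a: "a < L"
    \<comment> \<open>Chosen so that \<open>t * (\<kappa> + \<bar>a\<bar> + 1)\<close> is half the
      gap \<open>L - a\<close>, which yields \<open>a * (1 + t) < L - t * \<kappa>\<close>.\<close>
    define t where "t = (L - a) / (2 * (\<kappa> + \<bar>a\<bar> + 1))"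
    have den: "0 < 2 * (\<kappa> + \<bar>a\<bar> + 1)" using \<kappa> by (simp add: add_nonneg_pos)
    have t: "t > 0" using a den by (simp add: t_def)
    have "t * (2 * (\<kappa> + \<bar>a\<bar> + 1)) = L - a" unfolding t_def by (rule cancel[OF den])
    moreover have "t * (\<kappa> + a) \<le> t * (\<kappa> + \<bar>a\<bar> + 1)" using t by (intro mult_left_mono) auto
    ultimately have key: "a * (1 + t) < L - t * \<kappa>" using a by (simp add: algebra_simps)
    obtain q where q: "\<forall>\<^sub>F s in G. ennreal (q s) \<le> ennreal (1 + t) * F s" "(q \<longlongrightarrow> L - t * \<kappa>) G"
      using lo[OF t] by blast
    have "\<forall>\<^sub>F s in G. a * (1 + t) < q s" using order_tendstoD(1)[OF q(2) key] .
    with q(1) fin show "\<forall>\<^sub>F s in G. a < enn2real (F s)"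
    proof eventually_elim
      case (elim s)
      have "ennreal (q s) \<le> ennreal ((1 + t) * enn2real (F s))"
        using elim(1,2) t by (metis add_nonneg_nonneg ennreal_mult enn2real_nonneg less_eq_real_def zero_less_one)
      then have "q s \<le> (1 + t) * enn2real (F s)" using t by (subst (asm) ennreal_le_iff) auto
      then have "a * (1 + t) < enn2real (F s) * (1 + t)" using elim(3) by (simp add: mult.commute)
      then show ?case using t by (simp add: mult_less_cancel_right_pos)
    qed
  next
    fix a assume a: "L < a"
    define t where "t = (a - L) / (2 * (\<kappa> + 1))"
    have den: "0 < 2 * (\<kappa> + 1)" using \<kappa> by simp
    have t: "t > 0" using a den by (simp add: t_def)
    have "t * (2 * (\<kappa> + 1)) = a - L" unfolding t_def by (rule cancel[OF den])
    then have key: "L + t * \<kappa> < a" using a t \<kappa> by (simp add: algebra_simps)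
    obtain p where p: "\<forall>\<^sub>F s in G. F s \<le> ennreal (p s)" "(p \<longlongrightarrow> L + t * \<kappa>) G" using up[OF t] by blast
    have "\<forall>\<^sub>F s in G. p s < a" using order_tendstoD(2)[OF p(2) key] .
    with p(1) show "\<forall>\<^sub>F s in G. enn2real (F s) < a"
    proof eventually_elim
      case (elim s)
      have "enn2real (F s) \<le> enn2real (ennreal (p s))" using elim(1) by (intro enn2real_mono) auto
      also have "\<dots> \<le> max 0 (p s)" by (cases "0 \<le> p s") (auto simp: ennreal_neg)
      also have "\<dots> < a" using elim(2) a L by simp
      finally show ?case .
    qed
  qed
  then have "((\<lambda>s. ennreal (enn2real (F s))) \<longlongrightarrow> ennreal L) G" by (rule tendsto_ennrealI)
  then show ?thesis
    by (rule Lim_transform_eventually) (use fin in \<open>auto elim: eventually_mono\<close>)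
qed

text \<open>Averaging over the directions of \<open>h\<close> decouples the two integrals: only the
  energy of \<open>D\<close> and the second moment of the weight remain.\<close>

lemma nn_integral_hdot_weight:
  fixes D :: "real^'n \<Rightarrow> complex^'n" and g :: "real \<Rightarrow> ennreal"
  assumes D[measurable]: "D \<in> borel_measurable borel" and g[measurable]: "g \<in> borel_measurable borel"
  shows "of_nat CARD('n) * (\<integral>\<^sup>+h. (\<integral>\<^sup>+x. ennreal ((norm (hdot h (D x)))\<^sup>2) \<partial>lborel) * g (norm h) \<partial>lborel)
    = (\<integral>\<^sup>+x. ennreal ((norm (D x))\<^sup>2) \<partial>lborel) * (\<integral>\<^sup>+h. ennreal ((norm h)\<^sup>2) * g (norm h) \<partial>(lborel :: (real^'n) measure))"
proof -
  have m: "(\<lambda>(h, x). ennreal ((norm (hdot h (D x)))\<^sup>2) * g (norm h)) \<in> borel_measurable (borel \<Otimes>\<^sub>M borel)"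
    by measurable
  have "(\<integral>\<^sup>+h. (\<integral>\<^sup>+x. ennreal ((norm (hdot h (D x)))\<^sup>2) \<partial>lborel) * g (norm h) \<partial>lborel)
      = (\<integral>\<^sup>+h. (\<integral>\<^sup>+x. ennreal ((norm (hdot h (D x)))\<^sup>2) * g (norm h) \<partial>lborel) \<partial>lborel)"
    by (intro nn_integral_cong nn_integral_multc[symmetric]) measurable
  also have "\<dots> = (\<integral>\<^sup>+x. (\<integral>\<^sup>+h. ennreal ((norm (hdot h (D x)))\<^sup>2) * g (norm h) \<partial>lborel) \<partial>lborel)"
    by (rule lborel_pair.Fubini') (use m in \<open>simp add: lborel_prod[symmetric] cong: measurable_cong_sets\<close>)
  also have "of_nat CARD('n) * \<dots> = (\<integral>\<^sup>+x. of_nat CARD('n) * (\<integral>\<^sup>+h. ennreal ((norm (hdot h (D x)))\<^sup>2) * g (norm h) \<partial>lborel) \<partial>lborel)"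
    by (rule nn_integral_cmult[symmetric]) measurable
  also have "\<dots> = (\<integral>\<^sup>+x. ennreal ((norm (D x))\<^sup>2) * (\<integral>\<^sup>+h. ennreal ((norm h)\<^sup>2) * g (norm h) \<partial>(lborel :: (real^'n) measure)) \<partial>lborel)"
    by (simp only: nn_integral_hdot_square_radial[OF g])
  also have "\<dots> = (\<integral>\<^sup>+x. ennreal ((norm (D x))\<^sup>2) \<partial>lborel) * (\<integral>\<^sup>+h. ennreal ((norm h)\<^sup>2) * g (norm h) \<partial>(lborel :: (real^'n) measure))"
    by (rule nn_integral_multc) measurable
  finally show ?thesis .
qed

lemma nn_integral_weighted_le:
  fixes f1 f2 f3 :: "'a \<Rightarrow> ennreal"
  assumes [measurable]: "f2 \<in> borel_measurable M" "f3 \<in> borel_measurable M"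
    and le: "\<And>x. x \<in> space M \<Longrightarrow> f1 x \<le> a * f2 x + b * f3 x"
  shows "(\<integral>\<^sup>+x. f1 x \<partial>M) \<le> a * (\<integral>\<^sup>+x. f2 x \<partial>M) + b * (\<integral>\<^sup>+x. f3 x \<partial>M)"
proof -
  have "(\<integral>\<^sup>+x. f1 x \<partial>M) \<le> (\<integral>\<^sup>+x. a * f2 x + b * f3 x \<partial>M)" by (intro nn_integral_mono le)
  also have "\<dots> = a * (\<integral>\<^sup>+x. f2 x \<partial>M) + b * (\<integral>\<^sup>+x. f3 x \<partial>M)"
    by (simp add: nn_integral_add nn_integral_cmult)
  finally show ?thesis .
qed

text \<open>Steps shorter than \<delta> are compared with the directional term, whose integral is
  explicit; longer ones are bounded by the norm of \<open>u\<close> and vanish in the limit. The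
  limit constant is \<open>c / (2 * N)\<close>, where \<open>c / 2\<close> comes from the second
  moment and \<open>1 / N\<close> from averaging over directions.\<close>

lemma tendsto_nn_integral_mdiff:
  fixes \<Omega> :: "(real^'n) set" and A :: "real^'n \<Rightarrow> real^'n" and u :: "real^'n \<Rightarrow> complex" and D :: "real^'n \<Rightarrow> complex^'n"
  assumes \<Omega>: "open \<Omega>" and A: "A \<in> borel_measurable borel" and M: "\<And>x. norm (A x) \<le> M" and cA: "continuous_on \<Omega> A"
    and u: "u \<in> borel_measurable borel" and D: "D \<in> borel_measurable borel"
    and approx: "\<And>e. e > 0 \<Longrightarrow> \<exists>\<phi>\<in>test_functions \<Omega>. (\<integral>\<^sup>+x. ennreal ((norm (u x - \<phi> x))\<^sup>2) \<partial>lborel) \<le> ennreal e \<and>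
        (\<integral>\<^sup>+x. ennreal ((norm (D x - mgrad A \<phi> x))\<^sup>2) \<partial>lborel) \<le> ennreal e"
    and U: "(\<integral>\<^sup>+x. ennreal ((norm (u x))\<^sup>2) \<partial>lborel) = ennreal U" "0 \<le> U"
    and E: "(\<integral>\<^sup>+x. ennreal ((norm (D x))\<^sup>2) \<partial>lborel) = ennreal E" "0 \<le> E"
  shows "((\<lambda>s. ennreal (1 - s) * (\<integral>\<^sup>+h. (\<integral>\<^sup>+x. ennreal ((norm (mdiff A u h x))\<^sup>2) \<partial>lborel) * ennreal (norm h powr - (real CARD('n) + 2 * s)) \<partial>lborel))
    \<longlongrightarrow> ennreal (unit_ball_vol (real CARD('n)) / 2 * E)) (at_left 1)"
proof -
  define N where "N = real CARD('n)"
  define c where "c = N * unit_ball_vol N"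
  define L where "L = unit_ball_vol N / 2 * E"
  have N: "N > 0" by (simp add: N_def)
  have c: "c > 0" using N by (simp add: c_def)
  have cN: "c / N = unit_ball_vol N" using N by (simp add: c_def)
  have L: "0 \<le> L" using E by (simp add: L_def N_def)
  define T where "T h = (\<integral>\<^sup>+x. ennreal ((norm (mdiff A u h x))\<^sup>2) \<partial>lborel)" for h
  define B where "B h = (\<integral>\<^sup>+x. ennreal ((norm (hdot h (D x)))\<^sup>2) \<partial>lborel)" for h
  define w where "w s h = ennreal (norm h powr - (N + 2 * s))" for s and h :: "real^'n"
  define F where "F s = ennreal (1 - s) * (\<integral>\<^sup>+h. T h * w s h \<partial>lborel)" for s
  note [measurable] = A u D
  have [measurable]: "T \<in> borel_measurable borel"
  proof -
    have "(\<lambda>(h, x). ennreal ((norm (mdiff A u h x))\<^sup>2)) \<in> borel_measurable (borel \<Otimes>\<^sub>M lborel)"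
      unfolding mdiff_def by measurable
    then show ?thesis unfolding T_def[abs_def] by (rule lborel.borel_measurable_nn_integral)
  qed
  have [measurable]: "B \<in> borel_measurable borel"
  proof -
    have "(\<lambda>(h, x). ennreal ((norm (hdot h (D x)))\<^sup>2)) \<in> borel_measurable (borel \<Otimes>\<^sub>M lborel)"
      by measurable
    then show ?thesis unfolding B_def[abs_def] by (rule lborel.borel_measurable_nn_integral)
  qed
  have [measurable]: "w s \<in> borel_measurable borel" for s unfolding w_def by measurable
  have T_le: "T h \<le> ennreal (4 * U)" for h
    using nn_integral_mdiff_le_L2[OF A u, of h] U by (simp add: T_def ennreal_mult)
  \<comment> \<open>Here \<open>E / N\<close> is the directional average of the energy,
    \<open>c / 2 * \<delta> powr (2 - 2 * s)\<close> is \<open>1 - s\<close> times the second moment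
    of the weight inside the \<delta>-ball, and the last summand bounds the long steps.\<close>
  define p where "p \<epsilon> t \<delta> s = ((1 + t) * (E / N) + (1 + 1 / t) * \<epsilon>) * (c / 2 * \<delta> powr (2 - 2 * s))
      + 4 * U * ((1 - s) * (c * (\<delta> powr (- 2 * s) / (2 * s))))" for \<epsilon> t \<delta> s :: real
  define q where "q \<epsilon> t \<delta> s = (E / N - (1 + 1 / t) * \<epsilon>) * (c / 2 * \<delta> powr (2 - 2 * s))" for \<epsilon> t \<delta> s :: real
  have main: "\<exists>\<delta>>0. \<forall>s\<in>{0<..<1}. F s \<le> ennreal (p \<epsilon> t \<delta> s) \<and> ennreal (q \<epsilon> t \<delta> s) \<le> ennreal (1 + t) * F s"
    if \<epsilon>: "\<epsilon> > 0" and t: "t > 0" for \<epsilon> t :: real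
  proof -
    obtain \<delta> where \<delta>: "\<delta> > 0" "\<And>h. 0 < norm h \<Longrightarrow> norm h < \<delta> \<Longrightarrow>
        (\<integral>\<^sup>+x. ennreal ((norm (mdiff A u h x + hdot h (D x)))\<^sup>2) \<partial>lborel) \<le> ennreal (\<epsilon> * (norm h)\<^sup>2)"
      using mdiff_first_order_L2[OF \<Omega> A M cA u D approx \<epsilon>] by blast
    have TB: "T h \<le> ennreal (1 + t) * B h + ennreal ((1 + 1 / t) * \<epsilon>) * ennreal ((norm h)\<^sup>2)"
      and BT: "B h \<le> ennreal (1 + t) * T h + ennreal ((1 + 1 / t) * \<epsilon>) * ennreal ((norm h)\<^sup>2)"
      if h: "0 < norm h" "norm h < \<delta>" for h
    proof -
      let ?W = "\<integral>\<^sup>+x. ennreal ((norm (mdiff A u h x + hdot h (D x)))\<^sup>2) \<partial>lborel"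
      have W: "ennreal (1 + 1 / t) * ?W \<le> ennreal ((1 + 1 / t) * \<epsilon>) * ennreal ((norm h)\<^sup>2)"
      proof -
        have "ennreal (1 + 1 / t) * ?W \<le> ennreal (1 + 1 / t) * ennreal (\<epsilon> * (norm h)\<^sup>2)"
          by (intro mult_left_mono \<delta>(2) h) auto
        also have "\<dots> = ennreal ((1 + 1 / t) * (\<epsilon> * (norm h)\<^sup>2))"
          using t \<epsilon> by (intro ennreal_mult[symmetric]) auto
        also have "(1 + 1 / t) * (\<epsilon> * (norm h)\<^sup>2) = (1 + 1 / t) * \<epsilon> * (norm h)\<^sup>2" by (simp only: mult.assoc)
        also have "ennreal \<dots> = ennreal ((1 + 1 / t) * \<epsilon>) * ennreal ((norm h)\<^sup>2)"
          using t \<epsilon> by (intro ennreal_mult) auto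
        finally show ?thesis .
      qed
      have m: "mdiff A u h \<in> borel_measurable borel" by (rule mdiff_measurable[OF A u])
      have m2: "(\<lambda>x. hdot h (D x)) \<in> borel_measurable borel" by measurable
      have "T h \<le> ennreal (1 + t) * B h + ennreal (1 + 1 / t) * ?W"
        unfolding T_def B_def by (rule nn_integral_power2_le_weighted[OF m m2 t])
      then show "T h \<le> ennreal (1 + t) * B h + ennreal ((1 + 1 / t) * \<epsilon>) * ennreal ((norm h)\<^sup>2)"
        using W by (meson add_left_mono order_trans)
      have "B h \<le> ennreal (1 + t) * T h + ennreal (1 + 1 / t) * (\<integral>\<^sup>+x. ennreal ((norm (hdot h (D x) + mdiff A u h x))\<^sup>2) \<partial>lborel)"
        unfolding T_def B_def by (rule nn_integral_power2_le_weighted[OF m2 m t])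
      then show "B h \<le> ennreal (1 + t) * T h + ennreal ((1 + 1 / t) * \<epsilon>) * ennreal ((norm h)\<^sup>2)"
        using W by (simp only: add.commute[of "hdot _ _"]) (meson add_left_mono order_trans)
    qed
    have "F s \<le> ennreal (p \<epsilon> t \<delta> s) \<and> ennreal (q \<epsilon> t \<delta> s) \<le> ennreal (1 + t) * F s" if s: "s \<in> {0<..<1}" for s
    proof -
      define g where "g r = ennreal (r powr - (N + 2 * s)) * indicator {..<\<delta>} r" for r :: real
      have [measurable]: "g \<in> borel_measurable borel" unfolding g_def by measurable
      \<comment> \<open>This includes \<open>h = 0\<close>, where \<open>0 powr\<close> any exponent
        is 0; the comparison of \<open>T\<close> and \<open>B\<close> is available only for
        \<open>0 < norm h\<close>.\<close>
      have g0: "g (norm h) = 0" if "\<not> (0 < norm h \<and> norm h < \<delta>)" for h :: "real^'n"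
        using that by (auto simp: g_def indicator_def)
      define J where "J = c * (\<delta> powr (2 - 2 * s) / (2 - 2 * s))"
      have J: "(\<integral>\<^sup>+h. ennreal ((norm h)\<^sup>2) * g (norm h) \<partial>(lborel :: (real^'n) measure)) = ennreal J" "J \<ge> 0"
        using nn_integral_power_inside_ball[of s \<delta>, where 'a="real^'n"] s \<delta>(1) c
        by (auto simp: g_def J_def c_def N_def)
      define O' where "O' = c * (\<delta> powr (- 2 * s) / (2 * s))"
      have O': "(\<integral>\<^sup>+h. w s h * indicator {\<delta>..} (norm h) \<partial>(lborel :: (real^'n) measure)) = ennreal O'" "O' \<ge> 0"
        using nn_integral_power_outside_ball[of s \<delta>, where 'a="real^'n"] s \<delta>(1) c
        by (auto simp: w_def O'_def c_def N_def)
      define Gin where "Gin = (\<integral>\<^sup>+h. T h * g (norm h) \<partial>lborel)"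
      define Bin where "Bin = (\<integral>\<^sup>+h. B h * g (norm h) \<partial>lborel)"
      define Gout where "Gout = (\<integral>\<^sup>+h. T h * (w s h * indicator {\<delta>..} (norm h)) \<partial>lborel)"
      have G: "(\<integral>\<^sup>+h. T h * w s h \<partial>lborel) = Gin + Gout"
      proof -
        have "(\<integral>\<^sup>+h. T h * w s h \<partial>lborel) = (\<integral>\<^sup>+h. T h * g (norm h) + T h * (w s h * indicator {\<delta>..} (norm h)) \<partial>lborel)"
          by (intro nn_integral_cong) (auto simp: g_def w_def indicator_def)
        also have "\<dots> = Gin + Gout" unfolding Gin_def Gout_def by (rule nn_integral_add) measurable
        finally show ?thesis .
      qed
      have "of_nat CARD('n) * Bin = ennreal E * ennreal J"
        using nn_integral_hdot_weight[OF D \<open>g \<in> borel_measurable borel\<close>] by (simp add: Bin_def B_def E J(1))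
      then have "ennreal N * Bin = ennreal (E * J)" using E J by (simp add: N_def ennreal_mult ennreal_of_nat_eq_real_of_nat)
      then have "ennreal (1 / N) * (ennreal N * Bin) = ennreal (1 / N) * ennreal (E * J)" by simp
      then have Bin: "Bin = ennreal (E / N * J)"
        using N E J by (simp add: mult.assoc[symmetric] ennreal_mult[symmetric])
      have Gout_le: "Gout \<le> ennreal (4 * U * O')"
      proof -
        have "Gout \<le> (\<integral>\<^sup>+h. ennreal (4 * U) * (w s h * indicator {\<delta>..} (norm h)) \<partial>lborel)"
          unfolding Gout_def by (intro nn_integral_mono mult_right_mono T_le) auto
        also have "\<dots> = ennreal (4 * U) * ennreal O'" unfolding O'(1)[symmetric] by (rule nn_integral_cmult) measurable
        finally show ?thesis using U O' by (simp add: ennreal_mult)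
      qed
      have Gin_le: "Gin \<le> ennreal (1 + t) * Bin + ennreal ((1 + 1 / t) * \<epsilon>) * ennreal J"
        unfolding Gin_def Bin_def J(1)[symmetric]
      proof (rule nn_integral_weighted_le)
        fix h :: "real^'n"
        show "T h * g (norm h) \<le> ennreal (1 + t) * (B h * g (norm h)) + ennreal ((1 + 1 / t) * \<epsilon>) * (ennreal ((norm h)\<^sup>2) * g (norm h))"
        proof (cases "0 < norm h \<and> norm h < \<delta>")
          case True
          then show ?thesis using mult_right_mono[OF TB[of h], of "g (norm h)"] by (simp add: distrib_right mult.assoc)
        qed (simp add: g0)
      qed measurable
      have Bin_le: "Bin \<le> ennreal (1 + t) * Gin + ennreal ((1 + 1 / t) * \<epsilon>) * ennreal J"
        unfolding Gin_def Bin_def J(1)[symmetric]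
      proof (rule nn_integral_weighted_le)
        fix h :: "real^'n"
        show "B h * g (norm h) \<le> ennreal (1 + t) * (T h * g (norm h)) + ennreal ((1 + 1 / t) * \<epsilon>) * (ennreal ((norm h)\<^sup>2) * g (norm h))"
        proof (cases "0 < norm h \<and> norm h < \<delta>")
          case True
          then show ?thesis using mult_right_mono[OF BT[of h], of "g (norm h)"] by (simp add: distrib_right mult.assoc)
        qed (simp add: g0)
      qed measurable
      have s1: "0 < 1 - s" using s by simp
      have sJ: "(1 - s) * J = c / 2 * \<delta> powr (2 - 2 * s)"
      proof -
        have "(1 - s) / (2 - 2 * s) = 1 / 2" using s by (simp add: field_simps)
        then show ?thesis by (simp add: J_def mult.assoc[symmetric]) (simp add: field_simps)
      qed
      have pos: "0 \<le> E / N * J" "0 \<le> (1 + 1 / t) * \<epsilon>" "0 \<le> (1 + 1 / t) * \<epsilon> * J" "0 \<le> 4 * U * O'"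
        using E N J t \<epsilon> U O' by auto
      have nn: "0 \<le> (1 + t) * (E / N * J)" using t by (intro mult_nonneg_nonneg[OF _ pos(1)]) simp
      have up: "F s \<le> ennreal (p \<epsilon> t \<delta> s)"
      proof -
        have "(\<integral>\<^sup>+h. T h * w s h \<partial>lborel) \<le> (ennreal (1 + t) * ennreal (E / N * J) + ennreal ((1 + 1 / t) * \<epsilon>) * ennreal J) + ennreal (4 * U * O')"
          unfolding G using add_mono[OF Gin_le Gout_le] by (simp only: Bin)
        also have "\<dots> = ennreal ((1 + t) * (E / N * J) + (1 + 1 / t) * \<epsilon> * J + 4 * U * O')"
        proof -
          have "ennreal (1 + t) * ennreal (E / N * J) = ennreal ((1 + t) * (E / N * J))"
            using t by (intro ennreal_mult[OF _ pos(1), symmetric]) simp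
          moreover have "ennreal ((1 + 1 / t) * \<epsilon>) * ennreal J = ennreal ((1 + 1 / t) * \<epsilon> * J)"
            by (rule ennreal_mult[OF pos(2) J(2), symmetric])
          ultimately show ?thesis
            using ennreal_plus[OF nn pos(3)] ennreal_plus[OF add_nonneg_nonneg[OF nn pos(3)] pos(4)] by (simp only:)
        qed
        finally have "F s \<le> ennreal (1 - s) * ennreal ((1 + t) * (E / N * J) + (1 + 1 / t) * \<epsilon> * J + 4 * U * O')"
          unfolding F_def by (intro mult_left_mono) auto
        also have "\<dots> = ennreal ((1 - s) * ((1 + t) * (E / N * J) + (1 + 1 / t) * \<epsilon> * J + 4 * U * O'))"
          by (rule ennreal_mult[OF less_imp_le[OF s1] add_nonneg_nonneg[OF add_nonneg_nonneg[OF nn pos(3)] pos(4)], symmetric])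
        also have "(1 - s) * ((1 + t) * (E / N * J) + (1 + 1 / t) * \<epsilon> * J + 4 * U * O')
            = ((1 + t) * (E / N) + (1 + 1 / t) * \<epsilon>) * ((1 - s) * J) + 4 * U * ((1 - s) * O')"
          by (simp only: distrib_left distrib_right mult_ac)
        finally show ?thesis unfolding p_def sJ O'_def .
      qed
      have lo: "ennreal (q \<epsilon> t \<delta> s) \<le> ennreal (1 + t) * F s"
      proof -
        have "ennreal (E / N * J - (1 + 1 / t) * \<epsilon> * J) \<le> ennreal (1 + t) * Gin"
        proof -
          have "ennreal (E / N * J - (1 + 1 / t) * \<epsilon> * J) = ennreal (E / N * J) - ennreal ((1 + 1 / t) * \<epsilon> * J)"
            using pos by (intro ennreal_minus[symmetric])
          also have "\<dots> \<le> ennreal (1 + t) * Gin"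
            using Bin_le pos J(2) by (intro ennreal_minus_le_iff[THEN iffD2]) (simp add: Bin ennreal_mult[symmetric] add.commute)
          finally show ?thesis .
        qed
        also have "\<dots> \<le> ennreal (1 + t) * (Gin + Gout)" by (intro mult_left_mono) auto
        finally have "ennreal (1 - s) * ennreal (E / N * J - (1 + 1 / t) * \<epsilon> * J) \<le> ennreal (1 - s) * (ennreal (1 + t) * (Gin + Gout))"
          by (intro mult_left_mono) auto
        also have "\<dots> = ennreal (1 + t) * F s" by (simp only: F_def G mult.left_commute)
        also have "ennreal (1 - s) * ennreal (E / N * J - (1 + 1 / t) * \<epsilon> * J) = ennreal ((1 - s) * (E / N * J - (1 + 1 / t) * \<epsilon> * J))"
          using s1 by (simp add: ennreal_mult')
        also have "(1 - s) * (E / N * J - (1 + 1 / t) * \<epsilon> * J) = (E / N - (1 + 1 / t) * \<epsilon>) * ((1 - s) * J)"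
          by (subst left_diff_distrib[of "E / N" "(1 + 1 / t) * \<epsilon>" J, symmetric]) (rule mult.left_commute)
        finally show ?thesis unfolding q_def sJ .
      qed
      show ?thesis using up lo by blast
    qed
    then show ?thesis using \<delta>(1) by blast
  qed
  have ev: "\<forall>\<^sub>F s in at_left 1. s \<in> {0<..<1::real}"
    using eventually_at_left_real[of 0 "1::real"] by simp
  have lim_j: "((\<lambda>s::real. c / 2 * \<delta> powr (2 - 2 * s)) \<longlongrightarrow> c / 2) (at_left 1)" if "\<delta> > 0" for \<delta> :: real
  proof -
    have "((\<lambda>s::real. c / 2 * \<delta> powr (2 - 2 * s)) \<longlongrightarrow> c / 2 * \<delta> powr (2 - 2 * 1)) (at_left 1)"
      using that by (intro tendsto_intros) auto
    then show ?thesis using that by simp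
  qed
  have lim_o: "((\<lambda>s::real. (1 - s) * (c * (\<delta> powr (- 2 * s) / (2 * s)))) \<longlongrightarrow> 0) (at_left 1)" if "\<delta> > 0" for \<delta> :: real
  proof -
    have "((\<lambda>s::real. (1 - s) * (c * (\<delta> powr (- 2 * s) / (2 * s)))) \<longlongrightarrow> (1 - 1) * (c * (\<delta> powr (- 2 * 1) / (2 * 1)))) (at_left 1)"
      using that by (intro tendsto_intros) auto
    then show ?thesis by simp
  qed
  define \<kappa> where "\<kappa> = L + c / 2"
  have LE: "E / N * (c / 2) = L" using N by (simp add: L_def c_def)
  have "(F \<longlongrightarrow> ennreal L) (at_left 1)"
  proof (rule tendsto_ennreal_sandwich[OF L])
    show "0 \<le> \<kappa>" using L c by (simp add: \<kappa>_def)
    fix t :: real assume t: "t > 0"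
    \<comment> \<open>Solves \<open>(1 + 1 / t) * \<epsilon> = t\<close>, so that the remainder,
      despite the large factor \<open>1 / t\<close>, costs only a multiple of
      \<open>t\<close>.\<close>
    define \<epsilon> where "\<epsilon> = t\<^sup>2 / (1 + t)"
    have \<epsilon>: "\<epsilon> > 0" using t by (simp add: \<epsilon>_def)
    have te: "(1 + 1 / t) * \<epsilon> = t" 
    proof -
      have "1 + 1 / t = (1 + t) / t" using t by (simp add: field_simps)
      then show ?thesis using t by (simp add: \<epsilon>_def power2_eq_square)
    qed
    obtain \<delta> where \<delta>: "\<delta> > 0" "\<And>s. s \<in> {0<..<1} \<Longrightarrow> F s \<le> ennreal (p \<epsilon> t \<delta> s)"
        "\<And>s. s \<in> {0<..<1} \<Longrightarrow> ennreal (q \<epsilon> t \<delta> s) \<le> ennreal (1 + t) * F s"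
      using main[OF \<epsilon> t] by blast
    have "(p \<epsilon> t \<delta> \<longlongrightarrow> ((1 + t) * (E / N) + (1 + 1 / t) * \<epsilon>) * (c / 2) + 4 * U * 0) (at_left 1)"
      unfolding p_def[abs_def] by (intro tendsto_add tendsto_mult tendsto_const lim_j lim_o \<delta>(1))
    also have "((1 + t) * (E / N) + (1 + 1 / t) * \<epsilon>) * (c / 2) + 4 * U * 0 = L + t * \<kappa>"
    proof -
      have "((1 + t) * x + t) * k + 4 * U * 0 = x * k + t * (x * k + k)" for x k :: real
        by (simp add: algebra_simps)
      from this[of "E / N" "c / 2"] show ?thesis unfolding te \<kappa>_def LE[symmetric] .
    qed
    finally have "(p \<epsilon> t \<delta> \<longlongrightarrow> L + t * \<kappa>) (at_left 1)" .
    moreover have "\<forall>\<^sub>F s in at_left 1. F s \<le> ennreal (p \<epsilon> t \<delta> s)"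
      using ev by (rule eventually_mono) (rule \<delta>(2))
    ultimately show "\<exists>p. (\<forall>\<^sub>F s in at_left 1. F s \<le> ennreal (p s)) \<and> (p \<longlongrightarrow> L + t * \<kappa>) (at_left 1)"
      by blast
    have lim_q: "(q \<epsilon> t \<delta> \<longlongrightarrow> (E / N - (1 + 1 / t) * \<epsilon>) * (c / 2)) (at_left 1)"
      unfolding q_def[abs_def] by (intro tendsto_mult tendsto_const lim_j \<delta>(1))
    \<comment> \<open>Subtracting \<open>t * L\<close> only weakens the lower bound and gives both
      bounds the same \<kappa>: the limit of \<open>q\<close> is \<open>L - t * c / 2\<close>, and
      \<open>\<kappa> = L + c / 2\<close>.\<close>
    have "((\<lambda>s. q \<epsilon> t \<delta> s - t * L) \<longlongrightarrow> (E / N - (1 + 1 / t) * \<epsilon>) * (c / 2) - t * L) (at_left 1)"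
      by (intro tendsto_diff lim_q tendsto_const)
    also have "(E / N - (1 + 1 / t) * \<epsilon>) * (c / 2) - t * L = L - t * \<kappa>"
    proof -
      have "(x - t) * k - t * (x * k) = x * k - t * (x * k + k)" for x k :: real
        by (simp add: algebra_simps)
      from this[of "E / N" "c / 2"] show ?thesis unfolding te \<kappa>_def LE[symmetric] .
    qed
    finally have "((\<lambda>s. q \<epsilon> t \<delta> s - t * L) \<longlongrightarrow> L - t * \<kappa>) (at_left 1)" .
    moreover have "\<forall>\<^sub>F s in at_left 1. ennreal (q \<epsilon> t \<delta> s - t * L) \<le> ennreal (1 + t) * F s"
      using ev
    proof eventually_elim
      case (elim s)
      have "ennreal (q \<epsilon> t \<delta> s - t * L) \<le> ennreal (q \<epsilon> t \<delta> s)" using t L by (intro ennreal_leI) simp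
      then show ?case using \<delta>(3)[OF elim] by simp
    qed
    ultimately show "\<exists>q. (\<forall>\<^sub>F s in at_left 1. ennreal (q s) \<le> ennreal (1 + t) * F s) \<and> (q \<longlongrightarrow> L - t * \<kappa>) (at_left 1)"
      by (intro exI[of _ "\<lambda>s. q \<epsilon> t \<delta> s - t * L"] conjI)
  qed
  then show ?thesis by (simp add: F_def[abs_def] T_def w_def L_def N_def)
qed

section \<open>Borel representatives and the main theorem\<close>

lemma lebesgue_measurable_borel_representative:
  fixes f :: "'a::euclidean_space \<Rightarrow> 'b::euclidean_space"
  assumes f: "f \<in> borel_measurable lebesgue"
  obtains f' where "f' \<in> borel_measurable borel" "AE x in lborel. f x = f' x"
proof -
  have "\<exists>g\<in>borel_measurable lborel. AE x in lborel. f x \<bullet> b = g x" for b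
    using f by (intro completion_ex_borel_measurable_real) auto
  then obtain g where g: "\<And>b. g b \<in> borel_measurable lborel" "\<And>b. AE x in lborel. f x \<bullet> b = g b x" by metis
  have "AE x in lborel. \<forall>b\<in>Basis. f x \<bullet> b = g b x"
    by (intro AE_finite_allI finite_Basis g)
  then have "AE x in lborel. f x = (\<Sum>b\<in>Basis. g b x *\<^sub>R b)"
  proof eventually_elim
    case (elim x)
    have "f x = (\<Sum>b\<in>Basis. (f x \<bullet> b) *\<^sub>R b)" by (simp add: euclidean_representation)
    also have "\<dots> = (\<Sum>b\<in>Basis. g b x *\<^sub>R b)" using elim by (intro sum.cong) auto
    finally show ?case .
  qed
  moreover have "(\<lambda>x. \<Sum>b\<in>Basis. g b x *\<^sub>R b) \<in> borel_measurable borel"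
    using g(1) by (intro borel_measurable_sum borel_measurable_scaleR) auto
  ultimately show ?thesis by (rule that[rotated])
qed

lemma locally_bounded_compact:
  assumes f: "locally_bounded f" and K: "compact K"
  shows "bounded (f ` K)"
proof -
  obtain r where r: "\<And>x. r x > 0" "\<And>x. bounded (f ` ball x (r x))"
    using f unfolding locally_bounded_def by metis
  obtain C where C: "C \<subseteq> K" "finite C" "K \<subseteq> (\<Union>x\<in>C. ball x (r x))"
  proof (rule compactE_image[OF K])
    show "open (ball x (r x))" for x by simp
    show "K \<subseteq> (\<Union>x\<in>K. ball x (r x))" using r(1) by auto
  qed
  have "bounded (\<Union>x\<in>C. f ` ball x (r x))" using C(2) r(2) by blast
  moreover have "f ` K \<subseteq> (\<Union>x\<in>C. f ` ball x (r x))" using C(3) by blast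
  ultimately show ?thesis by (rule bounded_subset)
qed

text \<open>A weak gradient is given with integrability on compact subsets only; an exhaustion of
  \<Omega> by such sets yields measurability on the whole.\<close>

lemma weak_gradient_measurable:
  fixes u :: "real^'n \<Rightarrow> complex"
  assumes \<Omega>: "open \<Omega>" and u: "has_weak_gradient u G \<Omega>"
  shows "(\<lambda>x. indicator \<Omega> x *\<^sub>R G x) \<in> borel_measurable lebesgue"
proof -
  obtain C where C: "\<And>n::nat. compact (C n)" "\<And>n. C n \<subseteq> \<Omega>" "\<Union>(range C) = \<Omega>" "\<And>K. compact K \<Longrightarrow> K \<subseteq> \<Omega> \<Longrightarrow> \<exists>N. \<forall>n\<ge>N. K \<subseteq> C n"
    using open_Union_compact_subsets[OF \<Omega>] by metis
  show ?thesis
  proof (rule borel_measurable_LIMSEQ_metric)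
    fix n
    have "set_integrable lebesgue (C n) G" using u C by (auto simp: has_weak_gradient_def)
    then show "(\<lambda>x. indicator (C n) x *\<^sub>R G x) \<in> borel_measurable lebesgue"
      unfolding set_integrable_def by (rule borel_measurable_integrable)
  next
    fix x
    show "(\<lambda>n. indicator (C n) x *\<^sub>R G x) \<longlonglongrightarrow> indicator \<Omega> x *\<^sub>R G x"
    proof (cases "x \<in> \<Omega>")
      case True
      then obtain N where N: "\<And>n. n \<ge> N \<Longrightarrow> x \<in> C n" using C(4)[of "{x}"] by auto
      have "\<forall>\<^sub>F n in sequentially. indicator (C n) x *\<^sub>R G x = indicator \<Omega> x *\<^sub>R G x"
        using eventually_ge_at_top[of N] by eventually_elim (simp add: N True)
      then show ?thesis by (rule tendsto_eventually)
    next
      case False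
      then have "x \<notin> C n" for n using C(2) by blast
      then show ?thesis using False by simp
    qed
  qed
qed

text \<open>For fixed \<open>x\<close> the midpoint is an invertible affine function of
  \<open>y\<close>, so it pulls null sets back to null sets. This permits \<open>A\<close>, which is
  sampled at midpoints, to be altered on a null set.\<close>

lemma AE_lborel_midpoint:
  fixes x :: "'a::euclidean_space"
  assumes N: "N \<in> null_sets lborel"
  shows "AE y in lborel. (x + y) /\<^sub>R 2 \<notin> N"
proof -
  have [measurable]: "N \<in> sets borel" using N by auto
  let ?f = "\<lambda>y::'a. x /\<^sub>R 2 + (1 / 2) *\<^sub>R y"
  have "(1 / 2 :: real) \<noteq> 0" by simp
  note eq = lborel_affine[OF this, of "x /\<^sub>R 2"]
  have "AE z in lborel. z \<notin> N" by (rule AE_not_in[OF N])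
  then have "AE z in density (distr lborel borel ?f) (\<lambda>_. ennreal (\<bar>1 / 2\<bar> ^ DIM('a))). z \<notin> N"
    by (simp only: eq[symmetric])
  then have "AE z in distr lborel borel ?f. 0 < ennreal (\<bar>1 / 2\<bar> ^ DIM('a)) \<longrightarrow> z \<notin> N"
    by (rule iffD1[OF AE_density, rotated]) measurable
  then have AE: "AE z in distr lborel borel ?f. z \<notin> N" by simp
  have m: "?f \<in> measurable lborel borel" "{z \<in> space borel. z \<notin> N} \<in> sets borel" by measurable
  have "AE y in lborel. ?f y \<notin> N" using AE unfolding AE_distr_iff[OF m] .
  moreover have "(x + y) /\<^sub>R 2 = ?f y" for y by (simp add: scaleR_add_right)
  ultimately show ?thesis by (simp only:)
qed

lemma AE_lborel_prod_avoid:
  fixes N :: "'a::euclidean_space set"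
  assumes N: "N \<in> null_sets lborel"
  shows "AE p in lborel. fst p \<notin> N \<and> snd p \<notin> N \<and> (fst p + snd p) /\<^sub>R 2 \<notin> (N::'a set)"
proof -
  have [measurable]: "N \<in> sets borel" using N by auto
  have "AE p in lborel \<Otimes>\<^sub>M lborel. fst p \<notin> N \<and> snd p \<notin> N \<and> (fst p + snd p) /\<^sub>R 2 \<notin> N"
  proof (rule lborel_pair.AE_pair_measure)
    show "{p \<in> space (lborel \<Otimes>\<^sub>M lborel). fst p \<notin> N \<and> snd p \<notin> N \<and> (fst p + snd p) /\<^sub>R 2 \<notin> N} \<in> sets (lborel \<Otimes>\<^sub>M lborel)"
      by measurable
    have "AE x in lborel. x \<notin> N" by (rule AE_not_in[OF N])
    then show "AE x in lborel. AE y in lborel. fst (x, y) \<notin> N \<and> snd (x, y) \<notin> N \<and> (fst (x, y) + snd (x, y)) /\<^sub>R 2 \<notin> N"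
    proof eventually_elim
      case (elim x)
      have "AE y in lborel. y \<notin> N \<and> (x + y) /\<^sub>R 2 \<notin> N"
        using AE_not_in[OF N] AE_lborel_midpoint[OF N, of x] by eventually_elim simp
      then show ?case by eventually_elim (use elim in simp)
    qed
  qed
  then show ?thesis unfolding lborel_prod .
qed

lemma nn_integral_gagliardo_eq:
  fixes A :: "real^'n \<Rightarrow> real^'n" and u :: "real^'n \<Rightarrow> complex" and p :: real
  assumes A[measurable]: "A \<in> borel_measurable borel" and u[measurable]: "u \<in> borel_measurable borel"
  shows "(\<integral>\<^sup>+(x, y). ennreal ((cmod (u x - exp (\<i> * complex_of_real ((x - y) \<bullet> A ((x + y) /\<^sub>R 2))) * u y))\<^sup>2 / norm (x - y) powr p) \<partial>lborel)
    = (\<integral>\<^sup>+h. (\<integral>\<^sup>+x. ennreal ((norm (mdiff A u h x))\<^sup>2) \<partial>lborel) * ennreal (norm h powr - p) \<partial>lborel)"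
proof -
  let ?f = "\<lambda>x y. ennreal ((cmod (u x - exp (\<i> * complex_of_real ((x - y) \<bullet> A ((x + y) /\<^sub>R 2))) * u y))\<^sup>2 / norm (x - y) powr p)"
  have f: "(\<lambda>(x, y). ?f x y) \<in> borel_measurable (lborel \<Otimes>\<^sub>M lborel)" by measurable
  have shift: "?f x (x + h) = ennreal ((norm (mdiff A u h x))\<^sup>2) * ennreal (norm h powr - p)" for x h
  proof -
    have "x + (x + h) = 2 *\<^sub>R x + h" by (simp add: scaleR_2)
    then have "(x + (x + h)) /\<^sub>R 2 = x + h /\<^sub>R 2" by (simp add: scaleR_add_right)
    moreover have "x - (x + h) = - h" by simp
    ultimately have "?f x (x + h) = ennreal ((norm (mdiff A u h x))\<^sup>2 / norm h powr p)"
      by (simp only: mdiff_def norm_minus_cancel inner_minus_left)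
    \<comment> \<open>At \<open>h = 0\<close> both sides are 0, by \<open>0 powr p = 0\<close> and
      division by zero.\<close>
    also have "(norm (mdiff A u h x))\<^sup>2 / norm h powr p = (norm (mdiff A u h x))\<^sup>2 * norm h powr - p"
      by (simp add: powr_minus_divide)
    finally show ?thesis by (simp add: ennreal_mult)
  qed
  have m: "(\<lambda>(x, h). ennreal ((norm (mdiff A u h x))\<^sup>2) * ennreal (norm h powr - p)) \<in> borel_measurable (lborel \<Otimes>\<^sub>M lborel)"
    unfolding mdiff_def by measurable
  have "(\<integral>\<^sup>+(x, y). ?f x y \<partial>lborel) = (\<integral>\<^sup>+(x, y). ?f x y \<partial>(lborel \<Otimes>\<^sub>M lborel))" by (simp only: lborel_prod)
  also have "\<dots> = (\<integral>\<^sup>+x. \<integral>\<^sup>+y. ?f x y \<partial>lborel \<partial>lborel)"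
    using lborel.nn_integral_fst[OF f] by simp
  also have "\<dots> = (\<integral>\<^sup>+x. \<integral>\<^sup>+h. ennreal ((norm (mdiff A u h x))\<^sup>2) * ennreal (norm h powr - p) \<partial>lborel \<partial>lborel)"
  proof (rule nn_integral_cong)
    fix x
    have "(\<integral>\<^sup>+y. ?f x y \<partial>lborel) = (\<integral>\<^sup>+h. ?f x (x + h) \<partial>lborel)"
      by (rule nn_integral_lborel_translate[symmetric]) measurable
    then show "(\<integral>\<^sup>+y. ?f x y \<partial>lborel) = (\<integral>\<^sup>+h. ennreal ((norm (mdiff A u h x))\<^sup>2) * ennreal (norm h powr - p) \<partial>lborel)"
      by (simp only: shift)
  qed
  also have "\<dots> = (\<integral>\<^sup>+h. \<integral>\<^sup>+x. ennreal ((norm (mdiff A u h x))\<^sup>2) * ennreal (norm h powr - p) \<partial>lborel \<partial>lborel)"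
    by (rule lborel_pair.Fubini'[OF m, symmetric])
  also have "\<dots> = (\<integral>\<^sup>+h. (\<integral>\<^sup>+x. ennreal ((norm (mdiff A u h x))\<^sup>2) \<partial>lborel) * ennreal (norm h powr - p) \<partial>lborel)"
    by (intro nn_integral_cong nn_integral_multc) (use mdiff_measurable[OF A u] in measurable)
  finally show ?thesis .
qed

text \<open>If \<open>u\<close> vanishes at \<open>x\<close> or at \<open>y\<close>, the phase drops
  out of the modulus; otherwise both points lie in the ball of radius \<open>R\<close>, and so does
  their midpoint. Agreement of the potentials is therefore asked for on a convex set containing the
  support, since midpoints of points of \<Omega> may lie outside \<Omega>.\<close>

lemma nn_integral_gagliardo_cong:
  fixes A A' :: "real^'n \<Rightarrow> real^'n" and u u' :: "real^'n \<Rightarrow> complex" and p R :: real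
  assumes u: "AE x in lborel. u x = u' x" and A: "AE x in lborel. norm x < R \<longrightarrow> A x = A' x"
    and supp: "\<And>x. R \<le> norm x \<Longrightarrow> u x = 0"
  shows "(\<integral>\<^sup>+(x, y). ennreal ((cmod (u x - exp (\<i> * complex_of_real ((x - y) \<bullet> A ((x + y) /\<^sub>R 2))) * u y))\<^sup>2 / norm (x - y) powr p) \<partial>lborel)
    = (\<integral>\<^sup>+(x, y). ennreal ((cmod (u' x - exp (\<i> * complex_of_real ((x - y) \<bullet> A' ((x + y) /\<^sub>R 2))) * u' y))\<^sup>2 / norm (x - y) powr p) \<partial>lborel)"
proof -
  have "AE x in lborel. u x = u' x \<and> (norm x < R \<longrightarrow> A x = A' x)"
    using u A by eventually_elim simp
  then obtain N where "\<And>x. x \<in> space lborel - N \<Longrightarrow> u x = u' x \<and> (norm x < R \<longrightarrow> A x = A' x)" and N1: "N \<in> null_sets lborel"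
    by (rule AE_E3) blast
  then have N2: "\<And>x. x \<notin> N \<Longrightarrow> u x = u' x \<and> (norm x < R \<longrightarrow> A x = A' x)" by simp
  note N = N1 N2
  show ?thesis
  proof (rule nn_integral_cong_AE)
    show "AE p' in lborel. (case p' of (x, y) \<Rightarrow> ennreal ((cmod (u x - exp (\<i> * complex_of_real ((x - y) \<bullet> A ((x + y) /\<^sub>R 2))) * u y))\<^sup>2 / norm (x - y) powr p))
      = (case p' of (x, y) \<Rightarrow> ennreal ((cmod (u' x - exp (\<i> * complex_of_real ((x - y) \<bullet> A' ((x + y) /\<^sub>R 2))) * u' y))\<^sup>2 / norm (x - y) powr p))"
      using AE_lborel_prod_avoid[OF N(1)]
    proof eventually_elim
      case (elim q)
      obtain x y where q: "q = (x, y)" by (cases q)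
      have e: "u x = u' x" "u y = u' y" using N(2)[of x] N(2)[of y] elim q by auto
      have "cmod (u x - exp (\<i> * complex_of_real ((x - y) \<bullet> A ((x + y) /\<^sub>R 2))) * u y)
        = cmod (u' x - exp (\<i> * complex_of_real ((x - y) \<bullet> A' ((x + y) /\<^sub>R 2))) * u' y)"
      proof (cases "norm x < R \<and> norm y < R")
        case True
        have "norm ((x + y) /\<^sub>R 2) \<le> (norm x + norm y) / 2" using norm_triangle_ineq[of x y] by simp
        also have "\<dots> < R" using True by simp
        finally have "A ((x + y) /\<^sub>R 2) = A' ((x + y) /\<^sub>R 2)" using N(2)[of "(x + y) /\<^sub>R 2"] elim q by simp
        then show ?thesis by (simp only: e)
      next
        case False
        then have "u' x = 0 \<or> u' y = 0" using supp[of x] supp[of y] e by auto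
        then show ?thesis unfolding e by (auto simp only: norm_mult norm_exp_i_times mult_1 mult_zero_right diff_0 diff_0_right norm_minus_cancel)
      qed
      then show ?case by (simp only: q prod.case)
    qed
  qed
qed

text \<open>Restates density of test functions in terms of extended integrals of Borel
  representatives, the form used by the limit argument. Taking \<open>sqrt e\<close> as tolerance
  for the norm bounds both squared parts by \<open>e\<close>.\<close>

lemma magnetic_approximation:
  fixes \<Omega> :: "(real^'n) set" and A A0 :: "real^'n \<Rightarrow> real^'n" and u u0 :: "real^'n \<Rightarrow> complex" and D0 :: "real^'n \<Rightarrow> complex^'n"
  assumes \<Omega>: "open \<Omega>" and A0: "A0 \<in> borel_measurable borel" "\<And>x. norm (A0 x) \<le> M" "\<And>x. x \<in> \<Omega> \<Longrightarrow> A0 x = A x"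
    and u: "u \<in> H1A0_space A \<Omega>" "\<And>x. x \<notin> \<Omega> \<Longrightarrow> u x = 0"
    and u0: "u0 \<in> borel_measurable borel" "AE x in lborel. u x = u0 x"
    and D0: "D0 \<in> borel_measurable borel" "AE x in lborel. indicator \<Omega> x *\<^sub>R magnetic_gradient A \<Omega> u x = D0 x"
    and E: "(\<integral>\<^sup>+x. ennreal ((norm (D0 x))\<^sup>2) \<partial>lborel) < \<infinity>" and U: "(\<integral>\<^sup>+x. ennreal ((norm (u0 x))\<^sup>2) \<partial>lborel) < \<infinity>"
    and e: "e > 0"
  shows "\<exists>\<phi>\<in>test_functions \<Omega>. (\<integral>\<^sup>+x. ennreal ((norm (u0 x - \<phi> x))\<^sup>2) \<partial>lborel) \<le> ennreal e \<and>
    (\<integral>\<^sup>+x. ennreal ((norm (D0 x - mgrad A0 \<phi> x))\<^sup>2) \<partial>lborel) \<le> ennreal e"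
proof -
  have M0: "0 \<le> M" using A0(2)[of 0] norm_ge_zero order_trans by blast
  obtain G where G: "has_weak_gradient u G \<Omega>" using u(1) by (auto simp: H1A0_space_def H1A_space_def)
  have "sqrt e > 0" using e by simp
  then obtain \<phi> where \<phi>: "\<phi> \<in> test_functions \<Omega>" "H1A_norm A \<Omega> (\<lambda>x. u x - \<phi> x) < sqrt e"
    using u(1) unfolding H1A0_space_def by blast
  obtain K where K: "compact K" "K \<subseteq> \<Omega>" "\<And>x. x \<notin> K \<Longrightarrow> \<phi> x = 0" "\<And>x. x \<notin> K \<Longrightarrow> grad \<phi> x = 0"
    using \<phi>(1) by (rule test_function_support) blast
  have \<phi>m: "\<phi> \<in> borel_measurable borel"
    by (rule borel_measurable_continuous_onI[OF test_function_continuous[OF \<phi>(1)]])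
  note gm = borel_measurable_continuous_onI[OF grad_continuous[OF \<phi>(1)]]
  have compact_fin: "(\<integral>\<^sup>+x. ennreal ((norm (f x))\<^sup>2) \<partial>lborel) < \<infinity>"
    if "continuous_on UNIV f" "\<And>x. x \<notin> K \<Longrightarrow> f x = 0" for f :: "real^'n \<Rightarrow> 'b::euclidean_space"
  proof -
    have "integrable lborel (\<lambda>x. (norm (f x))\<^sup>2)"
      by (rule integrable_continuous_compact_support[OF _ K(1)]) (use that in \<open>auto intro!: continuous_intros\<close>)
    then have "(\<integral>\<^sup>+x. ennreal (norm ((norm (f x))\<^sup>2)) \<partial>lborel) < \<infinity>" by (simp add: integrable_iff_bounded)
    then show ?thesis by simp
  qed
  have two: "2 * a + 2 * b < (\<infinity>::ennreal)" if "a < \<infinity>" "b < \<infinity>" for a b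
    using that by (simp add: ennreal_mult_less_top)
  have fin_add: "(\<integral>\<^sup>+x. ennreal ((norm (f x - g x))\<^sup>2) \<partial>lborel) < \<infinity>"
    if "f \<in> borel_measurable borel" "g \<in> borel_measurable borel" "(\<integral>\<^sup>+x. ennreal ((norm (f x))\<^sup>2) \<partial>lborel) < \<infinity>"
      "(\<integral>\<^sup>+x. ennreal ((norm (g x))\<^sup>2) \<partial>lborel) < \<infinity>" for f g :: "real^'n \<Rightarrow> 'b::euclidean_space"
  proof -
    have "(\<integral>\<^sup>+x. ennreal ((norm (f x + - g x))\<^sup>2) \<partial>lborel)
      \<le> 2 * (\<integral>\<^sup>+x. ennreal ((norm (f x))\<^sup>2) \<partial>lborel) + 2 * (\<integral>\<^sup>+x. ennreal ((norm (- g x))\<^sup>2) \<partial>lborel)"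
      using that(1,2) by (intro nn_integral_power2_add_le borel_measurable_uminus)
    also have "\<dots> < \<infinity>" using that(3,4) by (intro two) simp_all
    finally show ?thesis by simp
  qed
  \<comment> \<open>Finiteness must be known beforehand: \<open>enn2real\<close> sends infinity to
    0, so a small value of \<open>H1A_norm\<close> alone would not exclude infinite
    integrals.\<close>
  have fin_u: "(\<integral>\<^sup>+x. ennreal ((norm (u0 x - \<phi> x))\<^sup>2) \<partial>lborel) < \<infinity>"
    by (rule fin_add[OF u0(1) \<phi>m U compact_fin[OF test_function_continuous[OF \<phi>(1)] K(3)]])
  have fin_\<phi>: "(\<integral>\<^sup>+x. ennreal ((norm (mgrad A0 \<phi> x))\<^sup>2) \<partial>lborel) < \<infinity>"
    unfolding mgrad_eq
  proof (rule fin_add[OF gm vec_mult_of_real_measurable[OF A0(1) \<phi>m] compact_fin[OF grad_continuous[OF \<phi>(1)] K(4)]])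
    have "(\<integral>\<^sup>+x. ennreal ((norm ((\<chi> j. \<i> * complex_of_real (A0 x $ j) * \<phi> x) :: complex^'n))\<^sup>2) \<partial>lborel)
      \<le> ennreal (M\<^sup>2) * (\<integral>\<^sup>+x. ennreal ((norm (\<phi> x))\<^sup>2) \<partial>lborel)"
      using A0(2) M0 by (intro nn_integral_power2_le_mult \<phi>m) (auto simp: norm_vec_mult_of_real intro!: mult_right_mono)
    also have "\<dots> < \<infinity>"
      using compact_fin[OF test_function_continuous[OF \<phi>(1)] K(3)] by (simp add: ennreal_mult_less_top)
    finally show "(\<integral>\<^sup>+x. ennreal ((norm ((\<chi> j. \<i> * complex_of_real (A0 x $ j) * \<phi> x) :: complex^'n))\<^sup>2) \<partial>lborel) < \<infinity>" .
  qed
  have fin_D: "(\<integral>\<^sup>+x. ennreal ((norm (D0 x - mgrad A0 \<phi> x))\<^sup>2) \<partial>lborel) < \<infinity>"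
    by (rule fin_add[OF D0(1) mgrad_measurable[OF A0(1) \<phi>(1)] E fin_\<phi>])
  have L2: "(LINT x:\<Omega>|lebesgue. (norm (u x - \<phi> x))\<^sup>2) = enn2real (\<integral>\<^sup>+x. ennreal ((norm (u0 x - \<phi> x))\<^sup>2) \<partial>lborel)"
  proof -
    have mb: "(\<lambda>x. (norm (u0 x - \<phi> x))\<^sup>2) \<in> borel_measurable borel"
      using u0(1) \<phi>m by measurable
    have "(LINT x:\<Omega>|lebesgue. (norm (u x - \<phi> x))\<^sup>2) = (LINT x|lebesgue. (norm (u0 x - \<phi> x))\<^sup>2)"
      unfolding set_lebesgue_integral_def
    proof (rule integral_cong_AE)
      have "(\<lambda>x. (norm (u0 x - \<phi> x))\<^sup>2) \<in> borel_measurable lborel" using mb by simp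
      then show m': "(\<lambda>x. (norm (u0 x - \<phi> x))\<^sup>2) \<in> borel_measurable lebesgue" by (rule measurable_completion)
      show AE: "AE x in lebesgue. indicator \<Omega> x *\<^sub>R (norm (u x - \<phi> x))\<^sup>2 = (norm (u0 x - \<phi> x))\<^sup>2"
        using AE_completion[OF u0(2)]
      proof eventually_elim
        case (elim x)
        then show ?case using u(2)[of x] K(2) K(3)[of x] by (cases "x \<in> \<Omega>") auto
      qed
      have "AE x in lebesgue. (norm (u0 x - \<phi> x))\<^sup>2 = indicator \<Omega> x *\<^sub>R (norm (u x - \<phi> x))\<^sup>2"
        using AE by eventually_elim simp
      from borel_measurable_AE[OF m' this]
      show "(\<lambda>x. indicator \<Omega> x *\<^sub>R (norm (u x - \<phi> x))\<^sup>2) \<in> borel_measurable lebesgue" .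
    qed
    also have "\<dots> = (LINT x|lborel. (norm (u0 x - \<phi> x))\<^sup>2)"
      using mb by (intro integral_completion) simp
    also have "\<dots> = enn2real (\<integral>\<^sup>+x. ennreal ((norm (u0 x - \<phi> x))\<^sup>2) \<partial>lborel)"
      using mb by (intro integral_eq_nn_integral) auto
    finally show ?thesis .
  qed
  have En: "magnetic_energy A \<Omega> (\<lambda>x. u x - \<phi> x) = (\<integral>\<^sup>+x. ennreal ((norm (D0 x - mgrad A0 \<phi> x))\<^sup>2) \<partial>lborel)"
  proof -
    have "magnetic_energy A \<Omega> (\<lambda>x. u x - \<phi> x) = (\<integral>\<^sup>+x. ennreal ((norm (D0 x - mgrad A0 \<phi> x))\<^sup>2) \<partial>lebesgue)"
      unfolding magnetic_energy_def
    proof (rule nn_integral_cong_AE)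
      show "AE x in lebesgue. ennreal ((norm (magnetic_gradient A \<Omega> (\<lambda>x. u x - \<phi> x) x))\<^sup>2) * indicator \<Omega> x = ennreal ((norm (D0 x - mgrad A0 \<phi> x))\<^sup>2)"
        using AE_completion[OF D0(2)] magnetic_gradient_diff_test_function[OF \<Omega> G \<phi>(1), of A]
      proof eventually_elim
        case (elim x)
        show ?case
        proof (cases "x \<in> \<Omega>")
          case True
          then have "magnetic_gradient A \<Omega> (\<lambda>x. u x - \<phi> x) x = D0 x - mgrad A0 \<phi> x"
            using elim A0(3)[OF True] by (simp add: mgrad_def)
          then show ?thesis using True by simp
        next
          case False
          then have "x \<notin> K" using K(2) by blast
          then have "mgrad A0 \<phi> x = 0" using K(3,4) by (simp add: mgrad_def vec_eq_iff)
          moreover have "D0 x = 0" using elim False by simp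
          ultimately show ?thesis using False by simp
        qed
      qed
    qed
    then show ?thesis by (simp only: nn_integral_completion)
  qed
  have "(LINT x:\<Omega>|lebesgue. (norm (u x - \<phi> x))\<^sup>2) + enn2real (magnetic_energy A \<Omega> (\<lambda>x. u x - \<phi> x)) < e"
    using \<phi>(2) unfolding H1A_norm_def by (simp only: real_sqrt_less_iff)
  then have sum: "enn2real (\<integral>\<^sup>+x. ennreal ((norm (u0 x - \<phi> x))\<^sup>2) \<partial>lborel) + enn2real (\<integral>\<^sup>+x. ennreal ((norm (D0 x - mgrad A0 \<phi> x))\<^sup>2) \<partial>lborel) < e"
    unfolding L2 En .
  have le: "X \<le> ennreal e" if "X < \<infinity>" "enn2real X < e" for X :: ennreal
    using that by (cases X) (auto intro: ennreal_leI)
  have "(\<integral>\<^sup>+x. ennreal ((norm (u0 x - \<phi> x))\<^sup>2) \<partial>lborel) \<le> ennreal e"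
    by (rule le[OF fin_u]) (use sum enn2real_nonneg[of "\<integral>\<^sup>+x. ennreal ((norm (D0 x - mgrad A0 \<phi> x))\<^sup>2) \<partial>lborel"] in linarith)
  moreover have "(\<integral>\<^sup>+x. ennreal ((norm (D0 x - mgrad A0 \<phi> x))\<^sup>2) \<partial>lborel) \<le> ennreal e"
    by (rule le[OF fin_D]) (use sum enn2real_nonneg[of "\<integral>\<^sup>+x. ennreal ((norm (u0 x - \<phi> x))\<^sup>2) \<partial>lborel"] in linarith)
  ultimately show ?thesis using \<phi>(1) by blast
qed

theorem theorem1p2:
  fixes \<Omega> :: "(real^'n) set" and A :: "real^'n \<Rightarrow> real^'n"
    and u :: "real^'n \<Rightarrow> complex" and e :: "real^'n"
  assumes "open \<Omega>" and "bounded \<Omega>" and "lipschitz_boundary \<Omega>"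
    and "A \<in> borel_measurable lebesgue" and "locally_bounded A" and "Ck_on_closure 2 A \<Omega>"
    and "u \<in> H1A0_space A \<Omega>" and "\<And>x. x \<notin> \<Omega> \<Longrightarrow> u x = 0"
    and "norm e = 1"
  shows "((\<lambda>s::real. ennreal (1 - s) *
            (\<integral>\<^sup>+(x, y). ennreal
               ((cmod (u x - exp (\<i> * complex_of_real ((x - y) \<bullet> A ((x + y) /\<^sub>R 2))) * u y))\<^sup>2
                 / norm (x - y) powr (real CARD('n) + 2 * s)) \<partial>lebesgue))
          \<longlongrightarrow> (1 / 2 * (\<integral>\<^sup>+\<omega>\<in>sphere 0 1. ennreal (\<bar>\<omega> \<bullet> e\<bar>\<^sup>2) \<partial>hausdorff_measure (CARD('n) - 1)))
              * (\<integral>\<^sup>+x\<in>\<Omega>. ennreal ((norm (magnetic_gradient A \<Omega> u x))\<^sup>2) \<partial>lebesgue))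
         (at_left 1)"
proof -
  note \<Omega> = assms(1)
  have u_space: "u \<in> L2_space \<Omega>" "magnetic_energy A \<Omega> u < \<infinity>"
    using assms(7) by (auto simp: H1A0_space_def H1A_space_def)
  have u_eq: "(\<lambda>x. indicator \<Omega> x *\<^sub>R u x) = u" using assms(8) by (auto simp: fun_eq_iff indicator_def)
  have u_meas: "u \<in> borel_measurable lebesgue"
    using u_space(1) by (simp add: L2_space_def set_borel_measurable_def u_eq)
  obtain u0 where u0: "u0 \<in> borel_measurable borel" "AE x in lborel. u x = u0 x"
    using lebesgue_measurable_borel_representative[OF u_meas] by blast
  \<comment> \<open>A ball around \<Omega>; being convex, it contains all midpoints of points of
    \<Omega>.\<close>
  obtain R where R: "\<And>x. x \<in> \<Omega> \<Longrightarrow> norm x < R"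
    using assms(2) by (auto simp: bounded_pos_less)
  have "bounded (A ` cball 0 R)" by (rule locally_bounded_compact[OF assms(5) compact_cball])
  then obtain M0 where M0: "\<And>x. x \<in> cball 0 R \<Longrightarrow> norm (A x) \<le> M0"
    unfolding bounded_iff by blast
  define M where "M = max 0 M0"
  have M: "norm (A x) \<le> M" if "norm x < R" for x using M0[of x] that by (auto simp: M_def le_max_iff_disj)
  obtain A1 where A1: "A1 \<in> borel_measurable borel" "AE x in lborel. A x = A1 x"
    using lebesgue_measurable_borel_representative[OF assms(4)] by blast
  have cA: "continuous_on \<Omega> A"
    using assms(6) closure_subset[of \<Omega>] continuous_on_subset by (auto simp: Ck_on_closure_def)
  define A0 where "A0 x = (if x \<in> \<Omega> then A x else if norm (A1 x) \<le> M then A1 x else 0)" for x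
  have A0_meas: "A0 \<in> borel_measurable borel"
  proof -
    have "(\<lambda>x. indicator \<Omega> x *\<^sub>R A x) \<in> borel_measurable borel"
      using \<Omega> cA by (intro borel_measurable_continuous_on_indicator) auto
    moreover have "(\<lambda>x. indicator (- \<Omega>) x *\<^sub>R (if norm (A1 x) \<le> M then A1 x else 0)) \<in> borel_measurable borel"
      using A1(1) \<Omega> by measurable
    ultimately have "(\<lambda>x. indicator \<Omega> x *\<^sub>R A x + indicator (- \<Omega>) x *\<^sub>R (if norm (A1 x) \<le> M then A1 x else 0)) \<in> borel_measurable borel"
      by (rule borel_measurable_add)
    moreover have "(\<lambda>x. indicator \<Omega> x *\<^sub>R A x + indicator (- \<Omega>) x *\<^sub>R (if norm (A1 x) \<le> M then A1 x else 0)) = A0"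
      by (auto simp: fun_eq_iff A0_def indicator_def)
    ultimately show ?thesis by simp
  qed
  have A0_bound: "norm (A0 x) \<le> M" for x
    using M[OF R, of x] by (auto simp: A0_def M_def)
  have A0_eq: "A0 x = A x" if "x \<in> \<Omega>" for x using that by (simp add: A0_def)
  have A0_AE: "AE x in lborel. norm x < R \<longrightarrow> A x = A0 x"
    using A1(2)
  proof eventually_elim
    case (elim x)
    then show ?case using M[of x] by (simp add: A0_def)
  qed
  have cA0: "continuous_on \<Omega> A0" using cA A0_eq by (simp cong: continuous_on_cong)
  let ?D = "\<lambda>x. indicator \<Omega> x *\<^sub>R magnetic_gradient A \<Omega> u x"
  have D_meas: "?D \<in> borel_measurable lebesgue"
  proof -
    obtain G where "has_weak_gradient u G \<Omega>" using assms(7) by (auto simp: H1A0_space_def H1A_space_def)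
    then have "has_weak_gradient u (weak_gradient \<Omega> u) \<Omega>"
      unfolding weak_gradient_def by (rule someI[of "\<lambda>G. has_weak_gradient u G \<Omega>"])
    then have W: "(\<lambda>x. indicator \<Omega> x *\<^sub>R weak_gradient \<Omega> u x) \<in> borel_measurable lebesgue"
      by (rule weak_gradient_measurable[OF \<Omega>])
    have V: "(\<lambda>x. (\<chi> j. \<i> * complex_of_real (A0 x $ j) * u0 x) :: complex^'n) \<in> borel_measurable lebesgue"
      using vec_mult_of_real_measurable[OF A0_meas u0(1)] by (intro measurable_completion) simp
    have diff: "(\<lambda>x. indicator \<Omega> x *\<^sub>R weak_gradient \<Omega> u x - indicator \<Omega> x *\<^sub>R (\<chi> j. \<i> * complex_of_real (A0 x $ j) * u0 x)) \<in> borel_measurable lebesgue"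
      using \<Omega> by (intro borel_measurable_diff W borel_measurable_scaleR V borel_measurable_indicator) auto
    \<comment> \<open>The Borel data \<open>A0\<close> and \<open>u0\<close> replace
      \<open>A\<close> and \<open>u\<close> up to a null set, and completeness of Lebesgue measure
      carries measurability back.\<close>
    show ?thesis
    proof (rule borel_measurable_AE[OF diff])
      show "AE x in lebesgue. indicator \<Omega> x *\<^sub>R weak_gradient \<Omega> u x - indicator \<Omega> x *\<^sub>R (\<chi> j. \<i> * complex_of_real (A0 x $ j) * u0 x) = ?D x"
        using AE_completion[OF u0(2)]
      proof eventually_elim
        case (elim x)
        then show ?case using A0_eq[of x] by (cases "x \<in> \<Omega>") (auto simp: magnetic_gradient_def vec_eq_iff)
      qed
    qed
  qed
  obtain D0 where D0: "D0 \<in> borel_measurable borel" "AE x in lborel. ?D x = D0 x"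
    using lebesgue_measurable_borel_representative[OF D_meas] by blast
  have energy: "(\<integral>\<^sup>+x\<in>\<Omega>. ennreal ((norm (magnetic_gradient A \<Omega> u x))\<^sup>2) \<partial>lebesgue) = (\<integral>\<^sup>+x. ennreal ((norm (D0 x))\<^sup>2) \<partial>lborel)"
  proof -
    have "(\<integral>\<^sup>+x\<in>\<Omega>. ennreal ((norm (magnetic_gradient A \<Omega> u x))\<^sup>2) \<partial>lebesgue)
      = (\<integral>\<^sup>+x. ennreal ((norm (magnetic_gradient A \<Omega> u x))\<^sup>2) * indicator \<Omega> x \<partial>lborel)"
      by (rule nn_integral_completion)
    also have "\<dots> = (\<integral>\<^sup>+x. ennreal ((norm (D0 x))\<^sup>2) \<partial>lborel)"
    proof (rule nn_integral_cong_AE)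
      show "AE x in lborel. ennreal ((norm (magnetic_gradient A \<Omega> u x))\<^sup>2) * indicator \<Omega> x = ennreal ((norm (D0 x))\<^sup>2)"
        using D0(2)
      proof eventually_elim
        case (elim x)
        have "norm (D0 x) = norm (?D x)" by (simp only: elim)
        then show ?case by (cases "x \<in> \<Omega>") simp_all
      qed
    qed
    finally show ?thesis .
  qed
  have E_fin: "(\<integral>\<^sup>+x. ennreal ((norm (D0 x))\<^sup>2) \<partial>lborel) < \<infinity>"
    using u_space(2) unfolding magnetic_energy_def energy .
  have U_fin: "(\<integral>\<^sup>+x. ennreal ((norm (u0 x))\<^sup>2) \<partial>lborel) < \<infinity>"
  proof -
    have "integrable lebesgue (\<lambda>x. indicator \<Omega> x *\<^sub>R (norm (u x))\<^sup>2)"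
      using u_space(1) by (simp add: L2_space_def set_integrable_def)
    moreover have "(\<lambda>x. indicator \<Omega> x *\<^sub>R (norm (u x))\<^sup>2) = (\<lambda>x. (norm (u x))\<^sup>2)"
      using assms(8) by (auto simp: fun_eq_iff indicator_def)
    ultimately have "(\<integral>\<^sup>+x. ennreal (norm ((norm (u x))\<^sup>2)) \<partial>lebesgue) < \<infinity>"
      by (simp only: integrable_iff_bounded)
    then have "(\<integral>\<^sup>+x. ennreal ((norm (u x))\<^sup>2) \<partial>lborel) < \<infinity>"
      by (simp add: nn_integral_completion)
    also have "(\<integral>\<^sup>+x. ennreal ((norm (u x))\<^sup>2) \<partial>lborel) = (\<integral>\<^sup>+x. ennreal ((norm (u0 x))\<^sup>2) \<partial>lborel)"
      by (rule nn_integral_cong_AE) (use u0(2) in \<open>eventually_elim, simp\<close>)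
    finally show ?thesis .
  qed
  define E where "E = enn2real (\<integral>\<^sup>+x. ennreal ((norm (D0 x))\<^sup>2) \<partial>lborel)"
  define U where "U = enn2real (\<integral>\<^sup>+x. ennreal ((norm (u0 x))\<^sup>2) \<partial>lborel)"
  have EU: "(\<integral>\<^sup>+x. ennreal ((norm (D0 x))\<^sup>2) \<partial>lborel) = ennreal E" "0 \<le> E"
    "(\<integral>\<^sup>+x. ennreal ((norm (u0 x))\<^sup>2) \<partial>lborel) = ennreal U" "0 \<le> U"
    using E_fin U_fin by (simp_all add: E_def U_def)
  have lim: "((\<lambda>s. ennreal (1 - s) * (\<integral>\<^sup>+h. (\<integral>\<^sup>+x. ennreal ((norm (mdiff A0 u0 h x))\<^sup>2) \<partial>lborel) * ennreal (norm h powr - (real CARD('n) + 2 * s)) \<partial>lborel))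
    \<longlongrightarrow> ennreal (unit_ball_vol (real CARD('n)) / 2 * E)) (at_left 1)"
  proof (rule tendsto_nn_integral_mdiff[OF \<Omega> A0_meas A0_bound cA0 u0(1) D0(1) _ EU(3,4,1,2)])
    fix e' :: real assume "e' > 0"
    then show "\<exists>\<phi>\<in>test_functions \<Omega>. (\<integral>\<^sup>+x. ennreal ((norm (u0 x - \<phi> x))\<^sup>2) \<partial>lborel) \<le> ennreal e' \<and>
        (\<integral>\<^sup>+x. ennreal ((norm (D0 x - mgrad A0 \<phi> x))\<^sup>2) \<partial>lborel) \<le> ennreal e'"
      by (intro magnetic_approximation[OF \<Omega> A0_meas A0_bound _ assms(7) _ u0 D0 E_fin U_fin])
         (simp_all add: A0_eq assms(8))
  qed
  \<comment> \<open>The completed product measure is removed first; then the Borel representatives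
    are exchanged off a null set of pairs, and \<open>y = x + h\<close> is substituted.\<close>
  have double: "(\<integral>\<^sup>+(x, y). ennreal ((cmod (u x - exp (\<i> * complex_of_real ((x - y) \<bullet> A ((x + y) /\<^sub>R 2))) * u y))\<^sup>2
                 / norm (x - y) powr p) \<partial>lebesgue)
     = (\<integral>\<^sup>+h. (\<integral>\<^sup>+x. ennreal ((norm (mdiff A0 u0 h x))\<^sup>2) \<partial>lborel) * ennreal (norm h powr - p) \<partial>lborel)" for p
  proof -
    have supp: "u x = 0" if "R \<le> norm x" for x using R[of x] assms(8)[of x] that by force
    show ?thesis
      unfolding nn_integral_completion
      by (rule trans[OF nn_integral_gagliardo_cong[OF u0(2) A0_AE] nn_integral_gagliardo_eq[OF A0_meas u0(1)]]) (rule supp)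
  qed
  have const: "(1 / 2 * (\<integral>\<^sup>+\<omega>\<in>sphere 0 1. ennreal (\<bar>\<omega> \<bullet> e\<bar>\<^sup>2) \<partial>hausdorff_measure (CARD('n) - 1)))
              * (\<integral>\<^sup>+x\<in>\<Omega>. ennreal ((norm (magnetic_gradient A \<Omega> u x))\<^sup>2) \<partial>lebesgue)
      = ennreal (unit_ball_vol (real CARD('n)) / 2 * E)"
  proof -
    have "(\<integral>\<^sup>+\<omega>\<in>sphere 0 1. ennreal (\<bar>\<omega> \<bullet> e\<bar>\<^sup>2) \<partial>hausdorff_measure (CARD('n) - 1)) = ennreal (unit_ball_vol (real CARD('n)))"
      using nn_integral_hausdorff_sphere_inner_square[OF assms(9)] by simp
    moreover have "ennreal 1 / ennreal 2 = ennreal (1 / 2)" by (rule divide_ennreal) auto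
    then have "(1 / 2 :: ennreal) = ennreal (1 / 2)" by (simp only: ennreal_1 ennreal_numeral)
    moreover have "ennreal (1 / 2) * ennreal (unit_ball_vol (real CARD('n))) = ennreal (1 / 2 * unit_ball_vol (real CARD('n)))"
      by (intro ennreal_mult[symmetric]) auto
    moreover have "ennreal (1 / 2 * unit_ball_vol (real CARD('n))) * ennreal E = ennreal (1 / 2 * unit_ball_vol (real CARD('n)) * E)"
      using EU(2) by (intro ennreal_mult[symmetric]) auto
    ultimately show ?thesis unfolding energy EU(1) by simp
  qed
  show ?thesis unfolding const double by (rule lim)
qed

end
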